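(* Let $D$ be the definite quaternion algebra over $\mathbb{Q}$ of discriminant $2$, and let $E$ be an imaginary quadratic field which embeds into $D$. Let $\pi'$ be the cuspidal automorphic representation of $\mathrm{PGL}_2(\mathbb{A})$ generated by the newform $\eta(z)^8\eta(2z)^8$ of weight $8$ and level $\Gamma_0(2)$. Suppose that $-\Delta_E$ is a prime number and $\Delta_E\equiv 5 \pmod 8$. Then $L(\tfrac12,\pi'\otimes\eta_E)\neq 0$.
   Context: $\eta$ is the Dedekind eta function; $\mathbb{A}$ is the adèle ring of $\mathbb{Q}$. $\Delta_E$ is the fundamental discriminant of $E$ and $\eta_E$ the quadratic idèle class character attached to $E/\mathbb{Q}$. $L(s,\pi'\otimes\eta_E)$ is normalized with center $s=\tfrac12$. (An imaginary quadratic field embeds into $D$ iff $2$ is not split in $E$.) In the paper $\pi'$ is defined as the Jacquet–Langlands transfer of the automorphic representation generated by the unique (up to scalar) harmonic polynomial invariant under the unit group of the Hurwitz order of degree $3$; the space of newforms of weight $8$ and level $\Gamma_0(2)$ is one-dimensional and spanned by $\eta(z)^8\eta(2z)^8$. *)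

theory Defs
  imports "HOL-Complex_Analysis.Complex_Analysis"
          "HOL-Computational_Algebra.Formal_Power_Series"
          "HOL-Number_Theory.Number_Theory"
begin

text \<open>Fourier coefficients a(n) of the newform
  eta(z)^8 eta(2z)^8 = q * prod_{m>=1} (1 - q^m)^8 (1 - q^(2m))^8
  (weight 8, level Gamma_0(2)). The coefficient of q^n only depends on the
  factors with m <= n, so the product is truncated there.\<close>
definition eta_coeff :: "nat \<Rightarrow> int" where
  "eta_coeff n =
     fps_nth (fps_X * (\<Prod>m\<in>{1..n}. (1 - fps_X ^ m) ^ 8 * (1 - fps_X ^ (2 * m)) ^ 8)) n"

definition kronecker_prime :: "int \<Rightarrow> nat \<Rightarrow> int" where
  "kronecker_prime \<Delta> p =
     (if p = 2 then
        (if even \<Delta> then 0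
         else if \<Delta> mod 8 = 1 \<or> \<Delta> mod 8 = 7 then 1 else -1)
      else Legendre \<Delta> (int p))"

text \<open>Kronecker symbol (Delta / n) for n >= 1, extended completely multiplicatively;
  this is the Dirichlet character attached to the quadratic idele class
  character eta_E of the field of discriminant Delta.\<close>
definition kronecker :: "int \<Rightarrow> nat \<Rightarrow> int" where
  "kronecker \<Delta> n =
     (if n = 0 then 0
      else (\<Prod>p\<in>prime_factors n. kronecker_prime \<Delta> p ^ multiplicity p n))"

definition twisted_coeff :: "int \<Rightarrow> nat \<Rightarrow> complex" where
  "twisted_coeff \<Delta> n = of_int (eta_coeff n * kronecker \<Delta> n)"

text \<open>L(s, pi' (x) eta_E) with centre s = 1/2: in Re s > 1 it is the Dirichlet
  series sum_n a(n) eta_E(n) n^{-(s + 7/2)}; L is its analytic continuation.\<close>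
definition is_twisted_L :: "int \<Rightarrow> (complex \<Rightarrow> complex) \<Rightarrow> bool" where
  "is_twisted_L \<Delta> L \<longleftrightarrow> L holomorphic_on UNIV \<and>
     (\<forall>s. Re s > 1 \<longrightarrow>
        (\<lambda>n. twisted_coeff \<Delta> n / of_nat n powr (s + 7 / 2)) sums L s)"

text \<open>E = Q(sqrt Delta) embeds into the definite quaternion algebra of
  discriminant 2 iff 2 is not split in E, i.e. (Delta/2) <> 1.\<close>
definition embeds_in_D :: "int \<Rightarrow> bool" where
  "embeds_in_D \<Delta> \<longleftrightarrow> kronecker_prime \<Delta> 2 \<noteq> 1"

end

theory Submission
  imports Defs "HOL-Real_Asymp.Real_Asymp"
begin

text \<open>Write \<Delta> = - p, let chi be the Legendre symbol modulo p and f(z) = eta(z)^8 eta(2 z)^8.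
  Multiplying the twisted Dirichlet series by the Gauss sum turns it into the Mellin transform of the
  sum of chi(u) f(u/p + i y) over u modulo p, which is entire because f decays at every cusp. At the
  centre the transform is p^(-3) times the sum of chi(u) K(u/p), where K(u/p) is the integral of
  f(z) (p z - u)^3 from u/p to \<infinity>. The forms met along the continued fraction of u/p all have
  discriminant p^2, and for them the integral along an edge is a coboundary plus a multiple of the
  cube of the difference of the values of the form at the two ends. Summing by means of an involution
  on the solutions of y L + 2 Y l = p in positive integers gives 120 r N for the imaginary part, where
  r > 0 is the second moment of f on the imaginary axis and N is the integer sum of
  chi(y l) (2 Y l - y L) y l Y L over these solutions. Modulo 2 only the solution y = L, Y = l
  contributes to N, and it is the unique representation p = y^2 + 2 Y^2; hence N is odd.

  The functional equation of f on the imaginary axis comes from the logarithmic derivative and the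
  transformation law of the Eisenstein series of weight 2. The Dirichlet series converges absolutely
  for Re s > 1 by Parseval's identity and the bound for y^4 |f(z)|.\<close>

section \<open>Sums over the solutions of y L + 2 Y l = p\<close>

text \<open>The maps z + 1 and -1/(2 z) suffice: under them every rational is equivalent to
  \<infinity>, so one functional equation, obtained from the imaginary axis, governs all cusps and
  all periods. It also reduces the four even moments of f that occur at the cusp 0 to those of order
  0 and 2. The moment of order 0 has no usable value and has to cancel; it does, because it occurs
  only in the coboundary. A single continued fraction gives no closed formula. Over all solutions at
  once the expansions telescope, and steps that belong to different u can be paired with each other.
  The condition p = 3 modulo 8 acts through the character. Since chi(-1) = -1, the sum of the
  periods against chi is purely imaginary, so nothing is lost by taking imaginary parts. Since
  chi(-2) = 1, the character does not see the exchange of the two roots of a form, and p is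
  represented by x^2 + 2 z^2; modulo 8 both x and z must then be odd. The constant 120 is 2 * 10 *
  6: the halves u and p - u, the coefficient of the cube along an edge, and 3 * 8 / 4 from
  eliminating b^2 = p^2 - 8 m in a cubic sum.\<close>

lemma sum_antisym_involution_eq_0:
  fixes g :: "'a \<Rightarrow> int"
  assumes "\<And>x. x \<in> A \<Longrightarrow> s x \<in> A" "\<And>x. x \<in> A \<Longrightarrow> s (s x) = x"
    and "\<And>x. x \<in> A \<Longrightarrow> g (s x) = - g x"
  shows "sum g A = 0"
proof -
  have "sum g A = sum (\<lambda>x. g (s x)) A"
    by (rule sum.reindex_bij_witness[of _ s s]) (use assms in auto)
  also have "\<dots> = - sum g A"
    using assms(3) by (simp add: sum_negf)
  finally show ?thesis by simp
qed

type_synonym quad = "int \<times> int \<times> int \<times> int"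

text \<open>A quadruple stands for the two cusps -y/(2 Y) < 0 < l/L, the roots of (y + 2 Y z)(l - L
  z); the equation says that this form has discriminant p^2.\<close>

definition quads :: "int \<Rightarrow> quad set" where
  "quads p = {(y, Y, l, L). y > 0 \<and> Y > 0 \<and> l > 0 \<and> L > 0 \<and> y * L + 2 * Y * l = p}"

text \<open>Up to sign this is the substitution z -> -1/(2 z), which exchanges the roles of the two
  linear factors.\<close>

fun qswap :: "quad \<Rightarrow> quad" where
  "qswap (y, Y, l, L) = (L, l, Y, y)"

text \<open>Where it is defined, namely for l \<noteq> L, this is an involution; composed with the swap it is a
  step of a Euclidean algorithm that brings the cusp l/L to 1.\<close>
fun qflip :: "quad \<Rightarrow> quad" where
  "qflip (y, Y, l, L) =
     (if L < l then (L, l - L, Y, y + 2 * Y)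
      else if 2 * l < L then (L - 2 * l, l, Y + y, y)
      else (2 * l - L, L - l, y + Y, y + 2 * Y))"

text \<open>The form attached to a quadruple is (y + 2 Y z) (l - L z) = 2 a z^2 + b z + c with a = - Y L.
  In terms of it h = c + a, d = c - a, m = - a c, and e is the value at 1 minus a.\<close>
fun qb :: "quad \<Rightarrow> int" where "qb (y, Y, l, L) = 2 * Y * l - y * L"
fun qh :: "quad \<Rightarrow> int" where "qh (y, Y, l, L) = y * l - Y * L"
fun qd :: "quad \<Rightarrow> int" where "qd (y, Y, l, L) = y * l + Y * L"
fun qm :: "quad \<Rightarrow> int" where "qm (y, Y, l, L) = y * l * Y * L"
definition qe :: "quad \<Rightarrow> int" where "qe q = qb q + qh q"
text \<open>Chosen because \<open>qflip\<close> multiplies it by 1 or -1, and always so that its odd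
  powers times the character change sign.\<close>

definition qs :: "quad \<Rightarrow> int" where "qs q = qb q + 2 * qh q"

text \<open>Here the Euclidean algorithm on the cusp l/L stops. The set \<open>qstart\<close>, where
  it begins, is the image under \<open>qswap\<close>.\<close>

definition qend :: "int \<Rightarrow> quad set" where
  "qend p = {(y, Y, l, L). (y, Y, l, L) \<in> quads p \<and> l = 1 \<and> L = 1}"

definition qstart :: "int \<Rightarrow> quad set" where
  "qstart p = {(y, Y, l, L). (y, Y, l, L) \<in> quads p \<and> y = 1 \<and> Y = 1}"

text \<open>Abstracts the Legendre symbol modulo a prime p = 3 (mod 8). That chi vanishes at the
  multiples of p follows from its oddness.\<close>

locale odd_residue_character =
  fixes p :: int and chi :: "int \<Rightarrow> int"
  assumes prime_p: "prime p" and p_mod_8: "p mod 8 = 3"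
    and chi_mult: "\<And>a b. chi (a * b) = chi a * chi b"
    and chi_cong: "\<And>a b. [a = b] (mod p) \<Longrightarrow> chi a = chi b"
    and chi_minus_1: "chi (-1) = -1" and chi_2: "chi 2 = -1"
    and chi_sq: "\<And>a. \<not> p dvd a \<Longrightarrow> chi a * chi a = 1"
begin

fun qchi :: "quad \<Rightarrow> int" where "qchi (y, Y, l, L) = chi (y * l)"

lemma p_ge_3: "p \<ge> 3"
  using prime_p p_mod_8 prime_gt_1_int[of p] by (cases "p = 2") auto

lemma odd_p: "odd p"
  using p_mod_8 by presburger

lemma chi_uminus: "chi (- a) = - chi a"
  using chi_mult[of "-1" a] chi_minus_1 by simp

lemma chi_minus_2: "chi (-2) = 1"
  using chi_uminus[of 2] chi_2 by simp

lemma quads_bounds: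
  assumes "(y, Y, l, L) \<in> quads p"
  shows "0 < y" "y < p" "0 < Y" "Y < p" "0 < l" "l < p" "0 < L" "L < p" "y * L + 2 * Y * l = p"
proof -
  have *: "y > 0" "Y > 0" "l > 0" "L > 0" "y * L + 2 * Y * l = p"
    using assms by (auto simp: quads_def)
  have "y * 1 \<le> y * L" "1 * L \<le> y * L" "Y * 1 \<le> Y * l" "1 * l \<le> Y * l" "Y * l > 0" "y * L > 0"
    using * by (auto intro: mult_left_mono mult_right_mono)
  moreover have "y * L + 2 * (Y * l) = p" using * by (simp add: mult.assoc)
  ultimately show "0 < y" "y < p" "0 < Y" "Y < p" "0 < l" "l < p" "0 < L" "L < p"
    "y * L + 2 * Y * l = p"
    using * by linarith+
qed

lemma finite_quads [simp]: "finite (quads p)"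
proof (rule finite_subset)
  show "quads p \<subseteq> {0..p} \<times> {0..p} \<times> {0..p} \<times> {0..p}"
  proof
    fix q assume q: "q \<in> quads p"
    obtain y Y l L where q': "q = (y, Y, l, L)" by (cases q)
    show "q \<in> {0..p} \<times> {0..p} \<times> {0..p} \<times> {0..p}"
      using quads_bounds[OF q[unfolded q']] by (simp add: q')
  qed
qed auto

lemma not_dvd_small: "0 < a \<Longrightarrow> a < p \<Longrightarrow> \<not> p dvd a"
  using zdvd_not_zless by blast

lemma chi_sq_small: "0 < a \<Longrightarrow> a < p \<Longrightarrow> chi a * chi a = 1"
  by (intro chi_sq not_dvd_small)

lemma qswap_in: "q \<in> quads p \<Longrightarrow> qswap q \<in> quads p"
  by (cases q) (auto simp: quads_def algebra_simps)

lemma qswap_qswap [simp]: "qswap (qswap q) = q"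
  by (cases q) auto

lemma q_swap [simp]:
  "qb (qswap q) = qb q" "qh (qswap q) = - qh q" "qd (qswap q) = qd q" "qm (qswap q) = qm q"
  by (cases q; simp add: algebra_simps)+

text \<open>The equation reads y L = -2 Y l modulo p, so chi(-2) = 1 gives chi(y L) = chi(Y l); the
  rest is multiplication by squares of character values.\<close>

lemma qchi_swap: assumes "q \<in> quads p" shows "qchi (qswap q) = qchi q"
proof -
  obtain y Y l L where q: "q = (y, Y, l, L)" by (cases q)
  note b = quads_bounds[OF assms[unfolded q]]
  have "[y * L = (-2) * (Y * l)] (mod p)"
    using b(9) by (simp add: cong_iff_dvd_diff mult.assoc)
  then have "chi (y * L) = chi (Y * l)"
    using chi_cong chi_mult[of "-2" "Y * l"] chi_minus_2 by fastforce
  then have *: "chi y * chi L = chi Y * chi l" by (simp add: chi_mult)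
  have sq: "chi y * chi y = 1" "chi Y * chi Y = 1" "chi l * chi l = 1" "chi L * chi L = 1"
    using b by (auto intro!: chi_sq_small)
  have "chi L * chi Y = (chi y * chi y) * (chi L * chi Y)" using sq by simp
  also have "\<dots> = (chi y * chi L) * (chi y * chi Y)" by (simp add: mult_ac)
  also have "\<dots> = chi y * chi l * (chi Y * chi Y)" unfolding * by (simp add: mult_ac)
  finally show ?thesis using sq by (simp add: q chi_mult)
qed

text \<open>Arithmetic excludes the ties: L = 2 l would make p even, and l = L divides the prime p
  and is smaller than p.\<close>

lemma quads_cases:
  assumes "(y, Y, l, L) \<in> quads p"
  obtains (R) "L < l" | (Lt) "2 * l < L" | (O) "l < L" "L < 2 * l" | (E) "l = 1" "L = 1"
proof -
  note b = quads_bounds[OF assms]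
  have "L \<noteq> 2 * l"
  proof
    assume "L = 2 * l" then have "p = 2 * (l * (y + Y))" using b(9) by (simp add: algebra_simps)
    then show False using odd_p by simp
  qed
  moreover have "l = 1" if "l = L"
  proof -
    have "l * (y + 2 * Y) = p" using b(9) that by (simp add: algebra_simps)
    then have "l dvd p" by (metis dvd_triv_left)
    then have "l = 1 \<or> l = p" using prime_p b(5) unfolding prime_int_iff by auto
    then show ?thesis using b by auto
  qed
  ultimately show ?thesis using R Lt O E by linarith
qed

lemma qflip_in:
  assumes "q \<in> quads p - qend p" shows "qflip q \<in> quads p - qend p"
proof -
  obtain y Y l L where q: "q = (y, Y, l, L)" by (cases q)
  have *: "(y, Y, l, L) \<in> quads p" using assms q by auto
  note b = quads_bounds[OF *]
  have e: "\<not> (l = 1 \<and> L = 1)" using assms q * by (auto simp: qend_def)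
  show ?thesis using *
  proof (cases rule: quads_cases)
    case R
    have "L * (y + 2 * Y) + 2 * (l - L) * Y = p" using b(9) by (simp add: algebra_simps)
    moreover have "y + 2 * Y \<noteq> 1" using b by linarith
    ultimately show ?thesis using b(1-8) R by (simp add: q quads_def qend_def)
  next
    case Lt
    have "(L - 2 * l) * y + 2 * l * (Y + y) = p" using b(9) by (simp add: algebra_simps)
    moreover have "Y + y \<noteq> 1" using b by linarith
    ultimately show ?thesis using b(1-8) Lt by (simp add: q quads_def qend_def)
  next
    case O
    have "(2 * l - L) * (y + 2 * Y) + 2 * (L - l) * (y + Y) = p" using b(9) by (simp add: algebra_simps)
    moreover have "y + Y \<noteq> 1" using b by linarith
    ultimately show ?thesis using b(1-8) O by (simp add: q quads_def qend_def)
  next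
    case E then show ?thesis using e by simp
  qed
qed

text \<open>The branches L < l and 2 l < L are inverse to each other, and the middle branch is its
  own inverse.\<close>

lemma qflip_qflip:
  assumes "q \<in> quads p - qend p" shows "qflip (qflip q) = q"
proof -
  obtain y Y l L where q: "q = (y, Y, l, L)" by (cases q)
  have *: "(y, Y, l, L) \<in> quads p" using assms q by auto
  note b = quads_bounds[OF *]
  have e: "\<not> (l = 1 \<and> L = 1)" using assms q * by (auto simp: qend_def)
  show ?thesis using *
  proof (cases rule: quads_cases)
    case E then show ?thesis using e by simp
  qed (use b(1-8) in \<open>simp_all add: q\<close>)
qed

text \<open>The pair (d, e) turns by a right angle, here in one sense and in \<open>q_flip_L\<close>
  in the other; up to sign d^3 and e^3 are interchanged.\<close>

lemma q_flip_R:
  assumes "L < l" and "q = (y, Y, l, L)"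
  shows "qd (qflip q) = qe q" "qe (qflip q) = - qd q" "qs (qflip q) = - qs q"
  using assms by (auto simp: qe_def qs_def algebra_simps)

lemma q_flip_L:
  assumes "2 * l < L" "0 < l" and "q = (y, Y, l, L)"
  shows "qd (qflip q) = - qe q" "qe (qflip q) = qd q" "qs (qflip q) = - qs q"
  using assms by (auto simp: qe_def qs_def algebra_simps)

lemma q_flip_O:
  assumes "l < L" "L < 2 * l" and "q = (y, Y, l, L)"
  shows "qd (qflip q) = qd q" "qs (qflip q) = qs q"
  using assms by (auto simp: qe_def qs_def algebra_simps)

text \<open>The cross difference l (y + 2 Y) - y (l - L) is exactly p.\<close>

lemma chi_step:
  assumes "(y, Y, l, L) \<in> quads p" "l \<noteq> L"
  shows "chi ((y + 2 * Y) * (l - L)) = chi (y * l)"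
proof -
  note b = quads_bounds[OF assms(1)]
  have "[l * (y + 2 * Y) = y * (l - L)] (mod p)"
    using b(9) by (simp add: cong_iff_dvd_diff algebra_simps)
  then have *: "chi l * chi (y + 2 * Y) = chi y * chi (l - L)"
    using chi_cong chi_mult by metis
  have "\<not> p dvd l - L"
    using b assms(2) zdvd_not_zless[of "\<bar>l - L\<bar>" p] by auto
  then have sq: "chi (l - L) * chi (l - L) = 1" "chi l * chi l = 1"
    using chi_sq chi_sq_small b by auto
  have "chi (y + 2 * Y) * chi (l - L) = (chi l * chi l) * chi (y + 2 * Y) * chi (l - L)" using sq by simp
  also have "\<dots> = chi l * chi (l - L) * (chi l * chi (y + 2 * Y))" by (simp add: mult_ac)
  also have "\<dots> = chi y * chi l * (chi (l - L) * chi (l - L))" unfolding * by (simp add: mult_ac)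
  finally show ?thesis using sq by (simp add: chi_mult)
qed

text \<open>After a swap the first and third entries are y + 2 Y and l - L for L < l, still y and l
  for 2 l < L, and y + 2 Y and L - l in the middle branch. There the oddness of chi produces the
  sign.\<close>

lemma qchi_flip:
  assumes "q \<in> quads p - qend p" "q = (y, Y, l, L)"
  shows "qchi (qflip q) = (if l < L \<and> L < 2 * l then - qchi q else qchi q)"
proof -
  have *: "(y, Y, l, L) \<in> quads p" using assms by auto
  note b = quads_bounds[OF *]
  have e: "\<not> (l = 1 \<and> L = 1)" using assms * by (auto simp: qend_def)
  have sw: "qchi (qflip q) = qchi (qswap (qflip q))"
    using qchi_swap qflip_in[OF assms(1)] by auto
  show ?thesis using *
  proof (cases rule: quads_cases)
    case R then show ?thesis using chi_step[OF *] b(1-8) unfolding sw by (simp add: assms(2))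
  next
    case Lt then show ?thesis using b(1-8) unfolding sw by (simp add: assms(2))
  next
    case O
    have "chi ((y + 2 * Y) * (L - l)) = - chi ((y + 2 * Y) * (l - L))"
      using chi_uminus[of "(y + 2 * Y) * (l - L)"] by (simp add: algebra_simps)
    then show ?thesis using chi_step[OF *] b(1-8) O unfolding sw by (simp add: assms(2))
  next
    case E then show ?thesis using e by auto
  qed
qed

section \<open>Cubic character sums over all solutions\<close>

lemma sum_swap:
  assumes "\<And>q. q \<in> quads p \<Longrightarrow> g (qswap q) = - (g q :: int)"
  shows "(\<Sum>q\<in>quads p. qchi q * g q) = 0"
  by (rule sum_antisym_involution_eq_0[where s = qswap])
     (simp_all only: qswap_in qswap_qswap qchi_swap assms mult_minus_right)

lemma sum_flip:
  assumes "\<And>q. q \<in> quads p - qend p \<Longrightarrow> qchi (qflip q) * g (qflip q) = - qchi q * (g q :: int)"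
  shows "(\<Sum>q\<in>quads p - qend p. qchi q * g q) = 0"
  by (rule sum_antisym_involution_eq_0[where s = qflip])
     (simp_all only: qflip_in qflip_qflip assms mult_minus_left)

lemma sum_flip_s:
  assumes "odd k"
  shows "(\<Sum>q\<in>quads p - qend p. qchi q * qs q ^ k) = 0"
proof (rule sum_flip)
  fix q assume q: "q \<in> quads p - qend p"
  obtain y Y l L where q': "q = (y, Y, l, L)" by (cases q)
  note * = qchi_flip[OF q q']
  have m: "(y, Y, l, L) \<in> quads p" using q q' by auto
  show "qchi (qflip q) * qs (qflip q) ^ k = - qchi q * qs q ^ k" using m
  proof (cases rule: quads_cases)
    case R then show ?thesis using * q_flip_R[OF R q'] assms by simp
  next
    case Lt then show ?thesis using * q_flip_L[OF Lt _ q'] assms quads_bounds[OF m] by simp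
  next
    case O then show ?thesis using * q_flip_O[OF O q'] by simp
  next
    case E then show ?thesis using q m by (simp add: q' qend_def)
  qed
qed

lemma sum_qend:
  "(\<Sum>q\<in>qend p. qchi q * g q) = (\<Sum>Y\<in>{1..(p - 1) div 2}. chi Y * (g (p - 2 * Y, Y, 1, 1) :: int))"
proof (rule sum.reindex_bij_witness[of _ "\<lambda>Y. (p - 2 * Y, Y, 1, 1)" "\<lambda>q. fst (snd q)"])
  fix Y assume Y: "Y \<in> {1..(p - 1) div 2}"
  then show "(p - 2 * Y, Y, 1, 1) \<in> qend p" by (auto simp: qend_def quads_def)
next
  fix q assume "q \<in> qend p"
  then obtain y Y where q: "q = (y, Y, 1, 1)" "y > 0" "Y > 0" "y + 2 * Y = p"
    by (auto simp: qend_def quads_def)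
  have "[p - 2 * Y = (-2) * Y] (mod p)" by (simp add: cong_iff_dvd_diff)
  then have "chi (p - 2 * Y) = chi Y"
    using chi_cong chi_mult[of "-2" Y] chi_minus_2 by fastforce
  moreover have "y = p - 2 * Y" using q by simp
  moreover have "qchi q = chi y" "fst (snd q) = Y" using q by auto
  ultimately show "chi (fst (snd q)) * g (p - 2 * fst (snd q), fst (snd q), 1, 1) = qchi q * g q"
    using q(1) by simp
qed (auto simp: qend_def quads_def)

lemma sum_quads_split:
  "(\<Sum>q\<in>quads p. f q) = (\<Sum>q\<in>quads p - qend p. f q) + (\<Sum>q\<in>qend p. f q :: int)"
proof -
  have "qend p \<subseteq> quads p" by (auto simp: qend_def)
  then show ?thesis by (simp add: sum.subset_diff)
qed

text \<open>These moments record the contributions of \<open>qend\<close>; they cancel in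
  \<open>half_period_sum\<close>.\<close>

definition half_sum :: "nat \<Rightarrow> int" where
  "half_sum k = (\<Sum>Y\<in>{1..(p - 1) div 2}. chi Y * Y ^ k)"

definition central_sum :: int where
  "central_sum = (\<Sum>q\<in>quads p. qchi q * (qb q * qm q))"

lemma qb_sq: "q \<in> quads p \<Longrightarrow> p ^ 2 = qb q ^ 2 + 8 * qm q"
proof -
  assume "q \<in> quads p"
  moreover obtain y Y l L where q: "q = (y, Y, l, L)" by (cases q)
  ultimately have "p = y * L + 2 * Y * l" by (simp add: quads_def)
  then show ?thesis by (simp add: q power2_eq_square algebra_simps)
qed

text \<open>In b = s - 2 h the term h is odd under \<open>qswap\<close>, and
  \<open>sum_flip_s\<close> confines the sum of s to \<open>qend\<close>.\<close>

lemma sum_s_1: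
  "(\<Sum>q\<in>quads p. qchi q * qb q) = p * half_sum 0 - 2 * half_sum 1"
proof -
  have "(\<Sum>q\<in>quads p. qchi q * qb q) = (\<Sum>q\<in>quads p. qchi q * (qs q ^ 1 - 2 * qh q))"
    by (intro sum.cong) (auto simp: qs_def)
  also have "\<dots> = (\<Sum>q\<in>quads p. qchi q * qs q ^ 1) - 2 * (\<Sum>q\<in>quads p. qchi q * qh q)"
    by (simp add: right_diff_distrib sum_subtractf sum_distrib_left mult_ac)
  also have "(\<Sum>q\<in>quads p. qchi q * qh q) = 0"
    by (rule sum_swap) simp
  also have "(\<Sum>q\<in>quads p. qchi q * qs q ^ 1) = (\<Sum>q\<in>qend p. qchi q * qs q ^ 1)"
    using sum_quads_split[of "\<lambda>q. qchi q * qs q ^ 1"] sum_flip_s[of 1] by simp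
  also have "\<dots> = (\<Sum>Y\<in>{1..(p - 1) div 2}. chi Y * (p - 2 * Y))"
    unfolding sum_qend by (intro sum.cong) (auto simp: qs_def algebra_simps)
  also have "\<dots> = p * half_sum 0 - 2 * half_sum 1"
    by (simp add: half_sum_def sum_distrib_left right_diff_distrib sum_subtractf mult_ac)
  finally show ?thesis by simp
qed

text \<open>The left side is s^3 = (b + 2 h)^3 without the terms odd in h, which
  \<open>qswap\<close> cancels.\<close>

lemma sum_s_3:
  "(\<Sum>q\<in>quads p. qchi q * (qb q ^ 3 + 12 * qb q * qh q ^ 2)) =
     p ^ 3 * half_sum 0 - 6 * p ^ 2 * half_sum 1 + 12 * p * half_sum 2 - 8 * half_sum 3"
proof -
  have "(\<Sum>q\<in>quads p. qchi q * (qb q ^ 3 + 12 * qb q * qh q ^ 2)) =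
        (\<Sum>q\<in>quads p. qchi q * qs q ^ 3) - (\<Sum>q\<in>quads p. qchi q * (6 * qb q ^ 2 * qh q + 8 * qh q ^ 3))"
    unfolding sum_subtractf [symmetric]
    by (intro sum.cong) (auto simp: qs_def power2_eq_square power3_eq_cube algebra_simps)
  also have "(\<Sum>q\<in>quads p. qchi q * (6 * qb q ^ 2 * qh q + 8 * qh q ^ 3)) = 0"
    by (rule sum_swap) simp
  also have "(\<Sum>q\<in>quads p. qchi q * qs q ^ 3) = (\<Sum>q\<in>qend p. qchi q * qs q ^ 3)"
    using sum_quads_split[of "\<lambda>q. qchi q * qs q ^ 3"] sum_flip_s[of 3] by simp
  also have "\<dots> = (\<Sum>Y\<in>{1..(p - 1) div 2}. chi Y * (p - 2 * Y) ^ 3)"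
    unfolding sum_qend by (intro sum.cong) (auto simp: qs_def algebra_simps)
  also have "\<dots> = (\<Sum>Y\<in>{1..(p - 1) div 2}. p ^ 3 * (chi Y * Y ^ 0) - 6 * p ^ 2 * (chi Y * Y ^ 1)
        + 12 * p * (chi Y * Y ^ 2) - 8 * (chi Y * Y ^ 3))"
    by (intro sum.cong) (auto simp: power2_eq_square power3_eq_cube algebra_simps)
  also have "\<dots> = p ^ 3 * half_sum 0 - 6 * p ^ 2 * half_sum 1 + 12 * p * half_sum 2 - 8 * half_sum 3"
    unfolding half_sum_def by (simp only: sum_subtractf sum.distrib sum_distrib_left)
  finally show ?thesis by simp
qed

text \<open>Without its terms odd in h, 4 e^3 is 4 b^3 + 12 b h^2 = (b^3 + 12 b h^2) + 3 b^3. The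
  bracket is \<open>sum_s_3\<close>, and b^2 = p^2 - 8 m turns b^3 into p^2 b - 8 b m; the factor 6
  is 3 * 8 / 4.\<close>

lemma sum_e_3:
  "(\<Sum>q\<in>quads p. qchi q * qe q ^ 3) =
     - 6 * central_sum + p ^ 3 * half_sum 0 - 3 * p ^ 2 * half_sum 1 + 3 * p * half_sum 2 - 2 * half_sum 3"
proof -
  define S1 where "S1 = (\<Sum>q\<in>quads p. qchi q * qb q)"
  define S3 where "S3 = (\<Sum>q\<in>quads p. qchi q * (qb q ^ 3 + 12 * qb q * qh q ^ 2))"
  have "4 * (\<Sum>q\<in>quads p. qchi q * qe q ^ 3) - 4 * (\<Sum>q\<in>quads p. qchi q * (3 * qb q ^ 2 * qh q + qh q ^ 3))
      = S3 + 3 * (p ^ 2 * S1 - 8 * central_sum)"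
    unfolding S1_def S3_def central_sum_def sum_distrib_left right_diff_distrib sum_subtractf [symmetric] sum.distrib [symmetric]
  proof (intro sum.cong refl)
    fix q assume "q \<in> quads p"
    then have "p ^ 2 = qb q ^ 2 + 8 * qm q" by (rule qb_sq)
    then show "4 * (qchi q * qe q ^ 3) - 4 * (qchi q * (3 * (qb q)\<^sup>2 * qh q + qh q ^ 3)) =
      qchi q * (qb q ^ 3 + 12 * qb q * (qh q)\<^sup>2) + (3 * (p\<^sup>2 * (qchi q * qb q)) - 3 * (8 * (qchi q * (qb q * qm q))))"
      unfolding qe_def by (simp add: power2_eq_square power3_eq_cube algebra_simps)
  qed
  moreover have "(\<Sum>q\<in>quads p. qchi q * (3 * qb q ^ 2 * qh q + qh q ^ 3)) = 0"
    by (rule sum_swap) simp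
  ultimately have "4 * (\<Sum>q\<in>quads p. qchi q * qe q ^ 3) = S3 + 3 * (p ^ 2 * S1 - 8 * central_sum)"
    by simp
  moreover note sum_s_1[folded S1_def] sum_s_3[folded S3_def]
  ultimately have "4 * (\<Sum>q\<in>quads p. qchi q * qe q ^ 3) =
    4 * (- 6 * central_sum + p ^ 3 * half_sum 0 - 3 * p ^ 2 * half_sum 1 + 3 * p * half_sum 2 - 2 * half_sum 3)"
    by (simp add: power2_eq_square power3_eq_cube algebra_simps)
  then show ?thesis by simp
qed

text \<open>This combination of cubes is what the periods leave at \<open>qstart\<close> and
  \<open>qend\<close>; it matches the boundary terms of \<open>sum_e_3\<close> with the opposite
  sign.\<close>

lemma half_range_sum:
  "(\<Sum>u\<in>{1..(p - 1) div 2}. chi u * (u ^ 3 - (p - u) ^ 3)) =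
     - (p ^ 3 * half_sum 0 - 3 * p ^ 2 * half_sum 1 + 3 * p * half_sum 2 - 2 * half_sum 3)"
proof -
  have "(\<Sum>u\<in>{1..(p - 1) div 2}. chi u * (u ^ 3 - (p - u) ^ 3)) =
    (\<Sum>Y\<in>{1..(p - 1) div 2}. - (p ^ 3 * (chi Y * Y ^ 0) - 3 * p ^ 2 * (chi Y * Y ^ 1)
        + 3 * p * (chi Y * Y ^ 2) - 2 * (chi Y * Y ^ 3)))"
    by (intro sum.cong) (auto simp: power2_eq_square power3_eq_cube algebra_simps)
  also have "\<dots> = - (p ^ 3 * half_sum 0 - 3 * p ^ 2 * half_sum 1 + 3 * p * half_sum 2 - 2 * half_sum 3)"
    unfolding half_sum_def by (simp only: sum_subtractf sum.distrib sum_distrib_left sum_negf)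
  finally show ?thesis .
qed

text \<open>On the outer branches t - 2 e^3 is -(e^3 + d^3) and -(e^3 - d^3), and the turn of (d, e)
  by a right angle carries each to minus the other. On the middle branch it is 0.\<close>

lemma sum_turns:
  fixes t :: "quad \<Rightarrow> int"
  assumes R: "\<And>y Y l L. L < l \<Longrightarrow> t (y, Y, l, L) = qe (y, Y, l, L) ^ 3 - qd (y, Y, l, L) ^ 3"
    and Lt: "\<And>y Y l L. 2 * l < L \<Longrightarrow> 0 < l \<Longrightarrow> t (y, Y, l, L) = qe (y, Y, l, L) ^ 3 + qd (y, Y, l, L) ^ 3"
    and O: "\<And>y Y l L. l < L \<Longrightarrow> L < 2 * l \<Longrightarrow> t (y, Y, l, L) = 2 * qe (y, Y, l, L) ^ 3"
  shows "(\<Sum>q\<in>quads p - qend p. qchi q * t q) = (\<Sum>q\<in>quads p - qend p. qchi q * (2 * qe q ^ 3))"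
proof -
  have "(\<Sum>q\<in>quads p - qend p. qchi q * (t q - 2 * qe q ^ 3)) = 0"
  proof (rule sum_flip)
    fix q assume q: "q \<in> quads p - qend p"
    obtain y Y l L where q': "q = (y, Y, l, L)" by (cases q)
    note * = qchi_flip[OF q q']
    have m: "(y, Y, l, L) \<in> quads p" using q q' by auto
    note b = quads_bounds[OF m]
    obtain y' Y' l' L' where f: "qflip q = (y', Y', l', L')" by (cases "qflip q")
    show "qchi (qflip q) * (t (qflip q) - 2 * qe (qflip q) ^ 3) = - qchi q * (t q - 2 * qe q ^ 3)"
      using m
    proof (cases rule: quads_cases)
      case R': R
      have "2 * l' < L'" "0 < l'" using R' f b(1-8) by (auto simp: q')
      then have "t (qflip q) = qe (qflip q) ^ 3 + qd (qflip q) ^ 3" unfolding f by (rule Lt)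
      moreover have "t q = qe q ^ 3 - qd q ^ 3" unfolding q' using R' by (rule R)
      moreover have "qchi (qflip q) = qchi q" using * R' by simp
      ultimately show ?thesis by (simp only: q_flip_R[OF R' q']) (simp add: algebra_simps)
    next
      case Lt': Lt
      have "L' < l'" using Lt' f b(1-8) by (auto simp: q')
      then have "t (qflip q) = qe (qflip q) ^ 3 - qd (qflip q) ^ 3" unfolding f by (rule R)
      moreover have "t q = qe q ^ 3 + qd q ^ 3" unfolding q' using Lt' b(5) by (rule Lt)
      moreover have "qchi (qflip q) = qchi q" using * Lt' b(5) by simp
      ultimately show ?thesis by (simp only: q_flip_L[OF Lt' b(5) q']) (simp add: algebra_simps)
    next
      case O': O
      have "l' < L'" "L' < 2 * l'" using O' f b(1-8) by (auto simp: q')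
      then have "t (qflip q) = 2 * qe (qflip q) ^ 3" unfolding f by (rule O)
      moreover have "t q = 2 * qe q ^ 3" unfolding q' using O' by (rule O)
      ultimately show ?thesis by simp
    next
      case E then show ?thesis using q m by (simp add: q' qend_def)
    qed
  qed
  then show ?thesis by (simp add: right_diff_distrib sum_subtractf)
qed

end

section \<open>Period cocycles\<close>

text \<open>The model: \<open>K x a b c\<close> is the imaginary part of the integral of f(z) (a z^2
  + b z + c)^3 from x to \<infinity>. The axioms are translation, reflection in the imaginary axis
  and inversion. At x = 0 only two moments of f survive: s0 is the one of order 0, and s2 is minus
  the one of order 2.\<close>

locale period_cocycle = odd_residue_character +
  fixes K :: "real \<Rightarrow> real \<Rightarrow> real \<Rightarrow> real \<Rightarrow> real" and s0 s2 :: real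
  assumes K_shift: "\<And>x a b c. x \<in> \<rat> \<Longrightarrow> K (x + 1) a b c = K x a (2 * a + b) (a + b + c)"
    and K_mirror: "\<And>x a b c. x \<in> \<rat> \<Longrightarrow> K (- x) a b c = K x a (- b) c"
    and K_invert: "\<And>x a b c. x \<in> \<rat> \<Longrightarrow> x \<noteq> 0 \<Longrightarrow>
        K x a b c = K 0 a b c + K (- 1 / (2 * x)) (2 * c) (- b) (a / 2)"
    and K_uminus: "\<And>x a b c. K x (- a) (- b) (- c) = - K x a b c"
    and K_0: "\<And>a b c. K 0 a b c =
        s0 * (c ^ 3 - (a / 2) ^ 3) + 3 * s2 * (c - a / 2) * (a * c + b ^ 2)"
begin

lemma K_sub_1: "x \<in> \<rat> \<Longrightarrow> K x a b c = K (x - 1) a (2 * a + b) (a + b + c)"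
  using K_shift[of "x - 1" a b c] by simp

lemma K_cong: "x = x' \<Longrightarrow> a = a' \<Longrightarrow> b = b' \<Longrightarrow> c = c' \<Longrightarrow> K x a b c = K x' a' b' c'"
  by simp

text \<open>The reflection keeps the argument positive, as the Euclidean algorithm requires.\<close>

lemma K_invert_mirror:
  assumes "x \<in> \<rat>" "x \<noteq> 0"
  shows "K x a b c = K 0 a b c + K (1 / (2 * x)) (2 * c) b (a / 2)"
  using K_invert[OF assms, of a b c] K_mirror[of "1 / (2 * x)" "2 * c" "- b" "a / 2"] assms by simp

text \<open>The value of K at 0 on a form 2 a z^2 + b z + c of discriminant p^2. Up to the coboundary of the
  function vertex below, it is -10 s2 (c - a)^3, where a and c are the values at the two ends of
  the edge from 0 to \<infinity>.\<close>
definition E :: "real \<Rightarrow> real \<Rightarrow> real" where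
  "E a c = (s0 + 10 * s2) * (c ^ 3 - a ^ 3) + 3 * s2 * p ^ 2 * (c - a) - 10 * s2 * (c - a) ^ 3"

text \<open>For this discriminant the last factor in \<open>K_0\<close> becomes 10 a c + p^2, and 3
  a c (c - a) = c^3 - a^3 - (c - a)^3 accounts for both coefficients 10 in \<open>E\<close>.\<close>

lemma K_0_disc:
  assumes "b ^ 2 = 8 * a * c + of_int p ^ 2"
  shows "K 0 (2 * a) b c = E a c"
  unfolding K_0 E_def assms by (simp add: field_simps power2_eq_square power3_eq_cube)

lemma K_invert_disc:
  assumes "x \<in> \<rat>" "x \<noteq> 0" "b ^ 2 = 8 * a * c + of_int p ^ 2"
  shows "K x (2 * a) b c = E a c + K (1 / (2 * x)) (2 * c) b a"
  using K_invert_mirror[OF assms(1,2), of "2 * a" b c] K_0_disc[OF assms(3)] by simp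

text \<open>The period of the form of the quadruple, taken from its positive root l/L.\<close>

fun Phi :: "quad \<Rightarrow> real" where
  "Phi (y, Y, l, L) = K (l / L) (2 * - of_int (Y * L)) (of_int (2 * Y * l - y * L)) (of_int (y * l))"

definition vertex :: "real \<Rightarrow> real" where
  "vertex a = (s0 + 10 * s2) * a ^ 3 + 3 * s2 * p ^ 2 * a"

lemma E_vertex: "E a c = vertex c - vertex a - 10 * s2 * (c - a) ^ 3"
  by (simp add: E_def vertex_def algebra_simps)

lemma vertex_uminus: "vertex (- a) = - vertex a"
  by (simp add: vertex_def)

lemma E_uminus: "E (- a) (- c) = - E a c"
  by (simp add: E_def algebra_simps power3_eq_cube)

lemma disc:
  assumes "(y, Y, l, L) \<in> quads p"
  shows "(of_int (2 * Y * l - y * L) :: real) ^ 2 = 8 * - of_int (Y * L) * of_int (y * l) + of_int p ^ 2"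
proof -
  have "p = y * L + 2 * Y * l" using assms by (simp add: quads_def)
  then have "(2 * Y * l - y * L) ^ 2 = 8 * - (Y * L) * (y * l) + p ^ 2"
    by (simp add: power2_eq_square algebra_simps)
  then have "(of_int ((2 * Y * l - y * L) ^ 2) :: real) = of_int (8 * - (Y * L) * (y * l) + p ^ 2)"
    by (rule arg_cong)
  then show ?thesis by simp
qed

section \<open>Periods along a step of the Euclidean algorithm\<close>

lemma Phi_R:
  assumes "(y, Y, l, L) \<in> quads p" "L < l"
  shows "Phi (y, Y, l, L) = Phi (y + 2 * Y, Y, l - L, L)"
proof -
  note b = quads_bounds[OF assms(1)]
  have "real_of_int l / L - 1 = (l - L) / L" using b by (simp add: field_simps)
  then show ?thesis
    unfolding Phi.simps by (subst K_sub_1) (auto simp: algebra_simps)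
qed

lemma Phi_invert:
  assumes "(y, Y, l, L) \<in> quads p"
  shows "Phi (y, Y, l, L) = E (of_int (- (Y * L))) (of_int (y * l)) +
    K (L / (2 * l)) (2 * of_int (y * l)) (of_int (2 * Y * l - y * L)) (- of_int (Y * L))"
  unfolding Phi.simps
  by (subst K_invert_disc[OF _ _ disc[OF assms]]) (use quads_bounds[OF assms] in auto)

lemma E_of_int:
  "c - a = d \<Longrightarrow> E (of_int a) (of_int c) = vertex (of_int c) - vertex (of_int a) - 10 * s2 * of_int d ^ 3"
  by (auto simp: E_vertex)

text \<open>Inversion takes l/L to L/(2 l), where 1 can be subtracted, and a second inversion leads
  to l/(L - 2 l). Each inversion splits off one edge \<open>E\<close>.\<close>

lemma Phi_L:
  assumes "(y, Y, l, L) \<in> quads p" "2 * l < L"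
  shows "Phi (y, Y, l, L) - E (- (Y * L)) (y * l) =
    Phi (y, Y + y, l, L - 2 * l) - E (- ((Y + y) * (L - 2 * l))) (y * l)"
proof -
  note b = quads_bounds[OF assms(1)]
  have m: "(y, Y + y, l, L - 2 * l) \<in> quads p"
    using b assms by (auto simp: quads_def algebra_simps)
  have 1: "Phi (y, Y, l, L) - E (- (Y * L)) (y * l) =
    K (L / (2 * l)) (2 * of_int (y * l)) (2 * Y * l - y * L) (- of_int (Y * L))"
    using Phi_invert[OF assms(1)] by simp
  have 2: "Phi (y, Y + y, l, L - 2 * l) - E (- ((Y + y) * (L - 2 * l))) (y * l) =
    K ((L - 2 * l) / (2 * l)) (2 * of_int (y * l)) (2 * (Y + y) * l - y * (L - 2 * l))
      (- of_int ((Y + y) * (L - 2 * l)))"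
    using Phi_invert[OF m] by simp
  have "real_of_int L / (2 * l) - 1 = (L - 2 * l) / (2 * l)" using b by (simp add: field_simps)
  then show ?thesis unfolding 1 2 by (subst K_sub_1) (auto simp: algebra_simps)
qed

text \<open>For 1/2 < l/L < 1 a translation makes the argument negative, which a reflection repairs.
  The plus sign on the left arises because the form finally reached is the negative of the form of
  the new quadruple.\<close>

lemma Phi_O:
  assumes "(y, Y, l, L) \<in> quads p" "l < L" "L < 2 * l"
  shows "Phi (y, Y, l, L) + Phi (y + 2 * Y, y + Y, L - l, 2 * l - L) =
    E (- (Y * L)) ((y + 2 * Y) * (l - L)) - E ((y + Y) * (2 * l - L)) ((y + 2 * Y) * (l - L))"
proof -
  note b = quads_bounds[OF assms(1)]
  have m: "(y + 2 * Y, y + Y, L - l, 2 * l - L) \<in> quads p"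
    using b assms by (auto simp: quads_def algebra_simps)
  \<comment> \<open>The coefficients after translation by 1 and reflection.\<close>
  define a1 b1 c1 where "a1 = - real_of_int (Y * L)" "b1 = real_of_int ((y + 4 * Y) * L - 2 * Y * l)"
    "c1 = real_of_int ((y + 2 * Y) * (l - L))"
  have d1: "b1 ^ 2 = 8 * a1 * c1 + of_int p ^ 2"
  proof -
    have "((y + 4 * Y) * L - 2 * Y * l) ^ 2 = 8 * - (Y * L) * ((y + 2 * Y) * (l - L)) + p ^ 2"
      using b(9) by (simp flip: b(9) add: power2_eq_square algebra_simps)
    then have "(of_int (((y + 4 * Y) * L - 2 * Y * l) ^ 2) :: real) =
       of_int (8 * - (Y * L) * ((y + 2 * Y) * (l - L)) + p ^ 2)" by (rule arg_cong)
    then show ?thesis by (simp add: a1_b1_c1_def)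
  qed
  have "Phi (y, Y, l, L) = K (- ((L - l) / L)) (2 * a1) (- b1) c1"
    unfolding Phi.simps a1_b1_c1_def
    by (subst K_sub_1, simp, rule K_cong) (use b(1-8) in \<open>auto simp: field_simps\<close>)
  also have "\<dots> = K ((L - l) / L) (2 * a1) b1 c1"
    by (subst K_mirror) auto
  also have "\<dots> = E a1 c1 + K (L / (2 * (L - l))) (2 * c1) b1 a1"
    by (subst K_invert_disc[OF _ _ d1]) (use assms b in auto)
  also have "K (L / (2 * (L - l))) (2 * c1) b1 a1 =
     K ((2 * l - L) / (2 * (L - l))) (2 * c1) (4 * c1 + b1) (2 * c1 + b1 + a1)"
    by (subst K_sub_1, simp, rule K_cong) (use assms in \<open>auto simp: field_simps\<close>)
  also have "K ((2 * l - L) / (2 * (L - l))) (2 * c1) (4 * c1 + b1) (2 * c1 + b1 + a1) =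
     - (K ((2 * l - L) / (2 * (L - l))) (2 * - c1) (- (4 * c1 + b1)) (- (2 * c1 + b1 + a1)))"
    using K_uminus[of "(2 * l - L) / (2 * (L - l))" "2 * c1" "4 * c1 + b1" "2 * c1 + b1 + a1"] by simp
  also have "K ((2 * l - L) / (2 * (L - l))) (2 * - c1) (- (4 * c1 + b1)) (- (2 * c1 + b1 + a1)) =
    Phi (y + 2 * Y, y + Y, L - l, 2 * l - L) -
      E (- ((y + Y) * (2 * l - L))) ((y + 2 * Y) * (L - l))"
    unfolding Phi_invert[OF m] by (simp, rule K_cong) (simp_all add: a1_b1_c1_def algebra_simps)
  also have "E (- ((y + Y) * (2 * l - L))) ((y + 2 * Y) * (L - l)) = - E ((y + Y) * (2 * l - L)) c1"
  proof -
    have "real_of_int ((y + 2 * Y) * (L - l)) = - c1" by (simp add: a1_b1_c1_def algebra_simps)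
    then show ?thesis by (simp add: E_uminus)
  qed
  finally show ?thesis by (simp add: a1_b1_c1_def)
qed

fun qa :: "quad \<Rightarrow> int" where "qa (y, Y, l, L) = - (Y * L)"

text \<open>The vertex term absorbs the coboundary. Adding 5 s2 d^3, half of the cube along an edge,
  lets each step see half a cube from the edge it leaves and half a cube from the edge it
  enters.\<close>

definition Xi :: "quad \<Rightarrow> real" where
  "Xi q = Phi q + vertex (of_int (qa q)) + 5 * s2 * qd q ^ 3"

text \<open>Minus the contribution of a step in units of 5 s2; the three cases are the three kinds
  of step.\<close>

fun qturn :: "quad \<Rightarrow> int" where
  "qturn (y, Y, l, L) = (if L < l then qe (y, Y, l, L) ^ 3 - qd (y, Y, l, L) ^ 3
     else if 2 * l < L then qe (y, Y, l, L) ^ 3 + qd (y, Y, l, L) ^ 3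
     else 2 * qe (y, Y, l, L) ^ 3)"

lemma Xi_step:
  assumes "q \<in> quads p - qend p"
  shows "qchi q * Xi q - qchi (qflip q) * Xi (qswap (qflip q)) = - 5 * s2 * (qchi q * qturn q)"
proof -
  obtain y Y l L where q: "q = (y, Y, l, L)" by (cases q)
  note * = qchi_flip[OF assms q]
  have m: "(y, Y, l, L) \<in> quads p" using q assms by auto
  note b = quads_bounds[OF m]
  show ?thesis using m
  proof (cases rule: quads_cases)
    case R
    have "Xi q - Xi (qswap (qflip q)) = - 5 * s2 * qturn q"
      using R Phi_R[OF m R] b(1-8) by (simp add: q Xi_def qe_def algebra_simps power3_eq_cube)
    moreover have "qchi (qflip q) = qchi q" using R * by simp
    ultimately show ?thesis by (simp flip: right_diff_distrib)
  next
    case Lt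
    have "Xi q - Xi (qswap (qflip q)) = - 5 * s2 * qturn q"
      using Lt Phi_L[OF m Lt] b(1-8) by (simp add: q Xi_def qe_def E_vertex algebra_simps power3_eq_cube)
    moreover have "qchi (qflip q) = qchi q" using Lt b(1-8) * by simp
    ultimately show ?thesis by (simp flip: right_diff_distrib)
  next
    case O
    have "Xi q + Xi (qswap (qflip q)) = - 5 * s2 * qturn q"
    proof -
      have "E (- (Y * L)) ((y + 2 * Y) * (l - L)) =
          vertex ((y + 2 * Y) * (l - L)) - vertex (- (Y * L)) - 10 * s2 * qe q ^ 3"
        using E_of_int[of "(y + 2 * Y) * (l - L)" "- (Y * L)" "qe q"]
        by (simp add: q qe_def algebra_simps)
      moreover have "E ((y + Y) * (2 * l - L)) ((y + 2 * Y) * (l - L)) =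
          vertex ((y + 2 * Y) * (l - L)) - vertex ((y + Y) * (2 * l - L)) + 10 * s2 * qd q ^ 3"
      proof -
        have "(y + 2 * Y) * (l - L) - (y + Y) * (2 * l - L) = - qd q" by (simp add: q algebra_simps)
        from E_of_int[OF this] show ?thesis by simp
      qed
      moreover have "qswap (qflip q) = (y + 2 * Y, y + Y, L - l, 2 * l - L)"
        using O by (simp add: q)
      moreover have "qd (y + 2 * Y, y + Y, L - l, 2 * l - L) = qd q" "qturn q = 2 * qe q ^ 3"
        "qa q = - (Y * L)" "qa (y + 2 * Y, y + Y, L - l, 2 * l - L) = - ((y + Y) * (2 * l - L))"
        using O by (simp_all add: q algebra_simps)
      ultimately show ?thesis
        using Phi_O[OF m O] by (simp add: Xi_def vertex_uminus flip: q)
    qed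
    moreover have "qchi (qflip q) = - qchi q" using O * by simp
    ultimately show ?thesis by (simp flip: distrib_left)
  next
    case E then show ?thesis using assms m by (simp add: q qend_def)
  qed
qed

lemma qswap_start_iff: "q \<in> quads p - qstart p \<longleftrightarrow> qswap q \<in> quads p - qend p"
  using qswap_in[of q] qswap_in[of "qswap q"] by (cases q) (auto simp: qstart_def qend_def)

text \<open>The step q -> \<open>qswap (qflip q)\<close> maps the complement of \<open>qend\<close>
  bijectively onto the complement of \<open>qstart\<close>, so summing \<open>Xi_step\<close>
  telescopes.\<close>

lemma sum_start:
  "(\<Sum>q\<in>qstart p. qchi q * Xi q) = (\<Sum>q\<in>qend p. qchi q * Xi q)
     - 5 * s2 * (\<Sum>q\<in>quads p - qend p. qchi q * qturn q)"
proof -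
  let ?g = "\<lambda>q. real_of_int (qchi q) * Xi q"
  have sub: "qend p \<subseteq> quads p" "qstart p \<subseteq> quads p" by (auto simp: qend_def qstart_def)
  have "(\<Sum>q\<in>quads p - qend p. ?g q) - (\<Sum>q\<in>quads p - qend p. qchi (qflip q) * Xi (qswap (qflip q)))
     = - 5 * s2 * (\<Sum>q\<in>quads p - qend p. real_of_int (qchi q * qturn q))"
    unfolding sum_subtractf [symmetric] sum_distrib_left
    by (intro sum.cong refl) (use Xi_step in simp)
  also have "(\<Sum>q\<in>quads p - qend p. qchi (qflip q) * Xi (qswap (qflip q))) =
      (\<Sum>q\<in>quads p - qstart p. ?g q)"
  proof (rule sum.reindex_bij_witness[of _ "\<lambda>q. qflip (qswap q)" "\<lambda>q. qswap (qflip q)"])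
    fix q assume q: "q \<in> quads p - qend p"
    show "qflip (qswap (qswap (qflip q))) = q" using qflip_qflip[OF q] by simp
    show "qswap (qflip q) \<in> quads p - qstart p"
      using qflip_in[OF q] unfolding qswap_start_iff by simp
    show "real_of_int (qchi (qswap (qflip q))) * Xi (qswap (qflip q)) = qchi (qflip q) * Xi (qswap (qflip q))"
      using qchi_swap[of "qflip q"] qflip_in[OF q] by simp
  next
    fix q assume q: "q \<in> quads p - qstart p"
    then have q': "qswap q \<in> quads p - qend p" unfolding qswap_start_iff .
    show "qswap (qflip (qflip (qswap q))) = q" using qflip_qflip[OF q'] by simp
    show "qflip (qswap q) \<in> quads p - qend p" using qflip_in[OF q'] .
  qed
  finally show ?thesis
    using sum.subset_diff[OF sub(1), of ?g] sum.subset_diff[OF sub(2), of ?g] by simp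
qed

text \<open>The cusp 1 is a translate of 0, and the translated form has c = 0; a single edge
  remains.\<close>

lemma Xi_end:
  assumes "0 < Y" "2 * Y < p"
  shows "Xi (p - 2 * Y, Y, 1, 1) = 5 * s2 * (p - Y) ^ 3 - 10 * s2 * Y ^ 3"
proof -
  have "Phi (p - 2 * Y, Y, 1, 1) = K 0 (2 * - of_int Y) (- of_int p) 0"
    unfolding Phi.simps by (subst K_sub_1, simp, rule K_cong) auto
  also have "\<dots> = E (- of_int Y) 0" by (rule K_0_disc) simp
  finally show ?thesis by (simp add: Xi_def E_vertex) (simp add: vertex_def)
qed

text \<open>From the form p z - u at u/p, one inversion and one translation lead to (p - 2 u)/(2 u),
  which is also where the inversion takes the cusp of the quadruple (1, 1, u, p - 2 u). The forms
  there are negatives of each other.\<close>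

lemma K_start:
  assumes "0 < u" "2 * u < p"
  shows "K (u / p) 0 p (- real_of_int u) = 10 * s2 * u ^ 3 - 5 * s2 * (p - u) ^ 3 - Xi (1, 1, u, p - 2 * u)"
proof -
  have m: "(1, 1, u, p - 2 * u) \<in> quads p" using assms by (auto simp: quads_def)
  have "K (u / p) (2 * 0) p (- real_of_int u) = E 0 (- real_of_int u) + K (1 / (2 * (real_of_int u / p))) (2 * - real_of_int u) p 0"
    by (rule K_invert_disc) (use assms in auto)
  also have "K (1 / (2 * (real_of_int u / p))) (2 * - real_of_int u) p 0 =
     K ((p - 2 * u) / (2 * u)) (- (2 * u)) (- (4 * u - p)) (- (2 * u - p))"
    by (subst K_sub_1, use assms in simp, rule K_cong) (use assms in \<open>auto simp: field_simps\<close>)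
  also have "\<dots> = - K ((p - 2 * u) / (2 * u)) (2 * u) (4 * u - p) (2 * u - p)"
    by (subst K_uminus [symmetric]) simp
  also have "K ((p - 2 * u) / (2 * u)) (2 * u) (4 * u - p) (2 * u - p) =
     Phi (1, 1, u, p - 2 * u) - E (- (p - 2 * u)) u"
    unfolding Phi_invert[OF m] by (simp add: mult_ac)
  finally show ?thesis
    by (simp add: Xi_def E_vertex vertex_uminus) (simp add: vertex_def algebra_simps power3_eq_cube)
qed

lemma sum_qstart:
  fixes g :: "quad \<Rightarrow> real"
  shows "(\<Sum>q\<in>qstart p. qchi q * g q) = (\<Sum>u\<in>{1..(p - 1) div 2}. chi u * g (1, 1, u, p - 2 * u))"
  by (rule sum.reindex_bij_witness[of _ "\<lambda>u. (1, 1, u, p - 2 * u)" "\<lambda>q. fst (snd (snd q))"])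
     (auto simp: qstart_def quads_def)

lemma sum_qend_real:
  fixes g :: "quad \<Rightarrow> real"
  shows "(\<Sum>q\<in>qend p. qchi q * g q) = (\<Sum>Y\<in>{1..(p - 1) div 2}. chi Y * g (p - 2 * Y, Y, 1, 1))"
proof (rule sum.reindex_bij_witness[of _ "\<lambda>Y. (p - 2 * Y, Y, 1, 1)" "\<lambda>q. fst (snd q)"])
  fix Y assume Y: "Y \<in> {1..(p - 1) div 2}"
  then show "(p - 2 * Y, Y, 1, 1) \<in> qend p" by (auto simp: qend_def quads_def)
next
  fix q assume "q \<in> qend p"
  then obtain y Y where q: "q = (y, Y, 1, 1)" "y > 0" "Y > 0" "y + 2 * Y = p"
    by (auto simp: qend_def quads_def)
  have "[p - 2 * Y = (-2) * Y] (mod p)" by (simp add: cong_iff_dvd_diff)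
  then have "chi (p - 2 * Y) = chi Y"
    using chi_cong chi_mult[of "-2" Y] chi_minus_2 by fastforce
  moreover have "y = p - 2 * Y" using q by simp
  moreover have "qchi q = chi y" "fst (snd q) = Y" using q by auto
  ultimately show "chi (fst (snd q)) * g (p - 2 * fst (snd q), fst (snd q), 1, 1) = qchi q * g q"
    using q(1) by simp
qed (auto simp: qend_def quads_def)

text \<open>The values of \<open>Xi\<close> at both ends and the turns missing at
  \<open>qend\<close> add up to 10 s2 times \<open>half_range_sum\<close>. This cancels 10 s2 times
  \<open>sum_e_3\<close> except for 10 s2 times -6 \<open>central_sum\<close>.\<close>

lemma half_period_sum:
  "(\<Sum>u\<in>{1..(p - 1) div 2}. chi u * K (u / p) 0 p (- real_of_int u)) = - 60 * s2 * central_sum"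
proof -
  let ?H = "{1..(p - 1) div 2}"
  have H: "0 < u" "2 * u < p" if "u \<in> ?H" for u
  proof -
    have "p - 1 = 2 * ((p - 1) div 2)" using odd_p by simp
    moreover have "1 \<le> u" "u \<le> (p - 1) div 2" using that by simp_all
    ultimately show "0 < u" "2 * u < p" by linarith+
  qed
  have start: "(\<Sum>u\<in>?H. chi u * K (u / p) 0 p (- real_of_int u)) =
      (\<Sum>u\<in>?H. chi u * (10 * s2 * u ^ 3 - 5 * s2 * (p - u) ^ 3)) - (\<Sum>q\<in>qstart p. qchi q * Xi q)"
    unfolding sum_qstart sum_subtractf [symmetric]
  proof (intro sum.cong refl)
    fix u assume "u \<in> ?H"
    from K_start[OF H[OF this]]
    show "chi u * K (u / p) 0 p (- real_of_int u) = chi u * (10 * s2 * u ^ 3 - 5 * s2 * (p - u) ^ 3)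
      - chi u * Xi (1, 1, u, p - 2 * u)"
      by (simp only: right_diff_distrib of_int_power)
  qed
  have fin: "(\<Sum>q\<in>qend p. qchi q * Xi q) = (\<Sum>u\<in>?H. chi u * (5 * s2 * (p - u) ^ 3 - 10 * s2 * u ^ 3))"
    unfolding sum_qend_real
  proof (intro sum.cong refl)
    fix u assume "u \<in> ?H"
    from Xi_end[OF H[OF this]]
    show "chi u * Xi (p - 2 * u, u, 1, 1) = chi u * (5 * s2 * (p - u) ^ 3 - 10 * s2 * u ^ 3)"
      by (simp only:)
  qed
  have "(\<Sum>q\<in>quads p - qend p. qchi q * qturn q) = (\<Sum>q\<in>quads p - qend p. qchi q * (2 * qe q ^ 3))"
    by (rule sum_turns) auto
  also have "\<dots> = (\<Sum>q\<in>quads p. qchi q * (2 * qe q ^ 3)) - (\<Sum>q\<in>qend p. qchi q * (2 * qe q ^ 3))"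
    using sum_quads_split[of "\<lambda>q. qchi q * (2 * qe q ^ 3)"] by simp
  also have "(\<Sum>q\<in>qend p. qchi q * (2 * qe q ^ 3)) = (\<Sum>u\<in>?H. chi u * (2 * u ^ 3))"
    unfolding sum_qend by (simp add: qe_def)
  finally have turns: "(\<Sum>q\<in>quads p - qend p. qchi q * qturn q) =
     2 * (\<Sum>q\<in>quads p. qchi q * qe q ^ 3) - (\<Sum>u\<in>?H. chi u * (2 * u ^ 3))"
    by (simp add: sum_distrib_left mult_ac)
  have "(\<Sum>u\<in>?H. chi u * K (u / p) 0 p (- real_of_int u)) =
     (\<Sum>u\<in>?H. chi u * (10 * s2 * u ^ 3 - 5 * s2 * (p - u) ^ 3))
     - (\<Sum>u\<in>?H. chi u * (5 * s2 * (p - u) ^ 3 - 10 * s2 * u ^ 3))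
     - 5 * s2 * (\<Sum>u\<in>?H. chi u * (2 * u ^ 3))
     + 10 * s2 * of_int (\<Sum>q\<in>quads p. qchi q * qe q ^ 3)"
    unfolding start sum_start fin turns by (simp add: algebra_simps)
  also have "(\<Sum>u\<in>?H. chi u * (10 * s2 * u ^ 3 - 5 * s2 * (p - u) ^ 3))
     - (\<Sum>u\<in>?H. chi u * (5 * s2 * (p - u) ^ 3 - 10 * s2 * u ^ 3))
     - 5 * s2 * (\<Sum>u\<in>?H. chi u * (2 * u ^ 3)) =
     10 * s2 * of_int (\<Sum>u\<in>?H. chi u * (u ^ 3 - (p - u) ^ 3))"
    unfolding of_int_sum sum_distrib_left sum_subtractf [symmetric]
    by (intro sum.cong refl) (simp add: algebra_simps)
  finally show ?thesis
    unfolding half_range_sum sum_e_3 by (simp add: algebra_simps)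
qed

text \<open>The residues u and p - u contribute equally: translation and reflection show that K
  changes sign, and so does chi.\<close>

theorem period_sum:
  "(\<Sum>u\<in>{1..p - 1}. chi u * K (u / p) 0 p (- real_of_int u)) = - 120 * s2 * central_sum"
proof -
  let ?H = "{1..(p - 1) div 2}" and ?g = "\<lambda>u. chi u * K (u / p) 0 p (- real_of_int u)"
  have *: "{1..p - 1} = ?H \<union> (\<lambda>u. p - u) ` ?H"
  proof -
    have "(\<lambda>u. p - u) ` ?H = {p - (p - 1) div 2..p - 1}" by simp
    moreover have "p - (p - 1) div 2 = (p - 1) div 2 + 1" using odd_p by presburger
    ultimately show ?thesis using p_ge_3 by auto
  qed
  have "sum ?g {1..p - 1} = sum ?g ?H + sum ?g ((\<lambda>u. p - u) ` ?H)"
    unfolding * by (rule sum.union_disjoint) (use odd_p in auto)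
  also have "sum ?g ((\<lambda>u. p - u) ` ?H) = (\<Sum>u\<in>?H. ?g (p - u))"
    by (subst sum.reindex) (auto simp: inj_on_def)
  also have "\<dots> = sum ?g ?H"
  proof (intro sum.cong refl)
    fix u assume u: "u \<in> ?H"
    have "[p - u = - u] (mod p)" by (simp add: cong_iff_dvd_diff)
    then have "chi (p - u) = - chi u" using chi_cong chi_uminus by fastforce
    moreover have "K ((p - u) / p) 0 p (- real_of_int (p - u)) = - K (u / p) 0 p (- real_of_int u)"
    proof -
      have "K ((p - u) / p) 0 p (- real_of_int (p - u)) = K (- (real_of_int u / p)) 0 p u"
        by (subst K_sub_1, simp, rule K_cong) (use p_ge_3 in \<open>auto simp: field_simps\<close>)
      also have "\<dots> = K (u / p) 0 (- real_of_int p) u" by (rule K_mirror) simp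
      also have "\<dots> = - K (u / p) 0 p (- real_of_int u)" by (subst K_uminus [symmetric]) simp
      finally show ?thesis .
    qed
    ultimately show "?g (p - u) = ?g u" by simp
  qed
  finally show ?thesis unfolding half_period_sum by simp
qed

end

section \<open>Parity of the central sum\<close>

lemma Legendre_cases: "Legendre a p \<in> {-1, 0, 1}"
  by (auto simp: Legendre_def)

lemma Legendre_cong: "[a = b] (mod p) \<Longrightarrow> Legendre a p = Legendre b p"
  by (simp add: Legendre_def QuadRes_def cong_def)

text \<open>Turns the congruences of Euler's criterion into equalities of Legendre symbols.\<close>

lemma small_cong_imp_eq:
  fixes a b p :: int
  assumes "[a = b] (mod p)" "a \<in> {-1, 0, 1}" "b \<in> {-1, 0, 1}" "2 < p"
  shows "a = b"
proof -
  have "p dvd a - b" using assms(1) by (simp add: cong_iff_dvd_diff)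
  moreover have "\<bar>a - b\<bar> < p" using assms by auto
  ultimately show ?thesis using zdvd_not_zless[of "\<bar>a - b\<bar>" p] by auto
qed

lemma Legendre_mult:
  fixes p :: nat
  assumes "prime p" "2 < p"
  shows "Legendre (a * b) p = Legendre a p * Legendre b p"
proof (rule small_cong_imp_eq)
  have "[Legendre a p * Legendre b p = a ^ ((p - 1) div 2) * b ^ ((p - 1) div 2)] (mod p)"
    by (intro cong_mult euler_criterion assms)
  moreover have "[Legendre (a * b) p = (a * b) ^ ((p - 1) div 2)] (mod p)"
    by (intro euler_criterion assms)
  ultimately show "[Legendre (a * b) p = Legendre a p * Legendre b p] (mod p)"
    by (metis cong_sym cong_trans power_mult_distrib)
  show "Legendre a p * Legendre b p \<in> {-1, 0, 1}"
    using Legendre_cases[of a p] Legendre_cases[of b p] by auto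
qed (use assms Legendre_cases in auto)

lemma Legendre_minus_1:
  fixes p :: nat
  assumes "prime p" "2 < p"
  shows "Legendre (-1) p = (-1) ^ ((p - 1) div 2)"
proof (rule small_cong_imp_eq)
  show "[Legendre (-1) p = (-1) ^ ((p - 1) div 2)] (mod p)"
    by (intro euler_criterion assms)
  show "(- 1 :: int) ^ ((p - 1) div 2) \<in> {-1, 0, 1}"
    by (cases "even ((p - 1) div 2)") auto
qed (use assms Legendre_cases in auto)

text \<open>Gauss's lemma for p = 8 k + 3: the doubled residues beyond (p - 1)/2 = 4 k + 1 are 2 x
  with 2 k + 1 \<le> x \<le> 4 k + 1, and there are 2 k + 1 of them.\<close>

lemma Legendre_2:
  fixes p :: nat
  assumes "prime p" "p mod 8 = 3"
  shows "Legendre 2 p = -1"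
proof -
  have p3: "p \<ge> 3" using assms by presburger
  interpret GAUSS p 2
  proof
    show "[2 \<noteq> 0] (mod int p)"
      using p3 assms by (auto simp: cong_iff_dvd_diff dest: zdvd_imp_le)
  qed (use assms p3 in auto)
  define k where "k = int p div 8"
  have k: "int p = 8 * k + 3" using assms unfolding k_def by presburger
  have k0: "k \<ge> 0" unfolding k_def by simp
  \<comment> \<open>Doubles of numbers up to (p - 1)/2 stay below p, so the reduction modulo p does
    nothing.\<close>
  have C: "C = (\<lambda>x. x * 2) ` A"
  proof -
    have "(x * 2) mod int p = x * 2" if "x \<in> A" for x
      using that k unfolding A_def by (intro mod_pos_pos_trivial) auto
    then show ?thesis unfolding C_def B_def image_image by (intro image_cong) auto
  qed
  have "E = (\<lambda>x. x * 2) ` {2 * k + 1..4 * k + 1}"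
    unfolding E_def C A_def using k by auto
  then have "card E = card {2 * k + 1..4 * k + 1}"
    by (simp add: card_image inj_on_def)
  also have "\<dots> = nat (2 * k + 1)" by simp
  finally have "odd (card E)" using k0 by (simp add: even_nat_iff)
  then show ?thesis using gauss_lemma by simp
qed

lemma odd_residue_character_Legendre:
  fixes p :: nat
  assumes "prime p" "p mod 8 = 3"
  shows "odd_residue_character (int p) (\<lambda>n. Legendre n p)"
proof -
  have p: "2 < p" using assms by presburger
  have odd: "odd ((p - 1) div 2)" using assms(2) by presburger
  show ?thesis
  proof
    show "int p mod 8 = 3" using assms(2) by presburger
    show "Legendre (- 1) (int p) = - 1"
      using Legendre_minus_1[OF assms(1) p] odd by simp
    show "Legendre a p * Legendre a p = 1" if "\<not> int p dvd a" for a
      using that Legendre_cases[of a p] by (auto simp: Legendre_def cong_0_iff)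
  qed (use assms p in \<open>auto simp: Legendre_mult Legendre_2 intro: Legendre_cong\<close>)
qed

context odd_residue_character
begin

lemma chi_odd: "\<not> p dvd a \<Longrightarrow> odd (chi a)"
  using chi_sq[of a] by (metis even_mult_iff odd_one)

lemma not_square: "x ^ 2 \<noteq> p"
proof
  assume x: "x ^ 2 = p"
  then obtain j where "x = 2 * j + 1" using odd_p by (metis even_power oddE zero_less_numeral)
  then have "p = 4 * (j ^ 2 + j) + 1" using x by (simp add: power2_eq_square algebra_simps)
  then show False using p_mod_8 by presburger
qed

text \<open>Thue's argument. There are more than p pairs (a, b) of numbers from 0 to the integer
  part of sqrt p, so two of them agree in a - t b modulo p. Their difference solves x^2 + 2 y^2 = p
  m with m = 1 or m = 2; in the second case x is even and halving it gives a solution for m =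
  1.\<close>

lemma sqrt_minus_2:
  assumes "QuadRes p (-2)"
  shows "\<exists>x y. x > 0 \<and> y > 0 \<and> x ^ 2 + 2 * y ^ 2 = p"
proof -
  obtain t where t: "[t ^ 2 = -2] (mod p)" using assms by (auto simp: QuadRes_def)
  define k where "k = nat (floor (sqrt p))"
  have k2: "int k ^ 2 \<le> p"
  proof -
    have "real k \<le> sqrt p" unfolding k_def using p_ge_3 by simp
    then have "real k ^ 2 \<le> sqrt p ^ 2" by (intro power_mono) auto
    then have "real_of_int (int k ^ 2) \<le> real_of_int p" using p_ge_3 by simp
    then show ?thesis by (simp only: of_int_le_iff)
  qed
  have k1: "p < (int k + 1) ^ 2"
  proof -
    have "sqrt p < real k + 1" unfolding k_def using p_ge_3 by linarith
    then have "sqrt p ^ 2 < (real k + 1) ^ 2" using p_ge_3 by (intro power_strict_mono) auto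
    then have "real_of_int p < real_of_int ((int k + 1) ^ 2)" using p_ge_3 by simp
    then show ?thesis by (simp only: of_int_less_iff)
  qed
  have ksq: "int k ^ 2 \<noteq> p"
    by (rule not_square)
  let ?A = "{0..int k} \<times> {0..int k}"
  define g where "g = (\<lambda>(a, b). (a - t * b) mod p)"
  have "\<not> inj_on g ?A"
  proof
    assume "inj_on g ?A"
    moreover have "g ` ?A \<subseteq> {0..<p}" unfolding g_def using p_ge_3 by (auto simp: split_beta)
    ultimately have "card ?A \<le> card {0..<p}" by (intro card_inj_on_le) auto
    moreover have "nat (int k + 1) = k + 1" by linarith
    ultimately have "(k + 1) ^ 2 \<le> nat p" by (simp add: card_cartesian_product power2_eq_square)
    then have "int ((k + 1) ^ 2) \<le> p" using p_ge_3 by linarith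
    then show False using k1 by (simp add: add.commute)
  qed
  then obtain a b c d where abcd: "(a, b) \<in> ?A" "(c, d) \<in> ?A" "(a, b) \<noteq> (c, d)" "g (a, b) = g (c, d)"
    by (force simp: inj_on_def)
  define x y where "x = \<bar>a - c\<bar>" and "y = \<bar>b - d\<bar>"
  have "p dvd (a - t * b) - (c - t * d)"
    using abcd(4) by (simp add: g_def mod_eq_dvd_iff)
  \<comment> \<open>Multiplying by the conjugate gives (a - c)^2 - t^2 (b - d)^2; adding (t^2 + 2)(b
    - d)^2 removes t.\<close>
  then have "p dvd ((a - c) - t * (b - d)) * ((a - c) + t * (b - d))"
    by (intro dvd_mult2) (simp add: algebra_simps)
  moreover have "p dvd (t ^ 2 + 2) * (b - d) ^ 2" using t by (simp add: cong_iff_dvd_diff)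
  ultimately have "p dvd ((a - c) - t * (b - d)) * ((a - c) + t * (b - d)) + (t ^ 2 + 2) * (b - d) ^ 2"
    by (rule dvd_add)
  also have "((a - c) - t * (b - d)) * ((a - c) + t * (b - d)) + (t ^ 2 + 2) * (b - d) ^ 2 = x ^ 2 + 2 * y ^ 2"
    by (simp add: x_def y_def power2_eq_square algebra_simps)
  finally have dv: "p dvd x ^ 2 + 2 * y ^ 2" .
  have xy: "0 \<le> x" "x \<le> k" "0 \<le> y" "y \<le> k" "x \<noteq> 0 \<or> y \<noteq> 0"
    using abcd by (auto simp: x_def y_def)
  then have "x ^ 2 \<le> int k ^ 2" "y ^ 2 \<le> int k ^ 2" by (auto intro!: power_mono)
  then have le: "x ^ 2 < p" "y ^ 2 < p" using k2 ksq by auto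
  obtain m where m: "x ^ 2 + 2 * y ^ 2 = p * m" using dv by (auto simp: dvd_def)
  have "x ^ 2 > 0 \<or> y ^ 2 > 0" using xy(5) by simp
  moreover have "x ^ 2 \<ge> 0" "y ^ 2 \<ge> 0" by auto
  ultimately have "p * m > 0" using m by linarith
  then have "m > 0" using p_ge_3 by (simp add: zero_less_mult_iff)
  moreover have "p * m < p * 3" using m le by simp
  then have "m < 3" using p_ge_3 by simp
  ultimately consider "m = 1" | "m = 2" by linarith
  then have "\<exists>x y. x ^ 2 + 2 * y ^ 2 = p"
  proof cases
    case 2
    then have "even x" using m by (metis even_add even_mult_iff even_power even_numeral)
    then obtain z where "x = 2 * z" by blast
    then have "y ^ 2 + 2 * z ^ 2 = p" using m 2 by (simp add: power2_eq_square)
    then show ?thesis by blast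
  qed (use m in auto)
  then obtain x y where xy: "x ^ 2 + 2 * y ^ 2 = p" by blast
  have "x \<noteq> 0" using xy odd_p by auto
  moreover have "y \<noteq> 0" using xy not_square[of x] by auto
  ultimately show ?thesis using xy by (intro exI[of _ "\<bar>x\<bar>"] exI[of _ "\<bar>y\<bar>"]) auto
qed

text \<open>The two composition identities for x^2 + 2 y^2 write p^2 as a square plus twice a
  square. If p divides a d - b c, this leaves only the value 0; p cannot divide the positive a d + b
  c, since twice its square would exceed p^2.\<close>

lemma two_squares_unique:
  fixes a b c d :: int
  assumes "a ^ 2 + 2 * b ^ 2 = p" "c ^ 2 + 2 * d ^ 2 = p" "a > 0" "b > 0" "c > 0" "d > 0"
  shows "a = c \<and> b = d"
proof -
  have p0: "p > 0" using p_ge_3 by simp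
  have eq: "(a * d - b * c) * (a * d + b * c) = p * (d ^ 2 - b ^ 2)"
  proof -
    have "(a * d - b * c) * (a * d + b * c) = (a ^ 2 + 2 * b ^ 2) * d ^ 2 - b ^ 2 * (c ^ 2 + 2 * d ^ 2)"
      by (simp add: power2_eq_square algebra_simps)
    then show ?thesis unfolding assms(1,2) by (simp add: algebra_simps)
  qed
  then have "p dvd (a * d - b * c) \<or> p dvd (a * d + b * c)"
    using prime_p by (metis dvd_triv_left prime_dvd_mult_iff)
  then have "a * d - b * c = 0"
  proof
    assume dv: "p dvd a * d - b * c"
    have "(a * c + 2 * b * d) ^ 2 + 2 * (a * d - b * c) ^ 2 = (a ^ 2 + 2 * b ^ 2) * (c ^ 2 + 2 * d ^ 2)"
      by (simp add: power2_eq_square algebra_simps)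
    also have "\<dots> = p ^ 2" unfolding assms(1,2) by (simp add: power2_eq_square)
    finally have *: "(a * c + 2 * b * d) ^ 2 + 2 * (a * d - b * c) ^ 2 = p ^ 2" .
    have "a * c + 2 * b * d > 0" using assms by (simp add: add_pos_pos)
    then have "(a * c + 2 * b * d) ^ 2 > 0" by simp
    moreover have "(a * d - b * c) ^ 2 \<ge> 0" by simp
    ultimately have "\<bar>a * d - b * c\<bar> ^ 2 < p ^ 2" using * unfolding power2_abs by linarith
    then have "\<bar>a * d - b * c\<bar> < p" using p0 by (meson less_imp_le power_less_imp_less_base)
    then show ?thesis using dv zdvd_not_zless[of "\<bar>a * d - b * c\<bar>" p] by auto
  next
    assume dv: "p dvd a * d + b * c"
    have "(a * c - 2 * b * d) ^ 2 + 2 * (a * d + b * c) ^ 2 = (a ^ 2 + 2 * b ^ 2) * (c ^ 2 + 2 * d ^ 2)"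
      by (simp add: power2_eq_square algebra_simps)
    also have "\<dots> = p ^ 2" unfolding assms(1,2) by (simp add: power2_eq_square)
    finally have *: "(a * c - 2 * b * d) ^ 2 + 2 * (a * d + b * c) ^ 2 = p ^ 2" .
    have pos: "a * d + b * c > 0" using assms by (simp add: add_pos_pos)
    have "p \<le> a * d + b * c" using dv pos by (rule zdvd_imp_le)
    then have "p ^ 2 \<le> (a * d + b * c) ^ 2" using p0 by (intro power_mono) auto
    moreover have "p ^ 2 > 0" using p0 by simp
    moreover have "(a * c - 2 * b * d) ^ 2 \<ge> 0" by simp
    ultimately show ?thesis using * by linarith
  qed
  then have "d ^ 2 = b ^ 2" using eq p0 by simp
  then have "d = b" using assms by (simp add: power2_eq_iff_nonneg)
  then have "a ^ 2 = c ^ 2" using assms(1,2) by simp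
  then have "a = c" using assms by (simp add: power2_eq_iff_nonneg)
  then show ?thesis using \<open>d = b\<close> by simp
qed

text \<open>The involution matches the points with u < v with those with v < u, which together
  contribute an even number.\<close>

lemma sum_parity_symmetric:
  fixes g :: "'a \<Rightarrow> int" and u v :: "'a \<Rightarrow> int"
  assumes "finite A" "\<And>x. x \<in> A \<Longrightarrow> s x \<in> A" "\<And>x. x \<in> A \<Longrightarrow> s (s x) = x"
    "\<And>x. x \<in> A \<Longrightarrow> g (s x) = g x" "\<And>x. x \<in> A \<Longrightarrow> u (s x) = v x" "\<And>x. x \<in> A \<Longrightarrow> v (s x) = u x"
  shows "even (sum g A) \<longleftrightarrow> even (sum g {x\<in>A. u x = v x})"
proof -
  have A: "A = {x\<in>A. u x = v x} \<union> ({x\<in>A. u x < v x} \<union> {x\<in>A. v x < u x})" by auto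
  have "sum g A = sum g {x\<in>A. u x = v x} + sum g ({x\<in>A. u x < v x} \<union> {x\<in>A. v x < u x})"
    by (subst A, rule sum.union_disjoint) (use assms(1) in auto)
  also have "sum g ({x\<in>A. u x < v x} \<union> {x\<in>A. v x < u x}) = sum g {x\<in>A. u x < v x} + sum g {x\<in>A. v x < u x}"
    by (rule sum.union_disjoint) (use assms(1) in auto)
  also have "sum g {x\<in>A. v x < u x} = sum g {x\<in>A. u x < v x}"
    by (rule sum.reindex_bij_witness[of _ s s]) (use assms in auto)
  finally show ?thesis by simp
qed

text \<open>Exchanging y with L and Y with l shows that modulo 2 only the solution with y = L, Y = l
  counts, and it comes from the unique representation of p by y^2 + 2 Y^2.\<close>
lemma central_sum_odd:
  assumes "QuadRes p (-2)"
  shows "odd central_sum"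
proof -
  obtain x z where xz: "x > 0" "z > 0" "x ^ 2 + 2 * z ^ 2 = p" using sqrt_minus_2[OF assms] by blast
  have "even central_sum \<longleftrightarrow> even (sum qm (quads p))"
  proof -
    \<comment> \<open>Modulo 2 the odd factors \<open>qchi\<close> and \<open>qb\<close> drop
      out.\<close>
    have "even (\<Sum>q\<in>quads p. qchi q * (qb q * qm q) - qm q)"
    proof (rule dvd_sum)
      fix q assume q: "q \<in> quads p"
      obtain y Y l L where q': "q = (y, Y, l, L)" by (cases q)
      note b = quads_bounds[OF q[unfolded q']]
      have "odd (y * L + 2 * Y * l)" using odd_p b(9) by simp
      then have "odd (y * L)" by simp
      then have qb: "odd (qb q)" by (simp add: q')
      have "\<not> p dvd y * l" using b(1-8) not_dvd_small prime_p by (simp add: prime_dvd_mult_iff)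
      then have "odd (qchi q)" using chi_odd by (simp add: q')
      with qb show "even (qchi q * (qb q * qm q) - qm q)" by simp
    qed
    then show ?thesis unfolding central_sum_def sum_subtractf by simp
  qed
  also have "\<dots> \<longleftrightarrow> even (sum qm {q \<in> quads p. fst q = snd (snd (snd q))})"
    by (rule sum_parity_symmetric[where s = "\<lambda>(y, Y, l, L). (L, Y, l, y)"], rule finite_quads)
       (auto simp: quads_def mult_ac)
  also have "\<dots> \<longleftrightarrow> even (sum qm {q \<in> {q \<in> quads p. fst q = snd (snd (snd q))}. fst (snd q) = fst (snd (snd q))})"
    by (rule sum_parity_symmetric[where s = "\<lambda>(y, Y, l, L). (y, l, Y, L)"],
        rule finite_subset[OF _ finite_quads]) (auto simp: quads_def mult_ac)
  also have "{q \<in> {q \<in> quads p. fst q = snd (snd (snd q))}. fst (snd q) = fst (snd (snd q))} = {(x, z, z, x)}"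
  proof -
    have "y = x \<and> Y = z" if "y * y + 2 * Y * Y = p" "y > 0" "Y > 0" for y Y
      using two_squares_unique[of y Y x z] that xz by (simp add: power2_eq_square)
    then show ?thesis using xz by (auto simp: quads_def power2_eq_square)
  qed
  also have "even (sum qm {(x, z, z, x)}) \<longleftrightarrow> even x \<or> even z" by auto
  finally have "even central_sum \<longleftrightarrow> even x \<or> even z" .
  moreover have "odd x" using xz odd_p by auto
  \<comment> \<open>An even z would give p = x^2 = 1 modulo 8.\<close>
  moreover have "odd z"
  proof
    assume "even z"
    then have "4 dvd z ^ 2" by (auto elim!: evenE simp: power2_eq_square)
    then obtain w where w: "z ^ 2 = 4 * w" by blast
    have "x ^ 2 mod 8 = 1"
    proof -
      obtain j where "x = 2 * j + 1" using \<open>odd x\<close> by (elim oddE)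
      moreover have "even (j * (j + 1))" by simp
      then obtain i where "j * (j + 1) = 2 * i" by blast
      ultimately have "x ^ 2 = 1 + i * 8" by (simp add: power2_eq_square algebra_simps)
      then show ?thesis by simp
    qed
    then show False using xz(3) w p_mod_8 by presburger
  qed
  ultimately show ?thesis by simp
qed

end

section \<open>The Kronecker symbol as a Legendre symbol modulo p\<close>

lemma Legendre_1: "p > 1 \<Longrightarrow> Legendre 1 p = 1"
  unfolding Legendre_def QuadRes_def
  by (auto simp: cong_iff_dvd_diff intro!: exI[of _ 1] dest: zdvd_imp_le)

lemma Legendre_prod_power:
  fixes p :: nat
  assumes "prime p" "2 < p"
  shows "Legendre (\<Prod>x\<in>A. g x ^ m x) p = (\<Prod>x\<in>A. Legendre (g x) p ^ m x)"
proof -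
  have pow: "Legendre (a ^ k) p = Legendre a p ^ k" for a and k :: nat
    by (induction k) (use assms in \<open>auto simp: Legendre_1 Legendre_mult\<close>)
  show ?thesis
    by (induction A rule: infinite_finite_induct)
       (use assms in \<open>auto simp: Legendre_1 Legendre_mult pow\<close>)
qed

text \<open>Quadratic reciprocity for -p = 1 modulo 4: the sign of (-1/q) cancels the reciprocity
  sign. At q = 2 both sides are -1 because -p = 5 modulo 8, and at q = p both are 0.\<close>

lemma kronecker_prime_eq_Legendre:
  fixes p q :: nat
  assumes "prime p" "p mod 8 = 3" "prime q"
  shows "kronecker_prime (- int p) q = Legendre q p"
proof -
  have p: "2 < p" using assms by presburger
  consider "q = 2" | "q = p" | "q > 2" "q \<noteq> p" using prime_ge_2_nat[OF assms(3)] by linarith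
  then show ?thesis
  proof cases
    case 1
    moreover have "odd p" "(- int p) mod 8 = 5" using assms(2) by presburger+
    ultimately show ?thesis using assms by (simp add: kronecker_prime_def Legendre_2)
  next
    case 2
    then show ?thesis using p by (simp add: kronecker_prime_def Legendre_def cong_0_iff)
  next
    case 3
    have "Legendre (- int p) q = Legendre (-1) q * Legendre p q"
      using Legendre_mult[OF assms(3) 3(1), of "-1" "int p"] by simp
    also have "Legendre (-1) q = (-1) ^ ((q - 1) div 2)"
      by (rule Legendre_minus_1[OF assms(3) 3(1)])
    also have "\<dots> = (-1) ^ ((p - 1) div 2 * ((q - 1) div 2))"
    proof -
      have "odd ((p - 1) div 2)" using assms(2) by presburger
      then show ?thesis by (simp add: power_mult)
    qed
    also have "\<dots> = Legendre p q * Legendre q p"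
      using Quadratic_Reciprocity[OF assms(1) p assms(3) 3(1)] 3 by simp
    also have "Legendre p q * Legendre q p * Legendre p q = (Legendre p q * Legendre p q) * Legendre q p"
      by simp
    also have "Legendre p q * Legendre p q = 1"
    proof -
      have "\<not> int q dvd int p" using assms 3 by (auto dest: primes_dvd_imp_eq)
      then show ?thesis by (simp add: Legendre_def cong_0_iff)
    qed
    finally show ?thesis using 3 by (simp add: kronecker_prime_def)
  qed
qed

lemma kronecker_eq_Legendre:
  fixes p :: nat
  assumes "prime p" "p mod 8 = 3"
  shows "kronecker (- int p) n = Legendre n p"
proof (cases "n = 0")
  case True
  then show ?thesis by (simp add: kronecker_def Legendre_def)
next
  case False
  have p: "2 < p" using assms by presburger
  have "n = (\<Prod>q\<in>prime_factors n. q ^ multiplicity q n)"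
    using False by (intro prime_factorization_nat) simp
  then have "int n = int (\<Prod>q\<in>prime_factors n. q ^ multiplicity q n)" by (rule arg_cong)
  also have "\<dots> = (\<Prod>q\<in>prime_factors n. int q ^ multiplicity q n)" by simp
  finally have "Legendre n p = (\<Prod>q\<in>prime_factors n. Legendre q p ^ multiplicity q n)"
    using Legendre_prod_power[OF assms(1) p, of int "\<lambda>q. multiplicity q n" "prime_factors n"] by simp
  also have "\<dots> = (\<Prod>q\<in>prime_factors n. kronecker_prime (- int p) q ^ multiplicity q n)"
  proof (intro prod.cong refl)
    fix q assume "q \<in> prime_factors n"
    then have "prime q" by (rule in_prime_factors_imp_prime)
    from kronecker_prime_eq_Legendre[OF assms this]
    show "Legendre q p ^ multiplicity q n = kronecker_prime (- int p) q ^ multiplicity q n" by simp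
  qed
  also have "\<dots> = kronecker (- int p) n" using False by (simp add: kronecker_def)
  finally show ?thesis by simp
qed

lemma QuadRes_minus_2:
  fixes p :: nat
  assumes "prime p" "p mod 8 = 3"
  shows "QuadRes p (-2)"
proof -
  interpret odd_residue_character "int p" "\<lambda>n. Legendre n p"
    by (rule odd_residue_character_Legendre[OF assms])
  show ?thesis using chi_minus_2 by (auto simp: Legendre_def split: if_splits)
qed

section \<open>The Eisenstein series of weight 2\<close>

lemma has_sum_int_split:
  fixes f :: "int \<Rightarrow> 'a :: {topological_comm_monoid_add, t3_space}"
  assumes "((\<lambda>n::nat. f (int n)) has_sum A) UNIV" "((\<lambda>n::nat. f (- 1 - int n)) has_sum B) UNIV"
  shows "(f has_sum (A + B)) UNIV"
proof -
  have "(f has_sum A) (range int)"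
    using assms(1) by (subst has_sum_reindex) (auto simp: o_def inj_on_def)
  moreover have "(f has_sum B) (range (\<lambda>n. - 1 - int n))"
    using assms(2) by (subst has_sum_reindex) (auto simp: o_def inj_on_def)
  moreover have "range int \<inter> range (\<lambda>n. - 1 - int n) = {}" by auto
  moreover have "range int \<union> range (\<lambda>n. - 1 - int n) = UNIV"
  proof -
    have "x \<in> range int \<union> range (\<lambda>n. - 1 - int n)" for x
    proof (cases "x \<ge> 0")
      case True then show ?thesis by (metis UnI1 rangeI zero_le_imp_eq_int)
    next
      case False
      then have "x = - 1 - int (nat (- 1 - x))" by simp
      then show ?thesis by blast
    qed
    then show ?thesis by blast
  qed
  ultimately show ?thesis using has_sum_Un_disjoint by metis
qed

lemma range_Suc_eq: "range Suc = - {0}"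
proof -
  have "x \<in> range Suc" if "x \<noteq> 0" for x using not0_implies_Suc[OF that] by blast
  then show ?thesis by blast
qed

lemma has_sum_minus:
  fixes f g :: "'b \<Rightarrow> 'a :: real_normed_vector"
  assumes "(f has_sum a) A" "(g has_sum b) A"
  shows "((\<lambda>x. f x - g x) has_sum (a - b)) A"
  using has_sum_add[OF assms(1), of "\<lambda>x. - g x" "- b"] assms(2) by (simp add: has_sum_uminus)

text \<open>This makes telescoping sums accessible: an unconditional sum over the integers is the
  limit over symmetric intervals.\<close>

lemma has_sum_int_symmetric:
  fixes f :: "int \<Rightarrow> 'a :: {topological_comm_monoid_add}"
  assumes "(f has_sum S) UNIV"
  shows "(\<lambda>M. sum f {- int M..int M}) \<longlonglongrightarrow> S"
proof -
  have "filterlim (\<lambda>M. {- int M..int M}) (finite_subsets_at_top UNIV) sequentially"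
    unfolding filterlim_iff eventually_finite_subsets_at_top
  proof (intro allI impI, elim exE conjE)
    fix P :: "int set \<Rightarrow> bool" and X
    assume X: "finite X" "\<forall>Y. finite Y \<and> X \<subseteq> Y \<and> Y \<subseteq> UNIV \<longrightarrow> P Y"
    define N where "N = Max (insert 0 ((\<lambda>x. nat \<bar>x\<bar>) ` X))"
    have N: "\<bar>x\<bar> \<le> int N" if "x \<in> X" for x
    proof -
      have "nat \<bar>x\<bar> \<le> N" unfolding N_def using that X(1) by (intro Max_ge) auto
      then show ?thesis by linarith
    qed
    show "\<forall>\<^sub>F M in sequentially. P {- int M..int M}"
      using eventually_ge_at_top[of N]
    proof eventually_elim
      case (elim M)
      have "X \<subseteq> {- int M..int M}"
        using N elim by (force dest: N)
      then show ?case using X(2) by auto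
    qed
  qed
  then show ?thesis using assms unfolding has_sum_def by (rule filterlim_compose[rotated])
qed

section \<open>Partial fractions of the cotangent and of its derivative\<close>

lemma Digamma_cot:
  fixes w :: complex
  assumes "w \<notin> \<int>"
  shows "Digamma (1 - w) - Digamma w = pi * cot (pi * w)"
proof -
  have w: "w \<notin> \<int>\<^sub>\<le>\<^sub>0" "1 - w \<notin> \<int>\<^sub>\<le>\<^sub>0"
    using assms nonpos_Ints_subset_Ints by (auto dest!: subsetD intro: Ints_diff)
  have 1: "((\<lambda>z. rGamma z * rGamma (1 - z)) has_field_derivative
      (rGamma w * rGamma (1 - w) * (Digamma (1 - w) - Digamma w))) (at w)"
    by (rule derivative_eq_intros refl has_field_derivative_rGamma_no_nonpos_int w)+
       (use w in \<open>auto simp: algebra_simps\<close>)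
  have 2: "((\<lambda>z. sin (of_real pi * z) / of_real pi) has_field_derivative cos (of_real pi * w)) (at w)"
    by (rule derivative_eq_intros refl)+ simp_all
  have "(\<lambda>z. rGamma z * rGamma (1 - z :: complex)) = (\<lambda>z. sin (of_real pi * z) / of_real pi)"
    by (rule ext) (rule rGamma_reflection_complex)
  with 1 2 have eq: "rGamma w * rGamma (1 - w) * (Digamma (1 - w) - Digamma w) = cos (of_real pi * w)"
    using DERIV_unique by metis
  have "sin (of_real pi * w) / of_real pi \<noteq> 0"
    using w rGamma_reflection_complex[of w] by (metis mult_eq_0_iff rGamma_eq_zero_iff)
  with eq show ?thesis
    unfolding rGamma_reflection_complex cot_def by (simp add: field_simps)
qed

lemma sin_pi_nonzero: "w \<notin> \<int> \<Longrightarrow> sin (complex_of_real pi * w) \<noteq> 0"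
proof
  assume w: "w \<notin> \<int>" and "sin (complex_of_real pi * w) = 0"
  then obtain n where "complex_of_real pi * w = of_real (of_int n * pi)"
    by (auto simp: sin_eq_0 mult_ac)
  then have "w = of_int n" by simp
  then show False using w by simp
qed

text \<open>The derivative of \<open>Digamma_cot\<close>, which in turn is the logarithmic
  derivative of the reflection formula for the Gamma function.\<close>

lemma Polygamma_1_sin:
  fixes w :: complex
  assumes w: "w \<notin> \<int>"
  shows "Polygamma 1 w + Polygamma 1 (1 - w) = (pi / sin (pi * w)) ^ 2"
proof -
  have w': "w \<notin> \<int>\<^sub>\<le>\<^sub>0" "1 - w \<notin> \<int>\<^sub>\<le>\<^sub>0"
    using assms nonpos_Ints_subset_Ints by (auto dest!: subsetD intro: Ints_diff)
  have 1: "((\<lambda>w. Digamma (1 - w) - Digamma w) has_field_derivative (- Polygamma 1 (1 - w) - Polygamma 1 w)) (at w)"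
    by (rule derivative_eq_intros refl w')+ (use w' in \<open>auto\<close>)
  have 2: "((\<lambda>w. of_real pi * cot (of_real pi * w)) has_field_derivative
      (- ((pi / sin (pi * w)) ^ 2))) (at w)"
    by (rule derivative_eq_intros refl DERIV_cot[THEN DERIV_chain2])+
       (use sin_pi_nonzero[OF w] in \<open>auto intro!: derivative_eq_intros simp: field_simps power2_eq_square\<close>)
  have 3: "\<forall>\<^sub>F z in nhds w. Digamma (1 - z) - Digamma z = of_real pi * cot (of_real pi * z)"
  proof -
    have "open (- (\<int> :: complex set))" using closed_Ints by blast
    then have "\<forall>\<^sub>F z in nhds w. z \<in> - \<int>" using w by (intro eventually_nhds_in_open) auto
    then show ?thesis by eventually_elim (use Digamma_cot in auto)
  qed
  have "- Polygamma 1 (1 - w) - Polygamma 1 w = - ((pi / sin (pi * w)) ^ 2)"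
    by (rule DERIV_unique[OF 1[unfolded DERIV_cong_ev[OF refl 3 refl]] 2])
  then show ?thesis by (simp add: algebra_simps minus_equation_iff)
qed

lemma summable_norm_inverse_sq:
  fixes z :: complex
  shows "summable (\<lambda>k::nat. norm (1 / (z + of_nat k) ^ 2))"
proof (rule summable_comparison_test_ev)
  show "summable (\<lambda>k. 4 * inverse (real k ^ 2))"
    by (intro summable_mult inverse_power_summable) auto
  show "\<forall>\<^sub>F k in sequentially. norm (norm (1 / (z + of_nat k) ^ 2)) \<le> 4 * inverse (real k ^ 2)"
    using eventually_ge_at_top[of "nat \<lceil>2 * norm z\<rceil> + 1"]
  proof eventually_elim
    case (elim k)
    then have k: "real k \<ge> 2 * norm z" "real k > 0" by linarith+
    have "norm (z + of_nat k) \<ge> real k - norm z"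
      by (metis norm_diff_ineq norm_of_nat add.commute)
    then have "norm (z + of_nat k) \<ge> real k / 2" using k by linarith
    then have "norm (z + of_nat k) ^ 2 \<ge> (real k / 2) ^ 2" using k by (intro power_mono) auto
    then have "1 / norm (z + of_nat k) ^ 2 \<le> 1 / (real k / 2) ^ 2"
      using k by (intro divide_left_mono) (auto intro!: mult_pos_pos)
    then show ?case by (simp add: norm_divide norm_power power_divide field_simps)
  qed
qed

lemma has_sum_inverse_sq_int:
  fixes w :: complex
  assumes w: "w \<notin> \<int>"
  shows "((\<lambda>n::int. 1 / (w + of_int n) ^ 2) has_sum (pi / sin (pi * w)) ^ 2) UNIV"
proof -
  have nz: "w \<noteq> 0" "1 - w \<noteq> 0" using w by auto
  have s: "((\<lambda>k. 1 / (z + of_nat k) ^ 2) has_sum Polygamma 1 z) UNIV" if "z \<noteq> 0" for z :: complex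
    using Polygamma_LIMSEQ[OF that, of 1]
    by (intro norm_summable_imp_has_sum summable_norm_inverse_sq) (simp add: numeral_2_eq_2 inverse_eq_divide)
  have "((\<lambda>n::int. 1 / (w + of_int n) ^ 2) has_sum (Polygamma 1 w + Polygamma 1 (1 - w))) UNIV"
  proof (rule has_sum_int_split)
    show "((\<lambda>n. 1 / (w + of_int (int n)) ^ 2) has_sum Polygamma 1 w) UNIV" using s[OF nz(1)] by simp
    have "(w + of_int (- 1 - int n)) ^ 2 = (1 - w + of_nat n) ^ 2" for n
      by (simp add: power2_eq_square algebra_simps)
    then show "((\<lambda>n. 1 / (w + of_int (- 1 - int n)) ^ 2) has_sum Polygamma 1 (1 - w)) UNIV"
      using s[OF nz(2)] by simp
  qed
  then show ?thesis using Polygamma_1_sin[OF w] by simp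
qed

lemma summable_norm_diff_inverse:
  fixes w w' :: complex
  shows "summable (\<lambda>k::nat. norm (1 / (w + of_nat k) - 1 / (w' + of_nat k)))"
proof (rule summable_comparison_test_ev)
  let ?g = "\<lambda>k::nat. norm (w' - w) * (norm (1 / (w + of_nat k) ^ 2) + norm (1 / (w' + of_nat k) ^ 2))"
  show "summable ?g"
    by (intro summable_mult summable_add summable_norm_inverse_sq)
  show "\<forall>\<^sub>F k in sequentially. norm (norm (1 / (w + of_nat k) - 1 / (w' + of_nat k))) \<le> ?g k"
    using eventually_gt_at_top[of "nat \<lceil>norm w\<rceil> + nat \<lceil>norm w'\<rceil>"]
  proof eventually_elim
    case (elim k)
    then have "real k > norm w" "real k > norm w'" by linarith+
    then have nz: "w + of_nat k \<noteq> 0" "w' + of_nat k \<noteq> 0"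
      by (metis add_eq_0_iff norm_minus_cancel norm_of_nat less_irrefl)+
    then have "1 / (w + of_nat k) - 1 / (w' + of_nat k) = (w' - w) * ((1 / (w + of_nat k)) * (1 / (w' + of_nat k)))"
      by (simp add: field_simps)
    then have "norm (1 / (w + of_nat k) - 1 / (w' + of_nat k)) =
       norm (w' - w) * (norm (1 / (w + of_nat k)) * norm (1 / (w' + of_nat k)))"
      by (simp add: norm_mult norm_divide)
    also have "norm (1 / (w + of_nat k)) * norm (1 / (w' + of_nat k)) \<le>
        norm (1 / (w + of_nat k)) ^ 2 + norm (1 / (w' + of_nat k)) ^ 2"
    proof -
      have "x * y \<le> x ^ 2 + y ^ 2" if "x \<ge> 0" "y \<ge> 0" for x y :: real
      proof -
        have "2 * (x * y) \<le> x ^ 2 + y ^ 2" using sum_squares_bound[of x y] by simp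
        moreover have "x * y \<ge> 0" using that by simp
        ultimately show ?thesis by linarith
      qed
      then show ?thesis by simp
    qed
    finally show ?case by (simp add: mult_left_mono norm_divide norm_power power_divide)
  qed
qed

text \<open>The cotangent series itself converges only conditionally; the difference of its values
  at two points converges absolutely and suffices for the telescoping terms.\<close>

lemma has_sum_cot_int:
  fixes w w' :: complex
  assumes w: "w \<notin> \<int>" "w' \<notin> \<int>"
  shows "((\<lambda>n::int. 1 / (w + of_int n) - 1 / (w' + of_int n)) has_sum
           (pi * cot (pi * w) - pi * cot (pi * w'))) UNIV"
proof -
  have s: "((\<lambda>k. 1 / (z + of_nat k) - 1 / (z' + of_nat k)) has_sum (Digamma z' - Digamma z)) UNIV"
    if "z \<noteq> 0" "z' \<noteq> 0" for z z' :: complex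
  proof (rule norm_summable_imp_has_sum[OF summable_norm_diff_inverse])
    have "(\<lambda>m. (of_real (ln (real m)) - (\<Sum>n<m. inverse (z' + of_nat n))) -
        (of_real (ln (real m)) - (\<Sum>n<m. inverse (z + of_nat n)))) \<longlonglongrightarrow> Digamma z' - Digamma z"
      by (intro tendsto_diff Digamma_LIMSEQ that)
    then show "(\<lambda>k. 1 / (z + of_nat k) - 1 / (z' + of_nat k)) sums (Digamma z' - Digamma z)"
      by (simp add: sums_def sum_subtractf inverse_eq_divide)
  qed
  have nz: "w \<noteq> 0" "1 - w \<noteq> 0" "w' \<noteq> 0" "1 - w' \<noteq> 0" using w by auto
  have "((\<lambda>n::int. 1 / (w + of_int n) - 1 / (w' + of_int n)) has_sum
      ((Digamma w' - Digamma w) + (Digamma (1 - w) - Digamma (1 - w')))) UNIV"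
  proof (rule has_sum_int_split)
    show "((\<lambda>n. 1 / (w + of_int (int n)) - 1 / (w' + of_int (int n))) has_sum (Digamma w' - Digamma w)) UNIV"
      using s[OF nz(1,3)] by simp
    have "1 / (z + of_int (- 1 - int n)) = - (1 / (1 - z + of_nat n))" for n and z :: complex
      by (subst minus_divide_right) (simp add: algebra_simps)
    then show "((\<lambda>n. 1 / (w + of_int (- 1 - int n)) - 1 / (w' + of_int (- 1 - int n))) has_sum
        (Digamma (1 - w) - Digamma (1 - w'))) UNIV"
      using s[OF nz(4,2)] by simp
  qed
  also have "(Digamma w' - Digamma w) + (Digamma (1 - w) - Digamma (1 - w')) =
     (Digamma (1 - w) - Digamma w) - (Digamma (1 - w') - Digamma w')" by simp
  finally show ?thesis unfolding Digamma_cot[OF w(1)] Digamma_cot[OF w(2)] .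
qed

text \<open>The closed form of the sum of 1/(m + i t n)^2 over m, without the term m = 0 if n =
  0.\<close>

definition eis_row :: "real \<Rightarrow> int \<Rightarrow> complex" where
  "eis_row t n = (if n = 0 then pi ^ 2 / 3 else (pi / sin (pi * (\<i> * t * n))) ^ 2)"

text \<open>The series G_2 at i t in Eisenstein's order of summation, first over m and then over
  n.\<close>

definition eis_G2 :: "real \<Rightarrow> complex" where
  "eis_G2 t = (\<Sum>\<^sub>\<infinity>n. eis_row t n)"

text \<open>Subtracting the telescoping term 1/(w^2 - 1/4) turns the conditionally convergent double
  series of 1/w^2 over the lattice into an absolutely convergent one.\<close>
definition eis_term :: "real \<Rightarrow> int \<Rightarrow> int \<Rightarrow> complex" where
  "eis_term t m n = (if m = 0 \<and> n = 0 then 0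
     else 1 / (of_int m + \<i> * t * of_int n) ^ 2 - 1 / ((of_int m + \<i> * t * of_int n) ^ 2 - 1 / 4))"

lemma has_sum_if_0: "((\<lambda>m::int. if m = 0 then c else 0) has_sum (c :: complex)) UNIV"
  by (rule has_sum_finite_neutralI[of "{0}"]) auto

lemma has_sum_inverse_sq_int_0:
  "((\<lambda>m::int. if m = 0 then 0 else 1 / (of_int m) ^ 2) has_sum (complex_of_real (pi ^ 2 / 3))) UNIV"
proof -
  have s: "((\<lambda>n::nat. 1 / (of_nat n + 1) ^ 2) has_sum complex_of_real (pi ^ 2 / 6)) UNIV"
  proof (rule norm_summable_imp_has_sum)
    show "summable (\<lambda>n. norm (1 / (of_nat n + 1 :: complex) ^ 2))"
      using summable_norm_inverse_sq[of 1] by (simp add: add.commute)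
    have "(\<lambda>n. complex_of_real (1 / (real n + 1) ^ 2)) sums complex_of_real (pi ^ 2 / 6)"
      using inverse_squares_sums unfolding sums_of_real_iff by (simp add: add.commute)
    then show "(\<lambda>n. 1 / (of_nat n + 1 :: complex) ^ 2) sums complex_of_real (pi ^ 2 / 6)" by simp
  qed
  have s0: "((\<lambda>n::nat. if int n = 0 then 0 else 1 / of_int (int n) ^ 2) has_sum complex_of_real (pi ^ 2 / 6)) UNIV"
  proof -
    have "((\<lambda>n::nat. if n = 0 then 0 else 1 / of_nat n ^ 2) has_sum complex_of_real (pi ^ 2 / 6)) (range Suc)"
      using s by (subst has_sum_reindex) (auto simp: o_def add.commute)
    then show ?thesis
      by (rule has_sum_cong_neutral[THEN iffD1, rotated -1]) (auto simp: range_Suc_eq)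
  qed
  have "of_int (- 1 - int n) ^ 2 = (of_nat n + 1 :: complex) ^ 2" for n
    by (simp add: power2_eq_square algebra_simps)
  then have "((\<lambda>m::int. if m = 0 then 0 else 1 / (of_int m) ^ 2) has_sum
      (complex_of_real (pi ^ 2 / 6) + complex_of_real (pi ^ 2 / 6))) UNIV"
    using s by (intro has_sum_int_split s0) (simp add: algebra_simps)
  then show ?thesis by (simp flip: of_real_add)
qed

lemma not_Ints_Im: "Im w \<noteq> 0 \<Longrightarrow> w \<notin> \<int>"
  by (auto elim!: Ints_cases)

lemma half_not_Ints: "of_int m - 1 / 2 \<notin> (\<int> :: complex set)"
proof
  assume "of_int m - 1 / 2 \<in> (\<int> :: complex set)"
  then obtain k where "of_int m - 1 / 2 = (of_int k :: complex)" by (elim Ints_cases)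
  then have "of_int (2 * m - 1) = (of_int (2 * k) :: complex)" by (simp add: field_simps)
  then have "2 * m - 1 = 2 * k" by (simp only: of_int_eq_iff)
  then show False by presburger
qed

lemma quarter_split:
  fixes w :: complex
  assumes "w - 1 / 2 \<noteq> 0" "w + 1 / 2 \<noteq> 0"
  shows "1 / (w ^ 2 - 1 / 4) = 1 / (w - 1 / 2) - 1 / (w + 1 / 2)"
proof -
  have "w ^ 2 - 1 / 4 = (w - 1 / 2) * (w + 1 / 2)" by (simp add: power2_eq_square algebra_simps)
  then show ?thesis using assms by (simp add: field_simps)
qed

lemma lattice_half_nonzero:
  assumes "t \<noteq> 0"
  shows "of_int m + \<i> * of_real t * of_int n - 1 / 2 \<noteq> 0" "of_int m + \<i> * of_real t * of_int n + 1 / 2 \<noteq> 0"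
proof -
  have "real_of_int m - 1 / 2 \<noteq> 0" "real_of_int m + 1 / 2 \<noteq> 0" for m
  proof -
    have "2 * m - 1 \<noteq> 0" "2 * m + 1 \<noteq> 0" by presburger+
    then have "real_of_int (2 * m - 1) \<noteq> 0" "real_of_int (2 * m + 1) \<noteq> 0" by (auto simp only: of_int_eq_0_iff)
    then show "real_of_int m - 1 / 2 \<noteq> 0" "real_of_int m + 1 / 2 \<noteq> 0" by auto
  qed
  then show "of_int m + \<i> * of_real t * of_int n - 1 / 2 \<noteq> 0" "of_int m + \<i> * of_real t * of_int n + 1 / 2 \<noteq> 0"
    by (auto simp: complex_eq_iff)
qed

lemma cot_shift_pi: "cot (complex_of_real pi * (w + 1 / 2)) = cot (of_real pi * (w - 1 / 2))"
proof -
  have "complex_of_real pi * (w + 1 / 2) = of_real pi * (w - 1 / 2) + of_real pi" by (simp add: algebra_simps)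
  then show ?thesis by (simp add: cot_def sin_add cos_add)
qed

text \<open>The telescoping terms of a row sum to 0 because the cotangent has period pi. The 4
  accounts for the origin, where \<open>eis_term\<close> is 0 by convention while 1/(w^2 - 1/4)
  would be -4.\<close>

lemma eis_row_sum:
  assumes "t \<noteq> 0"
  shows "((\<lambda>m. eis_term t m n) has_sum (eis_row t n - (if n = 0 then 4 else 0))) UNIV"
proof -
  let ?w = "\<i> * complex_of_real t * of_int n"
  have nI: "?w - 1 / 2 \<notin> \<int>" "?w + 1 / 2 \<notin> \<int>"
  proof -
    have "?w - 1 / 2 \<notin> \<int> \<and> ?w + 1 / 2 \<notin> \<int>"
    proof (cases "n = 0")
      case True then show ?thesis using half_not_Ints[of 0] half_not_Ints[of 1] by simp
    next
      case False then show ?thesis using assms by (auto intro!: not_Ints_Im)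
    qed
    then show "?w - 1 / 2 \<notin> \<int>" "?w + 1 / 2 \<notin> \<int>" by auto
  qed
  have b: "((\<lambda>m. 1 / ((of_int m + ?w) ^ 2 - 1 / 4)) has_sum 0) UNIV"
  proof -
    have "((\<lambda>m. 1 / (?w - 1 / 2 + of_int m) - 1 / (?w + 1 / 2 + of_int m)) has_sum 0) UNIV"
      using has_sum_cot_int[OF nI] by (simp add: cot_shift_pi)
    moreover have "1 / (?w - 1 / 2 + of_int m) - 1 / (?w + 1 / 2 + of_int m) = 1 / ((of_int m + ?w) ^ 2 - 1 / 4)" for m
      using quarter_split[OF lattice_half_nonzero[OF assms, of m n]] by (simp add: algebra_simps)
    ultimately show ?thesis by simp
  qed
  show ?thesis
  proof (cases "n = 0")
    case False
    have "((\<lambda>m. 1 / (?w + of_int m) ^ 2) has_sum (pi / sin (pi * ?w)) ^ 2) UNIV"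
      by (rule has_sum_inverse_sq_int) (use assms False in \<open>auto intro!: not_Ints_Im\<close>)
    then have "((\<lambda>m. 1 / (?w + of_int m) ^ 2 - 1 / ((of_int m + ?w) ^ 2 - 1 / 4)) has_sum
        (pi / sin (pi * ?w)) ^ 2 - 0) UNIV"
      using b by (rule has_sum_minus)
    then show ?thesis using False by (simp add: eis_term_def eis_row_def add.commute)
  next
    case True
    have "((\<lambda>m::int. (if m = 0 then 0 else 1 / (of_int m) ^ 2) - 1 / ((of_int m + ?w) ^ 2 - 1 / 4)
       - (if m = 0 then 4 else 0)) has_sum (complex_of_real (pi ^ 2 / 3) - 0 - 4)) UNIV"
      by (intro has_sum_minus has_sum_inverse_sq_int_0 b has_sum_if_0)
    also have "(\<lambda>m::int. (if m = 0 then 0 else 1 / (of_int m) ^ 2) - 1 / ((of_int m + ?w) ^ 2 - 1 / 4)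
       - (if m = 0 then 4 else 0)) = (\<lambda>m. eis_term t m n)"
      using True by (auto simp: eis_term_def fun_eq_iff)
    finally show ?thesis using True by (simp add: eis_row_def)
  qed
qed

text \<open>A potential for the columns: the telescoping terms of column m sum to
  \<open>eis_h t m - eis_h t (m + 1)\<close>.\<close>

definition eis_h :: "real \<Rightarrow> int \<Rightarrow> complex" where
  "eis_h t m = 1 / (\<i> * t) * (pi * cot (pi * ((of_int m - 1 / 2) / (\<i> * t))))"

text \<open>Taking (i t)^2 = -t^2 out of (m + i t n)^2 turns column m for t into row m for
  1/t.\<close>

lemma eis_col_sum:
  assumes "t \<noteq> 0"
  shows "((\<lambda>n. eis_term t m n) has_sum
    (- (1 / t ^ 2) * eis_row (1 / t) m - (eis_h t m - eis_h t (m + 1)) - (if m = 0 then 4 else 0))) UNIV"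
proof -
  define v where "v = (of_int m - 1 / 2) / (\<i> * complex_of_real t)"
  define v' where "v' = (of_int m + 1 / 2) / (\<i> * complex_of_real t)"
  have nI: "v \<notin> \<int>" "v' \<notin> \<int>"
  proof -
    have "real_of_int m - 1 / 2 \<noteq> 0" "real_of_int m + 1 / 2 \<noteq> 0"
      using lattice_half_nonzero[of 1 m 0] by (auto simp: complex_eq_iff)
    then show "v \<notin> \<int>" "v' \<notin> \<int>" using assms
      unfolding v_def v'_def by (auto intro!: not_Ints_Im simp: Im_divide power2_eq_square)
  qed
  have b: "((\<lambda>n. 1 / ((of_int m + \<i> * t * of_int n) ^ 2 - 1 / 4)) has_sum (eis_h t m - eis_h t (m + 1))) UNIV"
  proof -
    have "((\<lambda>n. 1 / (\<i> * t) * (1 / (v + of_int n) - 1 / (v' + of_int n))) has_sum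
       (1 / (\<i> * t) * (pi * cot (pi * v) - pi * cot (pi * v')))) UNIV"
      by (intro has_sum_cmult_right has_sum_cot_int nI)
    also have "(\<lambda>n. 1 / (\<i> * t) * (1 / (v + of_int n) - 1 / (v' + of_int n))) =
       (\<lambda>n. 1 / ((of_int m + \<i> * t * of_int n) ^ 2 - 1 / 4))"
    proof
      fix n
      have "1 / (\<i> * t) * (1 / (v + of_int n) - 1 / (v' + of_int n)) =
         1 / (\<i> * t * (v + of_int n)) - 1 / (\<i> * t * (v' + of_int n))"
        by (simp add: algebra_simps)
      also have "\<i> * t * (v + of_int n) = of_int m + \<i> * t * of_int n - 1 / 2"
        using assms by (simp add: v_def field_simps)
      also have "\<i> * t * (v' + of_int n) = of_int m + \<i> * t * of_int n + 1 / 2"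
        using assms by (simp add: v'_def field_simps)
      finally show "1 / (\<i> * t) * (1 / (v + of_int n) - 1 / (v' + of_int n)) =
        1 / ((of_int m + \<i> * t * of_int n) ^ 2 - 1 / 4)"
        using quarter_split[OF lattice_half_nonzero[OF assms, of m n]] by simp
    qed
    finally show ?thesis by (simp add: eis_h_def v_def v'_def algebra_simps)
  qed
  have sq: "(\<i> * complex_of_real t) ^ 2 = - of_real (t ^ 2)" by (simp add: power_mult_distrib)
  show ?thesis
  proof (cases "m = 0")
    case False
    have "((\<lambda>n. - (1 / t ^ 2) * (1 / (of_int m / (\<i> * t) + of_int n) ^ 2)) has_sum
       (- (1 / t ^ 2) * (pi / sin (pi * (of_int m / (\<i> * t)))) ^ 2)) UNIV"
      by (intro has_sum_cmult_right has_sum_inverse_sq_int)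
         (use assms False in \<open>auto intro!: not_Ints_Im simp: Im_divide power2_eq_square\<close>)
    also have "(\<lambda>n. - (1 / t ^ 2) * (1 / (of_int m / (\<i> * t) + of_int n) ^ 2)) =
       (\<lambda>n. 1 / (of_int m + \<i> * t * of_int n) ^ 2)"
    proof
      fix n
      have "of_int m + \<i> * t * of_int n = (\<i> * t) * (of_int m / (\<i> * t) + of_int n)"
        using assms by (simp add: field_simps)
      then have "(of_int m + \<i> * t * of_int n) ^ 2 = - of_real (t ^ 2) * (of_int m / (\<i> * t) + of_int n) ^ 2"
        by (simp only: power_mult_distrib[of "\<i> * t"] sq)
      then show "- (1 / t ^ 2) * (1 / (of_int m / (\<i> * t) + of_int n) ^ 2) = 1 / (of_int m + \<i> * t * of_int n) ^ 2"
        by simp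
    qed
    also have "(pi / sin (pi * (of_int m / (\<i> * t)))) ^ 2 = eis_row (1 / t) m"
    proof -
      have "pi * (of_int m / (\<i> * complex_of_real t)) = - (pi * (\<i> * complex_of_real (1 / t) * of_int m))"
        using assms by (simp add: field_simps)
      then show ?thesis using False unfolding eis_row_def by (simp only: sin_minus) (simp add: power2_eq_square)
    qed
    finally have "((\<lambda>n. 1 / (of_int m + \<i> * t * of_int n) ^ 2 - 1 / ((of_int m + \<i> * t * of_int n) ^ 2 - 1 / 4))
       has_sum (- (1 / t ^ 2) * eis_row (1 / t) m - (eis_h t m - eis_h t (m + 1)))) UNIV"
      using b by (rule has_sum_minus)
    then show ?thesis using False by (simp add: eis_term_def)
  next
    case True
    have "((\<lambda>n::int. complex_of_real (- (1 / t ^ 2)) * (if n = 0 then 0 else 1 / (of_int n) ^ 2)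
        - 1 / ((of_int m + \<i> * t * of_int n) ^ 2 - 1 / 4)
        - (if n = 0 then 4 else 0)) has_sum
        (complex_of_real (- (1 / t ^ 2)) * complex_of_real (pi ^ 2 / 3) - (eis_h t m - eis_h t (m + 1)) - 4)) UNIV"
      by (intro has_sum_minus has_sum_cmult_right has_sum_inverse_sq_int_0 b has_sum_if_0)
    also have "(\<lambda>n::int. complex_of_real (- (1 / t ^ 2)) * (if n = 0 then 0 else 1 / (of_int n) ^ 2)
        - 1 / ((of_int m + \<i> * t * of_int n) ^ 2 - 1 / 4)
        - (if n = 0 then 4 else 0)) = (\<lambda>n. eis_term t m n)"
      using True assms by (auto simp: eis_term_def fun_eq_iff power_mult_distrib field_simps)
    finally show ?thesis using True by (simp add: eis_row_def)
  qed
qed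

lemma abs_summable_int_product:
  "(\<lambda>(m::int, n::int). 1 / ((1 + \<bar>real_of_int m\<bar>) ^ 2 * (1 + \<bar>real_of_int n\<bar>) ^ 2)) summable_on UNIV \<times> UNIV"
proof -
  have n1: "cmod (1 + of_nat n) = 1 + real n" "cmod (2 + of_nat n) = 2 + real n" for n
    by (metis norm_of_nat of_nat_Suc) (metis norm_of_nat of_nat_add of_nat_numeral)
  have "summable (\<lambda>n::nat. 1 / (1 + real n) ^ 2)"
    using summable_norm_inverse_sq[of 1] n1 by (simp add: norm_divide norm_power)
  then have s: "(\<lambda>n::nat. 1 / (1 + real n) ^ 2) summable_on UNIV"
    by (intro norm_summable_imp_summable_on) simp
  have "summable (\<lambda>n::nat. 1 / (2 + real n) ^ 2)"
    using summable_norm_inverse_sq[of 2] n1 by (simp add: norm_divide norm_power)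
  then have s2: "(\<lambda>n::nat. 1 / (2 + real n) ^ 2) summable_on UNIV"
    by (intro norm_summable_imp_summable_on) simp
  obtain A B where AB: "((\<lambda>n::nat. 1 / (1 + real n) ^ 2) has_sum A) UNIV" "((\<lambda>n::nat. 1 / (2 + real n) ^ 2) has_sum B) UNIV"
    using s s2 unfolding summable_on_def by blast
  have "((\<lambda>n::int. 1 / (1 + \<bar>real_of_int n\<bar>) ^ 2) has_sum (A + B)) UNIV"
    by (rule has_sum_int_split) (use AB in simp_all)
  then have si: "(\<lambda>n::int. 1 / (1 + \<bar>real_of_int n\<bar>) ^ 2) summable_on UNIV"
    unfolding summable_on_def by blast
  have "(\<lambda>(m::int, n::int). 1 / (1 + \<bar>real_of_int m\<bar>) ^ 2 * (1 / (1 + \<bar>real_of_int n\<bar>) ^ 2)) summable_on UNIV \<times> UNIV"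
  proof (rule summable_on_SigmaI)
    show "((\<lambda>y. case (x, y) of (m, n) \<Rightarrow> 1 / (1 + \<bar>real_of_int m\<bar>) ^ 2 * (1 / (1 + \<bar>real_of_int n\<bar>) ^ 2)) has_sum
       1 / (1 + \<bar>real_of_int x\<bar>) ^ 2 * infsum (\<lambda>n::int. 1 / (1 + \<bar>real_of_int n\<bar>) ^ 2) UNIV) UNIV" for x :: int
      unfolding prod.case by (intro has_sum_cmult_right has_sum_infsum si)
    show "(\<lambda>x::int. 1 / (1 + \<bar>real_of_int x\<bar>) ^ 2 * infsum (\<lambda>n::int. 1 / (1 + \<bar>real_of_int n\<bar>) ^ 2) UNIV) summable_on UNIV"
      by (intro summable_on_cmult_left si)
  qed auto
  then show ?thesis by (simp add: case_prod_unfold)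
qed

text \<open>Off the origin the term is -(1/4)/(w^2 (w^2 - 1/4)), of order |w|^(-4), and (1 + |m|)(1
  + |n|) \<le> 4 (m^2 + n^2), so it is dominated by a product of two convergent series.\<close>

lemma eis_term_bound:
  assumes t: "t \<noteq> 0"
  defines "c \<equiv> min 1 (t ^ 2)"
  shows "norm (eis_term t m n) \<le> 16 / c ^ 2 * (1 / ((1 + \<bar>real_of_int m\<bar>) ^ 2 * (1 + \<bar>real_of_int n\<bar>) ^ 2))"
proof (cases "m = 0 \<and> n = 0")
  case True then show ?thesis by (simp add: eis_term_def)
next
  case False
  have c: "0 < c" "c \<le> 1" "c \<le> t ^ 2" using t by (auto simp: c_def)
  define w where "w = of_int m + \<i> * complex_of_real t * of_int n"
  define M N where "M = \<bar>real_of_int m\<bar>" and "N = \<bar>real_of_int n\<bar>"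
  have lower: "c * (x ^ 2 + N ^ 2) \<le> norm (of_real x + \<i> * complex_of_real t * of_int n) ^ 2" for x
  proof -
    have "norm (of_real x + \<i> * complex_of_real t * of_int n) ^ 2 = x ^ 2 + t ^ 2 * N ^ 2"
      unfolding cmod_power2 N_def by (simp add: power_mult_distrib)
    moreover have "c * x ^ 2 \<le> 1 * x ^ 2" "c * N ^ 2 \<le> t ^ 2 * N ^ 2"
      using c by (intro mult_right_mono; simp)+
    ultimately show ?thesis by (simp add: algebra_simps)
  qed
  have MN: "M \<ge> 0" "N \<ge> 0" "M = 0 \<or> M \<ge> 1" "N = 0 \<or> N \<ge> 1" "M \<ge> 1 \<or> N \<ge> 1"
  proof -
    have "m = 0 \<or> \<bar>m\<bar> \<ge> 1" "n = 0 \<or> \<bar>n\<bar> \<ge> 1" by linarith+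
    then have "M = 0 \<or> M \<ge> 1" "N = 0 \<or> N \<ge> 1" "m = 0 \<or> M \<ge> 1" "n = 0 \<or> N \<ge> 1"
      unfolding M_def N_def by (auto simp only: of_int_abs[symmetric] of_int_1_le_iff of_int_0 abs_zero)
    then show "M \<ge> 0" "N \<ge> 0" "M = 0 \<or> M \<ge> 1" "N = 0 \<or> N \<ge> 1" "M \<ge> 1 \<or> N \<ge> 1"
      using False by (auto simp: M_def N_def)
  qed
  have Q: "(1 + M) * (1 + N) \<le> 4 * (M ^ 2 + N ^ 2)"
  proof -
    have "(1 + M) * (1 + N) \<le> ((1 + M) ^ 2 + (1 + N) ^ 2) / 2"
    proof -
      have "x * y \<le> (x ^ 2 + y ^ 2) / 2" for x y :: real
        using sum_squares_bound[of x y] by simp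
      then show ?thesis .
    qed
    moreover have "M \<le> M ^ 2" "N \<le> N ^ 2" using MN by (auto simp: power2_eq_square mult_le_cancel_left1)
    moreover have "1 \<le> M ^ 2 + N ^ 2" proof -
      have "M ^ 2 \<ge> 1 \<or> N ^ 2 \<ge> 1" using MN(5) by (auto intro: one_le_power)
      then show ?thesis using zero_le_power2[of M] zero_le_power2[of N] by linarith
    qed
    ultimately show ?thesis by (simp add: power2_eq_square algebra_simps)
  qed
  have P0: "M ^ 2 + N ^ 2 > 0" proof -
    have "M ^ 2 \<ge> 1 \<or> N ^ 2 \<ge> 1" using MN(5) by (auto intro: one_le_power)
    then show ?thesis using zero_le_power2[of M] zero_le_power2[of N] by linarith
  qed
  have w1: "c * (M ^ 2 + N ^ 2) \<le> norm w ^ 2"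
    using lower[of "of_int m"] by (simp add: w_def M_def)
  \<comment> \<open>For integers |m| is at most |2 m - 1| and |2 m + 1|, so a shift by 1/2 at most
    halves the coordinate.\<close>
  have half: "(real_of_int m - 1 / 2) ^ 2 \<ge> M ^ 2 / 4" "(real_of_int m + 1 / 2) ^ 2 \<ge> M ^ 2 / 4"
  proof -
    have "\<bar>m\<bar> \<le> \<bar>2 * m - 1\<bar>" "\<bar>m\<bar> \<le> \<bar>2 * m + 1\<bar>" by linarith+
    then have "real_of_int \<bar>m\<bar> \<le> real_of_int \<bar>2 * m - 1\<bar>" "real_of_int \<bar>m\<bar> \<le> real_of_int \<bar>2 * m + 1\<bar>"
      by (simp_all only: of_int_le_iff)
    then have "M / 2 \<le> \<bar>real_of_int m - 1 / 2\<bar>" "M / 2 \<le> \<bar>real_of_int m + 1 / 2\<bar>"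
      unfolding M_def of_int_abs by (simp_all add: abs_if split: if_splits)
    then have "(M / 2) ^ 2 \<le> \<bar>real_of_int m - 1 / 2\<bar> ^ 2" "(M / 2) ^ 2 \<le> \<bar>real_of_int m + 1 / 2\<bar> ^ 2"
      using MN by (intro power_mono; simp)+
    then show "(real_of_int m - 1 / 2) ^ 2 \<ge> M ^ 2 / 4" "(real_of_int m + 1 / 2) ^ 2 \<ge> M ^ 2 / 4"
      by (simp_all add: power_divide)
  qed
  have w2: "c * (M ^ 2 + N ^ 2) / 4 \<le> norm (w - 1 / 2) ^ 2" "c * (M ^ 2 + N ^ 2) / 4 \<le> norm (w + 1 / 2) ^ 2"
  proof -
    have "c * (M ^ 2 + N ^ 2) / 4 \<le> c * (x ^ 2 + N ^ 2)" if "x ^ 2 \<ge> M ^ 2 / 4" for x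
    proof -
      have "(M ^ 2 + N ^ 2) / 4 \<le> x ^ 2 + N ^ 2"
        using add_mono[OF that, of "N ^ 2 / 4" "N ^ 2"] by (simp add: add_divide_distrib)
      then have "c * ((M ^ 2 + N ^ 2) / 4) \<le> c * (x ^ 2 + N ^ 2)" using c by (intro mult_left_mono) auto
      then show ?thesis by simp
    qed
    from this[OF half(1)] this[OF half(2)]
    show "c * (M ^ 2 + N ^ 2) / 4 \<le> norm (w - 1 / 2) ^ 2" "c * (M ^ 2 + N ^ 2) / 4 \<le> norm (w + 1 / 2) ^ 2"
      using lower[of "of_int m - 1 / 2"] lower[of "of_int m + 1 / 2"]
      by (simp_all add: w_def algebra_simps)
  qed
  define K where "K = c * (M ^ 2 + N ^ 2)"
  have K: "K > 0" using c P0 by (simp add: K_def)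
  have q: "w ^ 2 - 1 / 4 = (w - 1 / 2) * (w + 1 / 2)" by (simp add: power2_eq_square algebra_simps)
  have "(K / 4) * (K / 4) \<le> norm (w - 1 / 2) ^ 2 * norm (w + 1 / 2) ^ 2"
    using w2 K unfolding K_def by (intro mult_mono) auto
  then have "(K / 4) ^ 2 \<le> norm (w ^ 2 - 1 / 4) ^ 2"
    unfolding q norm_mult power_mult_distrib by (simp only: power2_eq_square)
  then have w3: "K / 4 \<le> norm (w ^ 2 - 1 / 4)" using K by (simp add: power2_le_iff_abs_le)
  have w4: "K \<le> norm (w ^ 2)" using w1 by (simp add: K_def norm_power)
  have np: "norm (w ^ 2) > 0" "norm (w ^ 2 - 1 / 4) > 0" using w3 w4 K by linarith+
  then have nz: "w ^ 2 \<noteq> 0" "w ^ 2 - 1 / 4 \<noteq> 0" by (auto simp only: zero_less_norm_iff)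
  have "eis_term t m n = 1 / w ^ 2 - 1 / (w ^ 2 - 1 / 4)"
    using False by (simp add: eis_term_def w_def)
  also have "\<dots> = - (1 / 4) / (w ^ 2 * (w ^ 2 - 1 / 4))"
    using nz by (simp add: field_simps)
  finally have "norm (eis_term t m n) = (1 / 4) / (norm (w ^ 2) * norm (w ^ 2 - 1 / 4))"
    by (simp add: norm_divide norm_mult)
  also have "\<dots> \<le> (1 / 4) / (K * (K / 4))"
    by (intro divide_left_mono mult_mono mult_pos_pos np) (use w3 w4 K np in linarith)+
  also have "\<dots> = 1 / K ^ 2" using K by (simp add: field_simps power2_eq_square)
  also have "\<dots> \<le> 1 / (c * ((1 + M) * (1 + N) / 4)) ^ 2"
  proof -
    have "c * ((1 + M) * (1 + N) / 4) \<le> K" unfolding K_def using Q c by (intro mult_left_mono) auto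
    moreover have "0 < c * ((1 + M) * (1 + N) / 4)" using c MN by (intro mult_pos_pos divide_pos_pos) auto
    moreover have "1 / b ^ 2 \<le> 1 / a ^ 2" if "0 < a" "a \<le> b" for a b :: real
      using that by (intro divide_left_mono power_mono) auto
    ultimately show ?thesis by blast
  qed
  also have "\<dots> = 16 / c ^ 2 * (1 / ((1 + M) ^ 2 * (1 + N) ^ 2))"
    by (simp add: power_mult_distrib power_divide)
  finally show ?thesis by (simp add: M_def N_def)
qed

lemma eis_term_summable:
  assumes "t \<noteq> 0"
  shows "(\<lambda>(m, n). eis_term t m n) summable_on UNIV \<times> UNIV"
proof (rule abs_summable_summable, rule summable_on_comparison_test)
  show "(\<lambda>(m::int, n::int). 16 / (min 1 (t ^ 2)) ^ 2 * (1 / ((1 + \<bar>real_of_int m\<bar>) ^ 2 * (1 + \<bar>real_of_int n\<bar>) ^ 2))) summable_on UNIV \<times> UNIV"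
    using summable_on_cmult_right[OF abs_summable_int_product, of "16 / (min 1 (t ^ 2)) ^ 2"] by (simp add: case_prod_unfold)
qed (use eis_term_bound[OF assms] in auto)

lemma cot_i_tendsto: "((\<lambda>x. cot (\<i> * complex_of_real x)) \<longlongrightarrow> - \<i>) at_top"
proof -
  have eq: "cot (\<i> * complex_of_real x) = - \<i> * of_real ((1 + exp (- 2 * x)) / (1 - exp (- 2 * x)))" for x
  proof -
    have "cot (\<i> * complex_of_real x) = of_real (cosh x) / (\<i> * of_real (sinh x))"
    proof -
      have "cos (\<i> * complex_of_real x) = of_real (cosh x)"
        unfolding cosh_conv_cos [symmetric] by (simp add: cosh_field_def flip: exp_of_real)
      moreover have "sinh (complex_of_real x) = of_real (sinh x)"
        by (simp add: sinh_field_def flip: exp_of_real)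
      then have "sin (\<i> * complex_of_real x) = \<i> * of_real (sinh x)"
        by (simp add: sinh_conv_sin complex_eq_iff)
      ultimately show ?thesis by (simp only: cot_def)
    qed
    also have "\<dots> = - \<i> * of_real (cosh x / sinh x)"
      by (simp add: complex_eq_iff Re_divide Im_divide power2_eq_square)
    also have "cosh x / sinh x = (1 + exp (- 2 * x)) / (1 - exp (- 2 * x))"
    proof -
      have "exp x * exp (- 2 * x) = exp (- x)" by (simp flip: exp_add)
      then have "2 * cosh x = exp x * (1 + exp (- 2 * x))" "2 * sinh x = exp x * (1 - exp (- 2 * x))"
        by (simp_all add: cosh_def sinh_def algebra_simps)
      then have "(2 * cosh x) / (2 * sinh x) = (exp x * (1 + exp (- 2 * x))) / (exp x * (1 - exp (- 2 * x)))"
        by simp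
      then show ?thesis by simp
    qed
    finally show ?thesis .
  qed
  have "((\<lambda>x::real. (1 + exp (- 2 * x)) / (1 - exp (- 2 * x))) \<longlongrightarrow> 1) at_top" by real_asymp
  then have "((\<lambda>x. - \<i> * complex_of_real ((1 + exp (- 2 * x)) / (1 - exp (- 2 * x)))) \<longlongrightarrow> - \<i> * of_real 1) at_top"
    by (intro tendsto_intros)
  then show ?thesis by (simp add: eq)
qed

lemma sum_int_telescope:
  fixes h :: "int \<Rightarrow> 'a :: ab_group_add"
  shows "(\<Sum>m\<in>{- int M..int M}. h m - h (m + 1)) = h (- int M) - h (int M + 1)"
proof (induction M)
  case (Suc M)
  have "{- int (Suc M)..int (Suc M)} = insert (- int (Suc M)) (insert (int (Suc M)) {- int M..int M})"
    by auto
  then show ?case using Suc by (simp add: algebra_simps)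
qed simp

text \<open>The potentials at the two ends are opposite, and cot(i x) tends to -i, so the telescoped
  sum has a nonzero limit. This is the failure of modularity in weight 2.\<close>

lemma eis_h_tendsto:
  assumes t: "t > 0"
  shows "(\<lambda>M. \<Sum>m\<in>{- int M..int M}. eis_h t m - eis_h t (m + 1)) \<longlonglongrightarrow> - (2 * pi / t)"
proof -
  have h1: "eis_h t (int M + 1) = - (1 / (\<i> * t) * (pi * cot (\<i> * complex_of_real (pi * (real M + 1 / 2) / t))))" for M
  proof -
    have "pi * ((of_int (int M + 1) - 1 / 2) / (\<i> * complex_of_real t)) = - (\<i> * complex_of_real (pi * (real M + 1 / 2) / t))"
      using t by (simp add: field_simps)
    then show ?thesis unfolding eis_h_def by (simp only: cot_def sin_minus cos_minus) simp
  qed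
  have h2: "eis_h t (- int M) = 1 / (\<i> * t) * (pi * cot (\<i> * complex_of_real (pi * (real M + 1 / 2) / t)))" for M
  proof -
    have "pi * ((of_int (- int M) - 1 / 2) / (\<i> * complex_of_real t)) = \<i> * complex_of_real (pi * (real M + 1 / 2) / t)"
      using t by (simp add: field_simps)
    then show ?thesis unfolding eis_h_def by simp
  qed
  have "filterlim (\<lambda>M. pi * (real M + 1 / 2) / t) at_top sequentially" using t by real_asymp
  then have "(\<lambda>M. cot (\<i> * complex_of_real (pi * (real M + 1 / 2) / t))) \<longlonglongrightarrow> - \<i>"
    by (rule filterlim_compose[OF cot_i_tendsto])
  then have "(\<lambda>M. 2 * (1 / (\<i> * t) * (pi * cot (\<i> * complex_of_real (pi * (real M + 1 / 2) / t))))) \<longlonglongrightarrow>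
      2 * (1 / (\<i> * t) * (pi * (- \<i>)))"
    by (intro tendsto_intros)
  moreover have "2 * (1 / (\<i> * t) * (pi * (- \<i>))) = - (2 * complex_of_real pi / t)"
    using t by (simp add: field_simps)
  ultimately show ?thesis unfolding sum_int_telescope h1 h2 by simp
qed

text \<open>Summed by rows, the absolutely convergent double series is \<open>eis_G2 t\<close> - 4;
  summed by columns, it is -t^(-2) \<open>eis_G2 (1 / t)\<close> - 4 + 2 pi/t.\<close>

theorem eis_G2_invert:
  assumes t: "t > 0"
  shows "eis_row t summable_on UNIV" "eis_G2 (1 / t) = - of_real (t ^ 2) * eis_G2 t + of_real (2 * pi * t)"
proof -
  obtain S where S: "\<And>t. t > 0 \<Longrightarrow> ((\<lambda>(m, n). eis_term t m n) has_sum S t) (UNIV \<times> UNIV)"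
    using eis_term_summable unfolding summable_on_def by (metis less_irrefl)
  have row: "(eis_row t has_sum (S t + 4)) UNIV" if "t > 0" for t
  proof -
    have "((\<lambda>(n, m). eis_term t m n) has_sum S t) (UNIV \<times> UNIV)"
      using S[OF that] by (subst has_sum_swap) (simp add: case_prod_unfold)
    from has_sum_SigmaD[OF this] have "((\<lambda>n. eis_row t n - (if n = 0 then 4 else 0)) has_sum S t) UNIV"
      using eis_row_sum[of t] that by auto
    from has_sum_add[OF this has_sum_if_0[of 4]] show ?thesis
      by (rule has_sum_cong[THEN iffD1, rotated]) auto
  qed
  then show "eis_row t summable_on UNIV" using t unfolding summable_on_def by blast
  have G2: "eis_G2 t = S t + 4" "eis_G2 (1 / t) = S (1 / t) + 4"
    using row t unfolding eis_G2_def by (auto intro!: infsumI)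
  have "((\<lambda>m. - (1 / t ^ 2) * eis_row (1 / t) m - (eis_h t m - eis_h t (m + 1)) - (if m = 0 then 4 else 0)) has_sum S t) UNIV"
    by (rule has_sum_SigmaD[OF S[OF t]]) (use eis_col_sum[of t] t in auto)
  from has_sum_add[OF this has_sum_if_0[of 4]]
  have "((\<lambda>m. - (1 / t ^ 2) * eis_row (1 / t) m - (eis_h t m - eis_h t (m + 1))) has_sum (S t + 4)) UNIV"
    by (rule has_sum_cong[THEN iffD1, rotated]) auto
  moreover have "((\<lambda>m. - (1 / t ^ 2) * eis_row (1 / t) m) has_sum (- (1 / t ^ 2) * (S (1 / t) + 4))) UNIV"
    using t by (intro has_sum_cmult_right row) auto
  ultimately have "((\<lambda>m. eis_h t m - eis_h t (m + 1)) has_sum (- (1 / t ^ 2) * (S (1 / t) + 4) - (S t + 4))) UNIV"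
    using has_sum_minus by fastforce
  from LIMSEQ_unique[OF has_sum_int_symmetric[OF this] eis_h_tendsto[OF t]]
  have "- (1 / t ^ 2) * (S (1 / t) + 4) - (S t + 4) = - (2 * complex_of_real pi / t)" by simp
  then have "- (1 / t ^ 2) * eis_G2 (1 / t) - eis_G2 t = - (2 * complex_of_real pi / t)"
    by (simp add: G2)
  then have "of_real (t ^ 2) * (- (1 / t ^ 2) * eis_G2 (1 / t) - eis_G2 t) = of_real (t ^ 2) * - (2 * complex_of_real pi / t)"
    by simp
  then show "eis_G2 (1 / t) = - of_real (t ^ 2) * eis_G2 t + of_real (2 * pi * t)"
    using t by (simp add: algebra_simps power2_eq_square)
qed

section \<open>The modular form\<close>

definition euler_prod :: "complex \<Rightarrow> complex" where
  "euler_prod q = (\<Prod>m. 1 - q ^ Suc m)"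

lemma convergent_euler_prod:
  assumes "norm q < 1"
  shows "convergent_prod (\<lambda>m. 1 - q ^ Suc m :: complex)"
proof (rule abs_convergent_prod_imp_convergent_prod)
  have "summable (\<lambda>m. norm q ^ Suc m)"
    using assms by (subst summable_Suc_iff) (simp add: summable_geometric)
  then show "abs_convergent_prod (\<lambda>m. 1 - q ^ Suc m)"
    by (simp add: abs_convergent_prod_conv_summable norm_power norm_mult)
qed

lemma one_minus_power_nonzero: "norm q < 1 \<Longrightarrow> 1 - q ^ Suc m \<noteq> (0 :: complex)"
proof
  assume q: "norm q < 1" and "1 - q ^ Suc m = 0"
  then have "q ^ Suc m = 1" by simp
  then have "norm q ^ Suc m = 1" by (metis norm_one norm_power)
  moreover have "norm q ^ Suc m < 1 ^ Suc m" using q by (intro power_strict_mono) auto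
  ultimately show False by simp
qed

lemma euler_prod_nonzero: "norm q < 1 \<Longrightarrow> euler_prod q \<noteq> 0"
  unfolding euler_prod_def using convergent_euler_prod one_minus_power_nonzero prodinf_nonzero by blast

lemma euler_prod_uniform_limit:
  assumes R: "0 \<le> R" "R < 1"
  shows "uniform_limit (cball 0 R) (\<lambda>N q. \<Prod>m<N. 1 - q ^ Suc m) euler_prod sequentially"
proof -
  have "uniformly_convergent_on (cball 0 R) (\<lambda>N q :: complex. \<Prod>m<N. 1 - q ^ Suc m)"
  proof (rule uniformly_convergent_on_prod')
    show "uniformly_convergent_on (cball 0 R) (\<lambda>N x :: complex. \<Sum>n<N. norm (1 - x ^ Suc n - 1))"
    proof (rule Weierstrass_m_test')
      show "summable (\<lambda>n. R ^ Suc n)"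
        using R by (subst summable_Suc_iff) (simp add: summable_geometric)
      show "norm (norm (1 - x ^ Suc n - 1)) \<le> R ^ Suc n" if "x \<in> cball 0 R" for n and x :: complex
        using that power_mono[of "norm x" R "Suc n"] by (simp add: norm_mult norm_power)
    qed
  qed (auto intro!: continuous_intros)
  then obtain g where g: "uniform_limit (cball 0 R) (\<lambda>N q :: complex. \<Prod>m<N. 1 - q ^ Suc m) g sequentially"
    by (auto simp: uniformly_convergent_on_def)
  also have "?this \<longleftrightarrow> ?thesis"
  proof (intro uniform_limit_cong)
    fix z :: complex assume z: "z \<in> cball 0 R"
    then have "norm z < 1" using R by simp
    from convergent_prod_LIMSEQ[OF convergent_euler_prod[OF this]]
    have "(\<lambda>n. \<Prod>m<Suc n. 1 - z ^ Suc m) \<longlonglongrightarrow> euler_prod z"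
      unfolding euler_prod_def lessThan_Suc_atMost .
    moreover have "(\<lambda>n. \<Prod>m<Suc n. 1 - z ^ Suc m) \<longlonglongrightarrow> g z"
      using tendsto_uniform_limitI[OF g z] by (subst filterlim_sequentially_Suc)
    ultimately show "g z = euler_prod z" using LIMSEQ_unique by blast
  qed auto
  finally show ?thesis .
qed

lemma holomorphic_euler_prod: "euler_prod holomorphic_on ball 0 1"
proof (rule holomorphic_uniform_sequence)
  fix x :: complex assume x: "x \<in> ball 0 1"
  define d where "d = (1 - norm x) / 2"
  have d: "d > 0" "norm x + d < 1" using x by (auto simp: d_def field_simps)
  have sub: "cball x d \<subseteq> cball 0 (norm x + d)" by (simp add: cball_subset_cball_iff)
  have "uniform_limit (cball 0 (norm x + d)) (\<lambda>N q. \<Prod>m<N. 1 - q ^ Suc m) euler_prod sequentially"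
    using d by (intro euler_prod_uniform_limit) (auto intro: add_nonneg_nonneg)
  then have "uniform_limit (cball x d) (\<lambda>N q. \<Prod>m<N. 1 - q ^ Suc m) euler_prod sequentially"
    using sub by (rule uniform_limit_on_subset)
  moreover have "cball x d \<subseteq> ball 0 1" using sub d by (auto simp: subset_iff)
  ultimately show "\<exists>d>0. cball x d \<subseteq> ball 0 1 \<and>
     uniform_limit (cball x d) (\<lambda>N q. \<Prod>m<N. 1 - q ^ Suc m) euler_prod sequentially"
    using d by blast
qed (auto intro!: holomorphic_intros)

lemma euler_prod_logderiv:
  assumes q: "norm q < 1"
  shows "(\<lambda>k. - (of_nat (Suc k) * q ^ k / (1 - q ^ Suc k))) sums (deriv euler_prod q / euler_prod q)"
proof -
  obtain R where R: "norm q < R" "R < 1" using q dense by blast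
  then have R0: "0 \<le> R" by (meson norm_ge_zero order.strict_trans1 less_imp_le)
  have lim: "uniform_limit (ball 0 R) (\<lambda>N q. \<Prod>m<N. 1 - q ^ Suc m) euler_prod sequentially"
    using euler_prod_uniform_limit[OF R0 R(2)] by (rule uniform_limit_on_subset) auto
  have "(\<lambda>k. deriv (\<lambda>q. 1 - q ^ Suc k) q / (1 - q ^ Suc k)) sums (deriv euler_prod q / euler_prod q)"
    by (rule logderiv_prodinf_complex_uniform_limit[OF lim])
       (use R q euler_prod_nonzero in \<open>auto intro!: holomorphic_intros\<close>)
  moreover have "deriv (\<lambda>q. 1 - q ^ Suc k) q = - (of_nat (Suc k) * q ^ k)" for k
    by (rule DERIV_imp_deriv) (rule derivative_eq_intros refl | simp)+
  ultimately show ?thesis by simp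
qed

text \<open>Both sides are the sum of m q^(m k) over m, k \<ge> 1, in the two orders of
  summation.\<close>

lemma lambert_swap:
  fixes q :: complex
  assumes q: "norm q < 1"
  assumes "(\<lambda>k. of_nat (Suc k) * q ^ Suc k / (1 - q ^ Suc k)) sums S"
  shows "((\<lambda>k. q ^ Suc k / (1 - q ^ Suc k) ^ 2) has_sum S) UNIV"
proof -
  define g where "g = (\<lambda>(m::nat, k::nat). of_nat (Suc m) * q ^ (Suc m * Suc k))"
  have "summable (\<lambda>n. norm (of_nat (Suc n) * q ^ n))"
  proof -
    have "(\<lambda>n. of_nat (Suc n) * norm q ^ n) sums (1 / (1 - norm q) ^ 2)"
      using q by (intro geometric_deriv_sums) auto
    then show ?thesis by (simp add: norm_mult norm_power sums_iff del: of_nat_Suc)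
  qed
  then have s1: "(\<lambda>n. norm (of_nat (Suc n) * q ^ n)) summable_on UNIV"
    by (intro norm_summable_imp_summable_on) simp
  have s2: "(\<lambda>n. norm q ^ n) summable_on UNIV"
    using q by (intro norm_summable_imp_summable_on) (simp add: summable_geometric)
  have "(\<lambda>(m, k). norm (of_nat (Suc m) * q ^ m) * norm q ^ k) summable_on UNIV \<times> UNIV"
  proof (rule summable_on_SigmaI)
    show "((\<lambda>y. case (x, y) of (m, k) \<Rightarrow> norm (of_nat (Suc m) * q ^ m) * norm q ^ k) has_sum
       norm (of_nat (Suc x) * q ^ x) * (\<Sum>\<^sub>\<infinity>n. norm q ^ n)) UNIV" for x
      unfolding prod.case by (intro has_sum_cmult_right has_sum_infsum s2)
    show "(\<lambda>x. norm (of_nat (Suc x) * q ^ x) * (\<Sum>\<^sub>\<infinity>n. norm q ^ n)) summable_on UNIV"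
      by (intro summable_on_cmult_left s1)
  qed auto
  then have "g summable_on UNIV \<times> UNIV"
  proof (rule abs_summable_summable[OF summable_on_comparison_test])
    fix x assume "x \<in> (UNIV :: nat set) \<times> (UNIV :: nat set)"
    obtain m k where x: "x = (m, k)" by (cases x)
    have "norm q ^ (Suc m * Suc k) \<le> norm q ^ (m + k)"
      using q by (intro power_decreasing) auto
    then have "of_nat (Suc m) * norm q ^ (Suc m * Suc k) \<le> of_nat (Suc m) * norm q ^ (m + k)"
      by (intro mult_left_mono) auto
    then show "norm (g x) \<le> (case x of (m, k) \<Rightarrow> norm (of_nat (Suc m) * q ^ m) * norm q ^ k)"
      unfolding x g_def prod.case norm_mult norm_power norm_of_nat power_add by (simp only: mult.assoc)
  qed auto
  then obtain T where T: "(g has_sum T) (UNIV \<times> UNIV)" unfolding summable_on_def by blast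
  have x1: "norm (q ^ Suc m) < 1" for m
    using q power_strict_mono[of "norm q" 1 "Suc m"] by (simp add: norm_mult norm_power)
  have row: "((\<lambda>k. g (m, k)) has_sum (of_nat (Suc m) * q ^ Suc m / (1 - q ^ Suc m))) UNIV" for m
  proof -
    have "(\<lambda>k. (q ^ Suc m) ^ k) sums (1 / (1 - q ^ Suc m))"
      using x1 by (rule geometric_sums)
    moreover have "summable (\<lambda>k. norm ((q ^ Suc m) ^ k))"
      using x1[of m] unfolding norm_power[of "q ^ Suc m"] by (intro summable_geometric) simp
    ultimately have "((\<lambda>k. (q ^ Suc m) ^ k) has_sum (1 / (1 - q ^ Suc m))) UNIV"
      by (intro norm_summable_imp_has_sum)
    then have "((\<lambda>k. of_nat (Suc m) * q ^ Suc m * (q ^ Suc m) ^ k) has_sum (of_nat (Suc m) * q ^ Suc m * (1 / (1 - q ^ Suc m)))) UNIV"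
      by (rule has_sum_cmult_right)
    moreover have "g (m, k) = of_nat (Suc m) * q ^ Suc m * (q ^ Suc m) ^ k" for k
      unfolding g_def prod.case by (simp only: power_mult power_Suc[of "q ^ Suc m"] mult.assoc)
    ultimately show ?thesis by simp
  qed
  have col: "((\<lambda>m. g (m, k)) has_sum (q ^ Suc k / (1 - q ^ Suc k) ^ 2)) UNIV" for k
  proof -
    have "(\<lambda>m. of_nat (Suc m) * (q ^ Suc k) ^ m) sums (1 / (1 - q ^ Suc k) ^ 2)"
      using x1 by (rule geometric_deriv_sums)
    moreover have "summable (\<lambda>m. norm (of_nat (Suc m) * (q ^ Suc k) ^ m))"
    proof -
      have "(\<lambda>n. of_nat (Suc n) * norm (q ^ Suc k) ^ n) sums (1 / (1 - norm (q ^ Suc k)) ^ 2)"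
        using x1[of k] by (intro geometric_deriv_sums) simp
      then show ?thesis
        unfolding norm_mult norm_power[of "q ^ Suc k"] norm_of_nat by (rule sums_summable)
    qed
    ultimately have "((\<lambda>m. of_nat (Suc m) * (q ^ Suc k) ^ m) has_sum (1 / (1 - q ^ Suc k) ^ 2)) UNIV"
      by (intro norm_summable_imp_has_sum)
    then have "((\<lambda>m. q ^ Suc k * (of_nat (Suc m) * (q ^ Suc k) ^ m)) has_sum (q ^ Suc k * (1 / (1 - q ^ Suc k) ^ 2))) UNIV"
      by (rule has_sum_cmult_right)
    moreover have "g (m, k) = q ^ Suc k * (of_nat (Suc m) * (q ^ Suc k) ^ m)" for m
      unfolding g_def prod.case
      by (subst mult.commute[of "Suc m"]) (simp only: power_mult power_Suc[of "q ^ Suc k"] mult_ac)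
    ultimately show ?thesis by simp
  qed
  have "((\<lambda>m. of_nat (Suc m) * q ^ Suc m / (1 - q ^ Suc m)) has_sum T) UNIV"
    by (rule has_sum_SigmaD[OF T]) (use row in auto)
  then have "T = S" using assms(2) has_sum_imp_sums sums_unique2 by blast
  have "((\<lambda>(k, m). g (m, k)) has_sum T) (UNIV \<times> UNIV)"
    using T by (subst has_sum_swap) (simp add: case_prod_unfold)
  from has_sum_SigmaD[OF this] show ?thesis using col \<open>T = S\<close> by auto
qed

text \<open>Rows n and -n agree, and with w = exp(-pi t n) each is -4 pi^2 w^2/(1 - w^2)^2. By
  \<open>lambert_swap\<close> their sum over n becomes the logarithmic derivative.\<close>

lemma eis_G2_logderiv:
  assumes t: "t > 0"
  defines "q \<equiv> complex_of_real (exp (- (2 * pi * t)))"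
  shows "eis_G2 t = pi ^ 2 / 3 + 8 * pi ^ 2 * (q * deriv euler_prod q / euler_prod q)"
proof -
  have q: "norm q < 1" "q \<noteq> 0" using t by (auto simp: q_def)
  define D where "D = q * deriv euler_prod q / euler_prod q"
  have "(\<lambda>k. - q * - (of_nat (Suc k) * q ^ k / (1 - q ^ Suc k))) sums (- q * (deriv euler_prod q / euler_prod q))"
    by (rule sums_mult[OF euler_prod_logderiv[OF q(1)]])
  then have "(\<lambda>k. of_nat (Suc k) * q ^ Suc k / (1 - q ^ Suc k)) sums (- D)"
    by (simp add: D_def mult_ac)
  from lambert_swap[OF q(1) this]
  have L: "((\<lambda>k. q ^ Suc k / (1 - q ^ Suc k) ^ 2) has_sum (- D)) UNIV" .
  have sin: "(pi / sin (pi * (\<i> * t * of_nat (Suc k)))) ^ 2 = - 4 * pi ^ 2 * (q ^ Suc k / (1 - q ^ Suc k) ^ 2)" for k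
  proof -
    define w where "w = complex_of_real (exp (- (pi * t * real (Suc k))))"
    have w0: "w \<noteq> 0" by (simp add: w_def)
    have ww: "w ^ 2 = q ^ Suc k"
      unfolding w_def q_def by (simp only: of_real_power[symmetric] exp_of_nat_mult[symmetric]) (simp add: algebra_simps)
    have "exp (\<i> * (pi * (\<i> * t * of_nat (Suc k)))) = w"
      unfolding w_def exp_of_real [symmetric] by (rule arg_cong[of _ _ exp]) (simp add: algebra_simps)
    moreover have "exp (- (\<i> * (pi * (\<i> * t * of_nat (Suc k))))) = 1 / w"
      unfolding exp_minus calculation by (simp add: inverse_eq_divide)
    ultimately have "sin (pi * (\<i> * t * of_nat (Suc k))) = (w - 1 / w) / (2 * \<i>)"
      unfolding sin_exp_eq by simp
    also have "\<dots> = (w ^ 2 - 1) / (2 * \<i> * w)"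
      using w0 by (simp add: field_simps power2_eq_square)
    finally have "(pi / sin (pi * (\<i> * t * of_nat (Suc k)))) ^ 2 = - 4 * pi ^ 2 * (w ^ 2 / (1 - w ^ 2) ^ 2)"
      using one_minus_power_nonzero[OF q(1), of k, folded ww] w0
      by (simp add: power_divide power_mult_distrib power2_commute[of "w ^ 2" 1])
    then show ?thesis unfolding ww .
  qed
  have half: "((\<lambda>k. eis_row t (1 + int k)) has_sum (4 * pi ^ 2 * D)) UNIV"
  proof -
    have "((\<lambda>k. - 4 * pi ^ 2 * (q ^ Suc k / (1 - q ^ Suc k) ^ 2)) has_sum (- 4 * pi ^ 2 * (- D))) UNIV"
      by (rule has_sum_cmult_right[OF L])
    moreover have "eis_row t (1 + int k) = - 4 * pi ^ 2 * (q ^ Suc k / (1 - q ^ Suc k) ^ 2)" for k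
      unfolding eis_row_def sin[symmetric] by (simp add: add.commute)
    ultimately show ?thesis by simp
  qed
  have sym: "eis_row t (- n) = eis_row t n" for n
    by (simp add: eis_row_def power_divide)
  have "(eis_row t has_sum (pi ^ 2 / 3 + 4 * pi ^ 2 * D + 4 * pi ^ 2 * D)) UNIV"
  proof (rule has_sum_int_split)
    show "((\<lambda>n. eis_row t (- 1 - int n)) has_sum (4 * pi ^ 2 * D)) UNIV"
      using half sym[of "1 + int k" for k] by simp
    have "((\<lambda>n. eis_row t (int n)) has_sum (4 * pi ^ 2 * D)) (range Suc)"
      using half by (subst has_sum_reindex) (auto simp: o_def add.commute)
    then have "((\<lambda>n. eis_row t (int n)) has_sum (eis_row t (int 0) + 4 * pi ^ 2 * D)) (insert 0 (range Suc))"
      by (intro has_sum_insert) auto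
    moreover have "insert 0 (range Suc) = UNIV" by (auto simp: range_Suc_eq)
    ultimately show "((\<lambda>n. eis_row t (int n)) has_sum (pi ^ 2 / 3 + 4 * pi ^ 2 * D)) UNIV"
      by (simp add: eis_row_def)
  qed
  then have "eis_G2 t = pi ^ 2 / 3 + 4 * pi ^ 2 * D + 4 * pi ^ 2 * D"
    unfolding eis_G2_def by (rule infsumI)
  then show ?thesis unfolding D_def by simp
qed

section \<open>The functional equation on the imaginary axis\<close>

definition eta_axis :: "real \<Rightarrow> complex" where
  "eta_axis t = exp (- (2 * pi * t)) * euler_prod (exp (- (2 * pi * t))) ^ 8 * euler_prod (exp (- (2 * pi * (2 * t)))) ^ 8"

text \<open>The constants pi^2/3 contribute 2 pi/3 + 4 pi/3, which cancels the -2 pi from the factor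
  q; this is the condition 8 + 2 * 8 = 24 on the exponents of eta.\<close>

lemma eta_axis_deriv:
  assumes t: "t > 0"
  shows "(eta_axis has_vector_derivative (- (2 / pi) * (eis_G2 t + 2 * eis_G2 (2 * t)) * eta_axis t)) (at t)"
proof -
  have P: "((\<lambda>t. euler_prod (exp (- (2 * pi * (c * t))))) has_vector_derivative
     (c * ((pi ^ 2 / 3 - eis_G2 (c * t)) / (4 * pi)) * euler_prod (exp (- (2 * pi * (c * t)))))) (at t)"
    if c: "c > 0" for c
  proof -
    define q where "q = complex_of_real (exp (- (2 * pi * (c * t))))"
    have ct: "c * t > 0" using c t by simp
    have q: "norm q < 1" using ct by (simp add: q_def)
    have "(euler_prod has_field_derivative deriv euler_prod q) (at q)"
      using holomorphic_derivI[OF holomorphic_euler_prod] q by simp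
    moreover have "((\<lambda>t. complex_of_real (exp (- (2 * pi * (c * t))))) has_vector_derivative (- (2 * pi * c) * q)) (at t)"
      unfolding q_def by (rule derivative_eq_intros refl has_vector_derivative_of_real | simp)+
    ultimately have "(euler_prod \<circ> (\<lambda>t. complex_of_real (exp (- (2 * pi * (c * t))))) has_vector_derivative
       (- (2 * pi * c) * q) * deriv euler_prod q) (at t)"
      unfolding q_def by (rule field_vector_diff_chain_at[rotated])
    moreover have "(- (2 * pi * c) * q) * deriv euler_prod q = c * ((pi ^ 2 / 3 - eis_G2 (c * t)) / (4 * pi)) * euler_prod q"
      unfolding eis_G2_logderiv[OF ct, folded q_def]
      using euler_prod_nonzero[OF q] by (simp add: field_simps power2_eq_square)
    ultimately show ?thesis by (simp add: o_def q_def)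
  qed
  have pow: "((\<lambda>t. f t ^ n) has_vector_derivative (of_nat n * b * f t ^ n)) (at t)"
    if "(f has_vector_derivative (b * f t)) (at t)" for f :: "real \<Rightarrow> complex" and b n
  proof (induction n)
    case (Suc n)
    have "((\<lambda>t. f t * f t ^ n) has_vector_derivative (f t * (of_nat n * b * f t ^ n) + b * f t * f t ^ n)) (at t)"
      by (rule has_vector_derivative_mult[OF that Suc])
    then show ?case by (simp add: algebra_simps)
  qed (simp add: has_vector_derivative_const)
  define A B C where "A = (\<lambda>t. complex_of_real (exp (- (2 * pi * t))))"
    and "B = (\<lambda>t. euler_prod (exp (- (2 * pi * t))))"
    and "C = (\<lambda>t. euler_prod (exp (- (2 * pi * (2 * t)))))"
  define b c where "b = (pi ^ 2 / 3 - eis_G2 t) / (4 * pi)" and "c = 2 * ((pi ^ 2 / 3 - eis_G2 (2 * t)) / (4 * pi))"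
  have A: "(A has_vector_derivative (- (2 * pi) * A t)) (at t)"
    unfolding A_def by (rule derivative_eq_intros refl has_vector_derivative_of_real | simp)+
  have B: "((\<lambda>t. B t ^ 8) has_vector_derivative (of_nat 8 * b * B t ^ 8)) (at t)"
    by (rule pow) (use P[of 1] in \<open>simp add: B_def b_def\<close>)
  have C: "((\<lambda>t. C t ^ 8) has_vector_derivative (of_nat 8 * c * C t ^ 8)) (at t)"
    by (rule pow) (use P[of 2] in \<open>simp add: C_def c_def\<close>)
  have eq: "eta_axis = (\<lambda>t. A t * B t ^ 8 * C t ^ 8)"
    by (rule ext) (simp only: eta_axis_def A_def B_def C_def)
  have "(eta_axis has_vector_derivative
     (A t * B t ^ 8 * (of_nat 8 * c * C t ^ 8) + (A t * (of_nat 8 * b * B t ^ 8) + - (2 * pi) * A t * B t ^ 8) * C t ^ 8)) (at t)"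
    unfolding eq by (intro has_vector_derivative_mult A B C)
  also have "A t * B t ^ 8 * (of_nat 8 * c * C t ^ 8) + (A t * (of_nat 8 * b * B t ^ 8) + - (2 * pi) * A t * B t ^ 8) * C t ^ 8
      = (8 * b + 8 * c - 2 * pi) * eta_axis t"
    unfolding eq by (simp add: algebra_simps)
  also have "8 * b + 8 * c - 2 * pi = - (2 / pi) * (eis_G2 t + 2 * eis_G2 (2 * t))"
    unfolding b_def c_def by (simp add: field_simps power2_eq_square)
  finally show ?thesis .
qed

lemma eta_axis_nonzero: "t > 0 \<Longrightarrow> eta_axis t \<noteq> 0"
  by (simp add: eta_axis_def euler_prod_nonzero)

text \<open>The quotient of f(i/(2 t)) by t^8 f(i t) is constant: the two anomalies of
  \<open>eis_G2_invert\<close> combine to 8/t, the logarithmic derivative of t^8. At the fixed point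
  t = 1/sqrt 2 the quotient is 1/t^8 = 16.\<close>

lemma eta_axis_invert:
  assumes t: "t > 0"
  shows "eta_axis (1 / (2 * t)) = 16 * of_real (t ^ 8) * eta_axis t"
proof -
  define l where "l = (\<lambda>t. - (2 / complex_of_real pi) * (eis_G2 t + 2 * eis_G2 (2 * t)))"
  define R where "R = (\<lambda>t. eta_axis (1 / (2 * t)) * inverse (of_real (t ^ 8) * eta_axis t))"
  have l: "of_real (- 1 / (2 * t ^ 2)) * l (1 / (2 * t)) = of_real (8 / t) + l t" if "t > 0" for t
  proof -
    have 1: "eis_G2 (1 / t) = - of_real (t ^ 2) * eis_G2 t + of_real (2 * pi * t)"
      "eis_G2 (1 / (2 * t)) = - of_real ((2 * t) ^ 2) * eis_G2 (2 * t) + of_real (2 * pi * (2 * t))"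
      using eis_G2_invert(2)[of t] eis_G2_invert(2)[of "2 * t"] that by auto
    have "2 * (1 / (2 * t)) = 1 / t" using that by simp
    then show ?thesis unfolding l_def using that
      by (simp only: 1) (simp add: field_simps power2_eq_square)
  qed
  have D: "(R has_vector_derivative 0) (at t)" if "t > 0" for t
  proof -
    have "1 / (2 * t) > 0" using that by simp
    from eta_axis_deriv[OF this]
    have e: "(eta_axis has_vector_derivative (l (1 / (2 * t)) * eta_axis (1 / (2 * t)))) (at (1 / (2 * t)))"
      by (simp add: l_def)
    have d: "((\<lambda>t. 1 / (2 * t)) has_vector_derivative (- 1 / (2 * t ^ 2))) (at t)"
      unfolding has_real_derivative_iff_has_vector_derivative [symmetric]
      using that by (auto intro!: derivative_eq_intros simp: field_simps power2_eq_square)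
    have u: "((\<lambda>t. eta_axis (1 / (2 * t))) has_vector_derivative
        ((- 1 / (2 * t ^ 2)) *\<^sub>R (l (1 / (2 * t)) * eta_axis (1 / (2 * t))))) (at t)"
      using vector_diff_chain_at[OF d e] by (simp add: o_def)
    have "((\<lambda>t. complex_of_real (t ^ 8)) has_vector_derivative of_real (8 * t ^ 7)) (at t)"
      by (rule has_vector_derivative_of_real) (auto intro!: derivative_eq_intros)
    moreover have "(eta_axis has_vector_derivative (l t * eta_axis t)) (at t)"
      using eta_axis_deriv[OF that] by (simp add: l_def)
    ultimately have w: "((\<lambda>t. of_real (t ^ 8) * eta_axis t) has_vector_derivative
        (of_real (t ^ 8) * (l t * eta_axis t) + of_real (8 * t ^ 7) * eta_axis t)) (at t)"
      by (intro has_vector_derivative_mult)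
    define W where "W = of_real (t ^ 8) * eta_axis t"
    have W: "W \<noteq> 0" using eta_axis_nonzero[OF that] that by (simp add: W_def)
    have wW: "of_real (t ^ 8) * (l t * eta_axis t) + of_real (8 * t ^ 7) * eta_axis t = (of_real (8 / t) + l t) * W"
      using that by (simp add: W_def field_simps eval_nat_numeral)
    have iD: "(inverse has_field_derivative - (inverse W * 1 * inverse W)) (at W)"
      by (rule derivative_eq_intros refl W)+
    have i: "((\<lambda>t. inverse (of_real (t ^ 8) * eta_axis t)) has_vector_derivative
       ((of_real (8 / t) + l t) * W) * - (inverse W * 1 * inverse W)) (at t)"
      using field_vector_diff_chain_at[OF w[unfolded wW] iD[unfolded W_def]] unfolding W_def by (simp only: o_def)
    have "(R has_vector_derivative (eta_axis (1 / (2 * t)) * (((of_real (8 / t) + l t) * W) * - (inverse W * 1 * inverse W))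
       + ((- 1 / (2 * t ^ 2)) *\<^sub>R (l (1 / (2 * t)) * eta_axis (1 / (2 * t)))) * inverse W)) (at t)"
      unfolding R_def W_def by (rule has_vector_derivative_mult[OF u i[unfolded W_def]])
    also have "(- 1 / (2 * t ^ 2)) *\<^sub>R (l (1 / (2 * t)) * eta_axis (1 / (2 * t))) =
        (of_real (8 / t) + l t) * eta_axis (1 / (2 * t))"
      unfolding l[OF that, symmetric] by (simp add: scaleR_conv_of_real)
    also have "eta_axis (1 / (2 * t)) * (((of_real (8 / t) + l t) * W) * - (inverse W * 1 * inverse W))
       + (of_real (8 / t) + l t) * eta_axis (1 / (2 * t)) * inverse W = 0"
      using W by (simp add: field_simps del: of_real_divide)
    finally show ?thesis .
  qed
  obtain c where "\<And>t. t \<in> {0<..} \<Longrightarrow> R t = c"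
    by (rule has_vector_derivative_zero_constant[of "{0<..}" R])
       (auto intro: has_vector_derivative_at_within D)
  then have c: "\<And>t. t > 0 \<Longrightarrow> R t = c" by simp
  have "c = 16"
  proof -
    define s where "s = 1 / sqrt 2"
    have s: "s > 0" "1 / (2 * s) = s" "s ^ 2 = 1 / 2"
      by (simp_all add: s_def real_div_sqrt power_divide field_simps)
    have "s ^ 8 = (s ^ 2) ^ 4" by simp
    then have "s ^ 8 = 1 / 16" unfolding s by (simp add: power_divide)
    then have "c = eta_axis s * inverse (of_real (1 / 16) * eta_axis s)"
      using c[OF s(1)] unfolding R_def s(2) by (simp only:)
    then show ?thesis using eta_axis_nonzero[OF s(1)] by simp
  qed
  then show ?thesis using c[OF t] eta_axis_nonzero[OF t] t by (simp add: R_def field_simps)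
qed

section \<open>The q-expansion\<close>

definition eta_q :: "complex \<Rightarrow> complex" where
  "eta_q q = q * euler_prod q ^ 8 * euler_prod (q ^ 2) ^ 8"

definition eta_q_partial :: "nat \<Rightarrow> complex \<Rightarrow> complex" where
  "eta_q_partial N q = q * (\<Prod>m<N. 1 - q ^ Suc m) ^ 8 * (\<Prod>m<N. 1 - (q ^ 2) ^ Suc m) ^ 8"

lemma norm_power2_less_1: "norm q < 1 \<Longrightarrow> norm (q ^ 2 :: complex) < 1"
  by (simp add: norm_power power_less_one_iff)

lemma holomorphic_eta_q: "eta_q holomorphic_on ball 0 1"
proof -
  have "(euler_prod \<circ> (\<lambda>q. q ^ 2)) holomorphic_on ball 0 1"
  proof (rule holomorphic_on_compose_gen[OF _ holomorphic_euler_prod])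
    show "(\<lambda>q. q ^ 2) ` ball 0 1 \<subseteq> (ball 0 1 :: complex set)"
      using norm_power2_less_1 by auto
  qed (auto intro!: holomorphic_intros)
  then show ?thesis
    unfolding eta_q_def o_def by (intro holomorphic_intros holomorphic_euler_prod)
qed

lemma uniform_limit_power:
  fixes f :: "'a \<Rightarrow> 'b \<Rightarrow> complex"
  assumes "uniform_limit S f l F" "bounded (l ` S)"
  shows "uniform_limit S (\<lambda>n x. f n x ^ k) (\<lambda>x. l x ^ k) F \<and> bounded ((\<lambda>x. l x ^ k) ` S)"
proof (induction k)
  case 0
  have "bounded ((\<lambda>x. 1 :: complex) ` S)" by (rule bounded_subset[of "{1}"]) auto
  then show ?case by (simp add: uniform_limit_const)
next
  case (Suc k)
  have "uniform_limit S (\<lambda>n x. f n x * f n x ^ k) (\<lambda>x. l x * l x ^ k) F"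
    using Suc assms by (intro uniform_lim_mult) auto
  moreover have "bounded ((\<lambda>x. l x * l x ^ k) ` S)"
  proof -
    obtain A B where "\<And>x. x \<in> S \<Longrightarrow> norm (l x) \<le> A" "\<And>x. x \<in> S \<Longrightarrow> norm (l x ^ k) \<le> B"
      using assms(2) Suc by (auto simp: bounded_iff)
    then have "norm (l x * l x ^ k) \<le> A * B" if "x \<in> S" for x
      unfolding norm_mult using that by (meson mult_mono norm_ge_zero order_trans)
    then show ?thesis by (auto simp: bounded_iff)
  qed
  ultimately show ?case by simp
qed

lemma eta_q_uniform_limit:
  assumes R: "0 \<le> R" "R < 1"
  shows "uniform_limit (cball 0 R) eta_q_partial eta_q sequentially"
proof -
  let ?S = "cball 0 R :: complex set"
  note U = euler_prod_uniform_limit[OF R]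
  have sq: "q ^ 2 \<in> ?S" if "q \<in> ?S" for q
  proof -
    have "norm q ^ 2 \<le> R ^ 2" using that by (intro power_mono) auto
    also have "\<dots> \<le> R" using R by (simp add: power2_eq_square mult_left_le)
    finally show ?thesis by (simp add: norm_power)
  qed
  have U2: "uniform_limit ?S (\<lambda>N q. \<Prod>m<N. 1 - (q ^ 2) ^ Suc m) (\<lambda>q. euler_prod (q ^ 2)) sequentially"
    using U sq unfolding uniform_limit_iff by (auto elim!: eventually_mono)
  have cont: "continuous_on ?S euler_prod"
    by (intro holomorphic_on_imp_continuous_on holomorphic_on_subset[OF holomorphic_euler_prod]) (use R in auto)
  have B: "bounded (euler_prod ` ?S)"
    by (intro compact_imp_bounded compact_continuous_image cont) simp
  have B2: "bounded ((\<lambda>q. euler_prod (q ^ 2)) ` ?S)"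
    by (rule bounded_subset[OF B]) (use sq in auto)
  have "bounded ((\<lambda>q. q) ` ?S)" by simp
  then have P: "uniform_limit ?S (\<lambda>N q. q * (\<Prod>m<N. 1 - q ^ Suc m) ^ 8) (\<lambda>q. q * euler_prod q ^ 8) sequentially"
    using uniform_limit_power[OF U B, of 8] by (intro uniform_lim_mult uniform_limit_const) auto
  have "bounded ((\<lambda>q. q * euler_prod q ^ 8) ` ?S)"
    by (intro compact_imp_bounded compact_continuous_image continuous_intros cont) simp
  then show ?thesis
    unfolding eta_q_def eta_q_partial_def
    using uniform_limit_power[OF U2 B2, of 8] P by (auto intro: uniform_lim_mult)
qed

definition fps_of_int_coeffs :: "int fps \<Rightarrow> complex fps" where
  "fps_of_int_coeffs f = Abs_fps (\<lambda>n. of_int (fps_nth f n))"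

lemma fps_of_int_coeffs_mult: "fps_of_int_coeffs (f * g) = fps_of_int_coeffs f * fps_of_int_coeffs g"
  by (rule fps_ext) (simp add: fps_of_int_coeffs_def fps_mult_nth)

lemma fps_of_int_coeffs_diff: "fps_of_int_coeffs (f - g) = fps_of_int_coeffs f - fps_of_int_coeffs g"
  by (rule fps_ext) (simp add: fps_of_int_coeffs_def)

lemma fps_of_int_coeffs_1 [simp]: "fps_of_int_coeffs 1 = 1"
  by (rule fps_ext) (simp add: fps_of_int_coeffs_def)

lemma fps_of_int_coeffs_X [simp]: "fps_of_int_coeffs fps_X = fps_X"
  by (rule fps_ext) (simp add: fps_of_int_coeffs_def fps_X_def)

lemma fps_of_int_coeffs_power: "fps_of_int_coeffs (f ^ k) = fps_of_int_coeffs f ^ k"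
  by (induction k) (simp_all add: fps_of_int_coeffs_mult)

lemma fps_of_int_coeffs_prod: "fps_of_int_coeffs (\<Prod>x\<in>A. f x) = (\<Prod>x\<in>A. fps_of_int_coeffs (f x))"
  by (induction A rule: infinite_finite_induct) (simp_all add: fps_of_int_coeffs_mult)

text \<open>Unlike in \<open>eta_coeff\<close> the truncation does not depend on the index, so one
  product yields all coefficients up to N.\<close>

definition eta_fps :: "nat \<Rightarrow> int fps" where
  "eta_fps N = fps_X * (\<Prod>m\<in>{1..N}. (1 - fps_X ^ m) ^ 8 * (1 - fps_X ^ (2 * m)) ^ 8)"

lemma fps_one_minus_power_nth:
  fixes g :: "int fps"
  assumes "k < m"
  shows "fps_nth ((1 - fps_X ^ m) ^ j * g) k = fps_nth g k"
proof (induction j)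
  case (Suc j)
  have "(1 - fps_X ^ m) ^ Suc j * g = (1 - fps_X ^ m) ^ j * g - fps_X ^ m * ((1 - fps_X ^ m) ^ j * g)"
    by (simp add: algebra_simps)
  then show ?case using Suc assms by (simp add: fps_X_power_mult_nth)
qed simp

lemma eta_fps_nth: "n \<le> N \<Longrightarrow> fps_nth (eta_fps N) n = eta_coeff n"
proof (induction N rule: dec_induct)
  case base
  show ?case by (simp add: eta_fps_def eta_coeff_def)
next
  case (step N)
  have "eta_fps (Suc N) = (1 - fps_X ^ Suc N) ^ 8 * ((1 - fps_X ^ (2 * Suc N)) ^ 8 * eta_fps N)"
    unfolding eta_fps_def by (simp add: prod.nat_ivl_Suc' mult_ac)
  then have "fps_nth (eta_fps (Suc N)) n = fps_nth (eta_fps N) n"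
    using step.hyps by (simp only:) (subst fps_one_minus_power_nth, simp, subst fps_one_minus_power_nth, simp_all)
  then show ?case using step by simp
qed

lemma eta_q_partial_expansion:
  "eta_q_partial N has_fps_expansion fps_of_int_coeffs (eta_fps N)"
proof -
  have "eta_q_partial N = (\<lambda>q. q * (\<Prod>m\<in>{1..N}. (1 - q ^ m) ^ 8 * (1 - q ^ (2 * m)) ^ 8))"
  proof
    fix q :: complex
    have "(\<Prod>m\<in>{1..N}. (1 - q ^ m) ^ 8 * (1 - q ^ (2 * m)) ^ 8) = (\<Prod>m<N. (1 - q ^ Suc m) ^ 8 * (1 - q ^ (2 * Suc m)) ^ 8)"
      by (rule prod.reindex_bij_witness[of _ Suc "\<lambda>m. m - 1"]) auto
    then show "eta_q_partial N q = q * (\<Prod>m\<in>{1..N}. (1 - q ^ m) ^ 8 * (1 - q ^ (2 * m)) ^ 8)"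
      unfolding eta_q_partial_def by (simp only: prod.distrib prod_power_distrib power_mult mult.assoc)
  qed
  moreover have "(\<lambda>q. q * (\<Prod>m\<in>{1..N}. (1 - q ^ m) ^ 8 * (1 - q ^ (2 * m)) ^ 8)) has_fps_expansion
     (fps_X * (\<Prod>m\<in>{1..N}. (1 - fps_X ^ m) ^ 8 * (1 - fps_X ^ (2 * m)) ^ 8) :: complex fps)"
    by (intro fps_expansion_intros)
  ultimately show ?thesis
    unfolding eta_fps_def
    by (simp only: fps_of_int_coeffs_mult fps_of_int_coeffs_prod fps_of_int_coeffs_power
        fps_of_int_coeffs_diff fps_of_int_coeffs_1 fps_of_int_coeffs_X)
qed

text \<open>Taylor coefficients pass to the locally uniform limit of the truncated products, and the
  n-th one is constant from truncation n on.\<close>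

lemma eta_q_sums:
  assumes q: "norm q < 1"
  shows "(\<lambda>n. of_int (eta_coeff n) * q ^ n) sums eta_q q"
proof -
  have "(deriv ^^ n) eta_q 0 / fact n = of_int (eta_coeff n)" for n
  proof -
    have "uniform_limit (ball 0 (1 / 2)) eta_q_partial eta_q sequentially"
      using eta_q_uniform_limit[of "1 / 2"] by (rule uniform_limit_on_subset) auto
    then have "(\<lambda>N. (deriv ^^ n) (eta_q_partial N) 0) \<longlonglongrightarrow> (deriv ^^ n) eta_q 0"
      by (rule higher_deriv_complex_uniform_limit)
         (auto simp: eta_q_partial_def[abs_def] intro!: always_eventually holomorphic_intros)
    then have "(\<lambda>N. (deriv ^^ n) (eta_q_partial N) 0 / fact n) \<longlonglongrightarrow> (deriv ^^ n) eta_q 0 / fact n"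
      by (intro tendsto_intros) auto
    moreover have "\<forall>\<^sub>F N in sequentially. (deriv ^^ n) (eta_q_partial N) 0 / fact n = of_int (eta_coeff n)"
      using eventually_ge_at_top[of n]
    proof eventually_elim
      case (elim N)
      have "(deriv ^^ n) (eta_q_partial N) 0 / fact n = fps_nth (fps_of_int_coeffs (eta_fps N)) n"
        by (rule fps_nth_fps_expansion[OF eta_q_partial_expansion, symmetric])
      then show ?case using eta_fps_nth[OF elim] by (simp add: fps_of_int_coeffs_def)
    qed
    ultimately show ?thesis
      by (metis LIMSEQ_unique tendsto_eventually)
  qed
  then show ?thesis
    using holomorphic_power_series[OF holomorphic_eta_q, of q] q by simp
qed

lemma eta_coeff_summable:
  assumes "0 \<le> r" "r < 1"
  shows "summable (\<lambda>n. \<bar>real_of_int (eta_coeff n)\<bar> * r ^ n)"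
proof -
  obtain s where s: "r < s" "s < 1" using assms dense by blast
  have "summable (\<lambda>n. of_int (eta_coeff n) * complex_of_real s ^ n)"
    using eta_q_sums[of "of_real s"] s assms by (auto simp: sums_iff)
  then have "summable (\<lambda>n. norm (of_int (eta_coeff n) * complex_of_real r ^ n))"
    by (rule powser_insidea) (use s assms in auto)
  then show ?thesis using assms by (simp add: norm_mult norm_power)
qed

section \<open>The form on the upper half-plane\<close>

definition eta_fun :: "complex \<Rightarrow> complex" where
  "eta_fun z = eta_q (exp (2 * of_real pi * \<i> * z))"

lemma norm_exp_2pi: "norm (exp (2 * of_real pi * \<i> * z)) = exp (- 2 * pi * Im z)"
  by simp

lemma norm_exp_2pi_less: "Im z > 0 \<Longrightarrow> norm (exp (2 * of_real pi * \<i> * z)) < 1"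
  by simp

lemma holomorphic_eta_fun: "eta_fun holomorphic_on {z. Im z > 0}"
proof -
  have "(eta_q \<circ> (\<lambda>z. exp (2 * of_real pi * \<i> * z))) holomorphic_on {z. Im z > 0}"
  proof (rule holomorphic_on_compose_gen[OF _ holomorphic_eta_q])
    show "(\<lambda>z. exp (2 * of_real pi * \<i> * z)) ` {z. Im z > 0} \<subseteq> ball 0 1"
      using norm_exp_2pi_less by auto
  qed (auto intro!: holomorphic_intros)
  then show ?thesis by (simp add: eta_fun_def[abs_def] o_def)
qed

lemma eta_fun_sums:
  assumes "Im z > 0"
  shows "(\<lambda>n. of_int (eta_coeff n) * exp (2 * of_real pi * \<i> * of_nat n * z)) sums eta_fun z"
proof -
  have "exp (2 * of_real pi * \<i> * z) ^ n = exp (2 * of_real pi * \<i> * of_nat n * z)" for n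
    by (simp add: exp_of_nat_mult[symmetric] mult_ac)
  then show ?thesis
    using eta_q_sums[OF norm_exp_2pi_less[OF assms]] by (simp add: eta_fun_def)
qed

lemma eta_fun_plus_1: "eta_fun (z + 1) = eta_fun z"
proof -
  have "exp (2 * of_real pi * \<i> * (z + 1)) = exp (2 * of_real pi * \<i> * z)"
    by (simp add: algebra_simps exp_add)
  then show ?thesis by (simp add: eta_fun_def)
qed

lemma eta_fun_axis: "eta_fun (\<i> * of_real t) = eta_axis t"
proof -
  have e: "exp (2 * of_real pi * \<i> * (\<i> * of_real t)) = complex_of_real (exp (- (2 * pi * t)))" for t
    unfolding exp_of_real [symmetric] by (rule arg_cong[of _ _ exp]) (simp add: algebra_simps)
  have "complex_of_real (exp (- (2 * pi * t))) ^ 2 = of_real (exp (- (2 * pi * (2 * t))))"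
    by (simp only: of_real_power[symmetric] exp_of_nat_mult[symmetric]) (simp add: algebra_simps)
  then show ?thesis unfolding eta_fun_def e eta_q_def eta_axis_def by simp
qed

text \<open>The partial products are real and nonnegative, hence so is their limit, and it is not
  0.\<close>

lemma euler_prod_pos:
  assumes x: "0 \<le> x" "x < 1"
  shows "Im (euler_prod (of_real x)) = 0" "Re (euler_prod (of_real x)) > 0"
proof -
  have "norm (complex_of_real x) < 1" using x by simp
  have lim: "(\<lambda>N. \<Prod>m<N. 1 - complex_of_real x ^ Suc m) \<longlonglongrightarrow> euler_prod (of_real x)"
    by (rule tendsto_uniform_limitI[OF euler_prod_uniform_limit[OF x]]) (use x in auto)
  have "(\<Prod>m<N. 1 - complex_of_real x ^ Suc m) = of_real (\<Prod>m<N. 1 - x ^ Suc m)" for N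
    by simp
  then have lim': "(\<lambda>N. complex_of_real (\<Prod>m<N. 1 - x ^ Suc m)) \<longlonglongrightarrow> euler_prod (of_real x)"
    using lim by simp
  from tendsto_Im[OF this] have "(\<lambda>N::nat. 0) \<longlonglongrightarrow> Im (euler_prod (of_real x))"
    by (simp only: Im_complex_of_real)
  then show im: "Im (euler_prod (of_real x)) = 0" by (simp add: LIMSEQ_const_iff)
  have "x ^ Suc m \<le> 1" for m using x by (intro power_le_one) auto
  then have "0 \<le> (\<Prod>m<N. 1 - x ^ Suc m)" for N by (intro prod_nonneg) simp
  moreover have "(\<lambda>N. \<Prod>m<N. 1 - x ^ Suc m) \<longlonglongrightarrow> Re (euler_prod (of_real x))"
    using tendsto_Re[OF lim'] by (simp only: Re_complex_of_real)
  ultimately have "Re (euler_prod (of_real x)) \<ge> 0"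
    by (intro LIMSEQ_le_const) blast+
  moreover have "euler_prod (of_real x) \<noteq> 0" using euler_prod_nonzero x by simp
  ultimately show "Re (euler_prod (of_real x)) > 0" using im by (auto simp: complex_eq_iff less_le)
qed

lemma eta_fun_axis_pos:
  assumes t: "t > 0"
  shows "Im (eta_fun (\<i> * of_real t)) = 0" "Re (eta_fun (\<i> * of_real t)) > 0"
proof -
  have e: "\<exists>r>0. euler_prod (complex_of_real (exp (- (2 * pi * s)))) = of_real r" if "s > 0" for s
    using euler_prod_pos[of "exp (- (2 * pi * s))"] that
    by (intro exI[of _ "Re (euler_prod (complex_of_real (exp (- (2 * pi * s)))))"]) (auto simp: complex_eq_iff)
  obtain a b where ab: "a > 0" "b > 0"
    "euler_prod (complex_of_real (exp (- (2 * pi * t)))) = of_real a"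
    "euler_prod (complex_of_real (exp (- (2 * pi * (2 * t))))) = of_real b"
    using e[of t] e[of "2 * t"] t by auto
  have "eta_fun (\<i> * of_real t) = of_real (exp (- (2 * pi * t)) * a ^ 8 * b ^ 8)"
    unfolding eta_fun_axis eta_axis_def ab by simp
  then show "Im (eta_fun (\<i> * of_real t)) = 0" "Re (eta_fun (\<i> * of_real t)) > 0"
    using ab by (simp_all del: of_real_mult of_real_power)
qed

lemma Im_invert: "Im (- 1 / (2 * z)) = Im z / (2 * norm z ^ 2)"
  by (subst complex_div_cnj) (simp add: norm_mult power_mult_distrib)

text \<open>Both sides are holomorphic and agree on the imaginary axis, so the identity theorem
  extends \<open>eta_axis_invert\<close>.\<close>

theorem eta_fun_invert:
  assumes z: "Im z > 0"
  shows "eta_fun (- 1 / (2 * z)) = 16 * z ^ 8 * eta_fun z"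
proof -
  let ?H = "{z. Im z > 0}"
  define g where "g = (\<lambda>z. eta_fun (- 1 / (2 * z)) - 16 * z ^ 8 * eta_fun z)"
  have Hc: "convex ?H" by (rule convex_halfspace_Im_gt)
  have H: "open ?H" "connected ?H" using Hc by (auto intro: open_halfspace_Im_gt convex_connected)
  have "(eta_fun \<circ> (\<lambda>z. - 1 / (2 * z))) holomorphic_on ?H"
  proof (rule holomorphic_on_compose_gen[OF _ holomorphic_eta_fun])
    show "(\<lambda>z. - 1 / (2 * z)) ` ?H \<subseteq> ?H"
      using Im_invert by (auto intro!: divide_pos_pos)
  qed (auto intro!: holomorphic_intros)
  then have hol: "g holomorphic_on ?H"
    unfolding g_def o_def by (intro holomorphic_intros holomorphic_eta_fun)
  have zero: "g w = 0" if "w \<in> (\<lambda>t. \<i> * complex_of_real t) ` {0<..}" for w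
  proof -
    from that obtain t where "t \<in> {0<..}" and w: "w = \<i> * of_real t" by blast
    then have t: "t > 0" "w = \<i> * of_real t" by simp_all
    have "- 1 / (2 * w) = \<i> * of_real (1 / (2 * t))" using t by (simp add: field_simps)
    moreover have "w ^ 8 = of_real (t ^ 8)" using t by (simp add: power_mult_distrib)
    ultimately show ?thesis
      unfolding g_def using eta_axis_invert[OF t(1)] by (simp only: t(2) eta_fun_axis) simp
  qed
  have "\<i> islimpt ((\<lambda>t. \<i> * complex_of_real t) ` {0<..})"
    unfolding islimpt_approachable
  proof (intro allI impI)
    fix e :: real assume e: "e > 0"
    let ?x = "\<i> * complex_of_real (1 + e / 2)"
    have "?x - \<i> = \<i> * of_real (e / 2)" by (simp add: algebra_simps)
    then have "dist ?x \<i> = e / 2" using e by (simp only: dist_norm) (simp add: norm_mult)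
    then have "dist ?x \<i> < e" "?x \<noteq> \<i>" using e by auto
    moreover have "?x \<in> (\<lambda>t. \<i> * complex_of_real t) ` {0<..}"
      by (rule imageI) (use e in simp)
    ultimately show "\<exists>x'\<in>(\<lambda>t. \<i> * complex_of_real t) ` {0<..}. x' \<noteq> \<i> \<and> dist x' \<i> < e"
      by blast
  qed
  then have "g z = 0"
    by (rule analytic_continuation[OF hol H(1,2), rotated 2]) (use zero z in auto)
  then show ?thesis by (simp add: g_def)
qed

section \<open>Growth at the cusps and of the coefficients\<close>

text \<open>The exponent is half the weight, which makes this invariant under z + 1 and -1/(2
  z).\<close>

definition eta_h :: "complex \<Rightarrow> real" where
  "eta_h z = Im z ^ 4 * norm (eta_fun z)"

lemma eta_fun_plus_of_int: "eta_fun (z + of_int n) = eta_fun z"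
proof -
  have nat: "eta_fun (z + of_nat k) = eta_fun z" for k z
    by (induction k) (use eta_fun_plus_1 in \<open>auto simp: add.assoc[symmetric] add.commute[of 1]\<close>)
  show ?thesis
  proof (cases "n \<ge> 0")
    case True then show ?thesis using nat[of z "nat n"] by simp
  next
    case False then show ?thesis using nat[of "z + of_int n" "nat (- n)"] by simp
  qed
qed

lemma eta_h_plus_of_int: "eta_h (z + of_int n) = eta_h z"
  by (simp add: eta_h_def eta_fun_plus_of_int)

lemma eta_h_invert:
  assumes z: "Im z > 0"
  shows "eta_h (- 1 / (2 * z)) = eta_h z"
proof -
  have "z \<noteq> 0" using z by auto
  then show ?thesis
    unfolding eta_h_def Im_invert eta_fun_invert[OF z]
    by (simp add: norm_mult norm_power power_divide power_mult_distrib)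
qed

lemma pow_le_exp: "0 \<le> y \<Longrightarrow> y ^ n \<le> fact n * exp (y :: real)"
proof -
  assume y: "0 \<le> y"
  have "y ^ n / fact n \<le> (\<Sum>n. y ^ n / fact n)"
    using y summable_exp[of y] by (intro sum_le_suminf[of _ "{n}", simplified]) (auto simp: field_simps)
  also have "\<dots> = exp y" by (simp add: exp_def field_simps)
  finally show ?thesis by (simp add: field_simps)
qed

lemma eta_fun_bound_high:
  "\<exists>C>0. \<forall>z. Im z \<ge> 2 / 5 \<longrightarrow> norm (eta_fun z) \<le> C * exp (- 2 * pi * Im z)"
proof -
  define r where "r = exp (- 2 * pi * (2 / 5))"
  have r: "0 \<le> r" "r < 1" by (auto simp: r_def)
  define G where "G = (\<lambda>q. euler_prod q ^ 8 * euler_prod (q ^ 2) ^ 8)"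
  have sq: "q ^ 2 \<in> ball 0 1" if "q \<in> cball 0 r" for q :: complex
    using that r norm_power2_less_1[of q] by auto
  have c: "continuous_on (ball 0 1) euler_prod"
    by (rule holomorphic_on_imp_continuous_on[OF holomorphic_euler_prod])
  have "continuous_on (cball 0 r) G"
    unfolding G_def
    by (intro continuous_intros continuous_on_compose2[OF c]) (use r sq in auto)
  then have "bounded (G ` cball 0 r)"
    by (intro compact_imp_bounded compact_continuous_image) auto
  then obtain C where C: "C > 0" "\<And>q. q \<in> cball 0 r \<Longrightarrow> norm (G q) \<le> C"
    unfolding bounded_pos by auto
  have "norm (eta_fun z) \<le> C * exp (- 2 * pi * Im z)" if "Im z \<ge> 2 / 5" for z
  proof -
    define q where "q = exp (2 * of_real pi * \<i> * z)"
    have nq: "norm q = exp (- 2 * pi * Im z)" unfolding q_def by (rule norm_exp_2pi)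
    then have "norm q \<le> r" using that by (simp add: r_def)
    then have "norm (G q) \<le> C" using C by simp
    moreover have "eta_fun z = q * G q" by (simp add: eta_fun_def eta_q_def q_def G_def mult.assoc)
    ultimately show ?thesis using nq by (simp add: norm_mult mult_ac mult_left_mono)
  qed
  then show ?thesis using C by blast
qed

text \<open>Reduction theory with the two maps. A point with |Re z| \<le> 1/2 and Im z < 2/5 has 2
  |z|^2 \<le> 2 (1/4 + 4/25) < 5/6, so the inversion raises its height by a factor of at least 6/5,
  and finitely many steps reach height 2/5.\<close>

lemma eta_h_bounded: "\<exists>K>0. \<forall>z. Im z > 0 \<longrightarrow> eta_h z \<le> K"
proof -
  obtain C where C: "C > 0" "\<And>z. Im z \<ge> 2 / 5 \<Longrightarrow> norm (eta_fun z) \<le> C * exp (- 2 * pi * Im z)"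
    using eta_fun_bound_high by blast
  have high: "eta_h z \<le> 24 * C" if z: "Im z \<ge> 2 / 5" for z
  proof -
    have pow4: "Im z ^ 4 \<le> 24 * exp (Im z)"
      using z pow_le_exp[of "Im z" 4] by (simp add: fact_numeral)
    have "eta_h z \<le> (24 * exp (Im z)) * (C * exp (- 2 * pi * Im z))"
      unfolding eta_h_def using z C by (intro mult_mono pow4) auto
    also have "\<dots> = 24 * C * exp (Im z - 2 * pi * Im z)" by (simp add: exp_diff exp_minus field_simps)
    also have "Im z - 2 * pi * Im z \<le> 0"
      using z pi_gt3 by (simp add: mult_le_cancel_right1)
    then have "24 * C * exp (Im z - 2 * pi * Im z) \<le> 24 * C * 1"
      using C by (intro mult_left_mono) auto
    finally show ?thesis by simp
  qed
  have "eta_h z \<le> 24 * C" if "Im z > 0" "Im z \<ge> 2 / 5 / (6 / 5) ^ k" for k z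
    using that
  proof (induction k arbitrary: z)
    case 0 then show ?case using high by simp
  next
    case (Suc k)
    show ?case
    proof (cases "Im z \<ge> 2 / 5")
      case False
      define z' where "z' = z + of_int (- round (Re z))"
      have z': "Im z' = Im z" "\<bar>Re z'\<bar> \<le> 1 / 2"
        using of_int_round_abs_le[of "Re z"] by (auto simp: z'_def abs_minus_commute)
      have "norm z' ^ 2 = Re z' ^ 2 + Im z' ^ 2" by (rule cmod_power2)
      also have "Re z' ^ 2 \<le> (1 / 2) ^ 2" using z' by (simp add: abs_le_square_iff[symmetric])
      also have "Im z' ^ 2 \<le> (2 / 5) ^ 2" using z' False Suc.prems by (intro power_mono) auto
      finally have n: "2 * norm z' ^ 2 \<le> 5 / 6" by (simp add: power2_eq_square)
      have "z' \<noteq> 0" using z' Suc.prems by auto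
      then have pos: "0 < 2 * norm z' ^ 2" by simp
      have "Im z * (6 / 5) \<le> Im z / (2 * norm z' ^ 2)"
      proof -
        have "Im z / (5 / 6) \<le> Im z / (2 * norm z' ^ 2)"
          using n pos Suc.prems by (intro divide_left_mono) auto
        then show ?thesis by simp
      qed
      then have im: "Im z * (6 / 5) \<le> Im (- 1 / (2 * z'))" unfolding Im_invert z' .
      have "2 / 5 / (6 / 5) ^ k = 2 / 5 / (6 / 5) ^ Suc k * (6 / 5 :: real)" by simp
      also have "\<dots> \<le> Im z * (6 / 5)" using Suc.prems by (intro mult_right_mono) auto
      finally have "2 / 5 / (6 / 5) ^ k \<le> Im (- 1 / (2 * z'))" using im by simp
      moreover have "0 < Im (- 1 / (2 * z'))" using im Suc.prems by linarith
      ultimately have "eta_h (- 1 / (2 * z')) \<le> 24 * C" by (intro Suc.IH)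
      moreover have "eta_h (- 1 / (2 * z')) = eta_h z'" by (rule eta_h_invert) (use z' Suc.prems in simp)
      moreover have "eta_h z' = eta_h z" unfolding z'_def by (rule eta_h_plus_of_int)
      ultimately show ?thesis by simp
    qed (use high in auto)
  qed
  moreover have "\<exists>k. y \<ge> 2 / 5 / (6 / 5) ^ k" if y: "y > 0" for y :: real
  proof -
    obtain k where "(2 / 5) / y < (6 / 5) ^ k" using real_arch_pow[of "6/5"] by auto
    then show ?thesis using y by (intro exI[of _ k]) (simp add: field_simps)
  qed
  ultimately have "\<forall>z. Im z > 0 \<longrightarrow> eta_h z \<le> 24 * C" by blast
  then show ?thesis using C by (intro exI[of _ "24 * C"]) auto
qed

text \<open>High up the q-expansion decides. Below height 2/5 the factor exp(1 - Im z) is at least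
  1, and boundedness is enough.\<close>

lemma eta_h_decay_infinity: "\<exists>C>0. \<forall>z. Im z > 0 \<longrightarrow> eta_h z \<le> C * exp (- Im z)"
proof -
  obtain C where C: "C > 0" "\<And>z. Im z \<ge> 2 / 5 \<Longrightarrow> norm (eta_fun z) \<le> C * exp (- 2 * pi * Im z)"
    using eta_fun_bound_high by blast
  obtain K where K: "K > 0" "\<And>z. Im z > 0 \<Longrightarrow> eta_h z \<le> K" using eta_h_bounded by blast
  have "eta_h z \<le> (24 * C + K * exp 1) * exp (- Im z)" if z: "Im z > 0" for z
  proof (cases "Im z \<ge> 2 / 5")
    case True
    have pow4: "Im z ^ 4 \<le> 24 * exp (Im z)"
      using z pow_le_exp[of "Im z" 4] by (simp add: fact_numeral)
    have "eta_h z \<le> (24 * exp (Im z)) * (C * exp (- 2 * pi * Im z))"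
      unfolding eta_h_def using z C True by (intro mult_mono pow4) auto
    also have "\<dots> = 24 * C * exp (Im z - 2 * pi * Im z)" by (simp add: exp_diff exp_minus field_simps)
    also have "Im z - 2 * pi * Im z \<le> - Im z"
    proof -
      have "2 * Im z \<le> 2 * pi * Im z" using z pi_gt3 by (intro mult_right_mono) auto
      then show ?thesis by simp
    qed
    then have "24 * C * exp (Im z - 2 * pi * Im z) \<le> 24 * C * exp (- Im z)"
      using C by (intro mult_left_mono) auto
    finally have "eta_h z \<le> 24 * C * exp (- Im z)" .
    moreover have "0 \<le> K * exp 1 * exp (- Im z)" using K(1) by simp
    ultimately show ?thesis by (simp add: distrib_right)
  next
    case False
    have "K * 1 \<le> K * (exp 1 * exp (- Im z))"
      using K False by (intro mult_left_mono) (auto simp: exp_add[symmetric])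
    then have "eta_h z \<le> K * exp 1 * exp (- Im z)" using K(2)[OF z] by simp
    moreover have "0 \<le> 24 * C * exp (- Im z)" using C(1) by simp
    ultimately show ?thesis by (simp add: distrib_right)
  qed
  then show ?thesis using C K by (intro exI[of _ "24 * C + K * exp 1"]) (auto intro: add_pos_pos)
qed

text \<open>Euclid's algorithm with nearest integers: after a translation x = w/v with 2 |w| \<le>
  v, and the inversion gives -v/(2 w). Its denominator 2 |w| is smaller than v, or else equal to v,
  and then the result is an integer.\<close>

lemma rational_cusp_induct [consumes 1, case_names zero shift invert]:
  fixes P :: "real \<Rightarrow> bool"
  assumes "x \<in> \<rat>" "P 0" "\<And>x n. P x \<Longrightarrow> P (x + of_int n)"
    and "\<And>x. x \<noteq> 0 \<Longrightarrow> P (- 1 / (2 * x)) \<Longrightarrow> P x"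
  shows "P x"
proof -
  have "P (of_int u / of_nat v)" if "v > 0" for u v
    using that
  proof (induction v arbitrary: u rule: less_induct)
    case (less v)
    define n where "n = round (real_of_int u / real v)"
    define w where "w = u - int v * n"
    have uv: "of_int u / of_nat v = real_of_int w / real v + of_int n"
      using less.prems by (simp add: w_def field_simps)
    have "\<bar>real_of_int w / real v\<bar> \<le> 1 / 2"
    proof -
      have "real_of_int w / real v = - (of_int n - real_of_int u / real v)" using uv by linarith
      then show ?thesis
        using of_int_round_abs_le[of "real_of_int u / real v"] unfolding n_def by (simp only: abs_minus)
    qed
    then have "real_of_int (2 * \<bar>w\<bar>) \<le> real_of_int (int v)"
      using less.prems by (simp add: abs_divide field_simps)
    then have le: "2 * \<bar>w\<bar> \<le> int v" by (simp only: of_int_le_iff)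
    have "P (real_of_int w / real v)"
    proof (cases "w = 0")
      case False
      have "P (- 1 / (2 * (real_of_int w / real v)))"
      proof (cases "2 * \<bar>w\<bar> = int v")
        case True
        then have "real_of_int (2 * \<bar>w\<bar>) = real_of_int (int v)" by (simp only:)
        then have "real v = 2 * \<bar>real_of_int w\<bar>" by simp
        then have "- 1 / (2 * (real_of_int w / real v)) = 0 + of_int (- sgn w)"
          using False by (auto simp: abs_if sgn_if)
        then show ?thesis using assms(3)[OF assms(2)] by metis
      next
        case F: False
        then have "nat (2 * \<bar>w\<bar>) < v" "nat (2 * \<bar>w\<bar>) > 0" using le False by auto
        then have "P (of_int (- sgn w * int v) / of_nat (nat (2 * \<bar>w\<bar>)))" by (rule less.IH)
        also have "of_int (- sgn w * int v) / of_nat (nat (2 * \<bar>w\<bar>)) = - 1 / (2 * (real_of_int w / real v))"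
          using False less.prems by (auto simp: sgn_if field_simps)
        finally show ?thesis .
      qed
      then show ?thesis using False less.prems by (intro assms(4)[of "real_of_int w / real v"]) auto
    qed (use assms in simp)
    then show ?case unfolding uv by (rule assms(3))
  qed
  then show ?thesis using assms(1) by (elim Rats_cases') (metis of_int_of_nat_eq zero_less_imp_eq_int)
qed

text \<open>This is the decay at \<infinity> carried to x: under a map g that takes x to
  \<infinity>, Im (g z) is a constant times Im z/|z - x|^2. The induction only has to follow that
  constant.\<close>

lemma eta_h_decay_cusp:
  assumes "x \<in> \<rat>"
  shows "\<exists>C>0. \<exists>c>0. \<forall>z. Im z > 0 \<longrightarrow> eta_h z \<le> C * exp (- (c * Im z / norm (z - of_real x) ^ 2))"
  using assms
proof (induction x rule: rational_cusp_induct)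
  case zero
  obtain C where C: "C > 0" "\<And>z. Im z > 0 \<Longrightarrow> eta_h z \<le> C * exp (- Im z)"
    using eta_h_decay_infinity by blast
  have "eta_h z \<le> C * exp (- (1 / 2 * Im z / norm (z - of_real 0) ^ 2))" if z: "Im z > 0" for z
  proof -
    have "z \<noteq> 0" using z by auto
    then have "Im (- 1 / (2 * z)) > 0" unfolding Im_invert using z by simp
    from C(2)[OF this] show ?thesis unfolding eta_h_invert[OF z] Im_invert by simp
  qed
  then show ?case using C(1) by (intro exI[of _ C] conjI exI[of _ "1 / 2"]) auto
next
  case (shift x n)
  then obtain C c where C: "C > 0" "c > 0" "\<And>z. Im z > 0 \<Longrightarrow> eta_h z \<le> C * exp (- (c * Im z / norm (z - of_real x) ^ 2))"
    by blast
  have "eta_h z \<le> C * exp (- (c * Im z / norm (z - of_real (x + of_int n)) ^ 2))" if z: "Im z > 0" for z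
    using C(3)[of "z + of_int (- n)"] z unfolding eta_h_plus_of_int by (simp add: algebra_simps)
  then show ?case using C by blast
next
  case (invert x)
  then obtain C c where C: "C > 0" "c > 0"
    "\<And>z. Im z > 0 \<Longrightarrow> eta_h z \<le> C * exp (- (c * Im z / norm (z - of_real (- 1 / (2 * x))) ^ 2))"
    by blast
  have "eta_h z \<le> C * exp (- (c * (2 * x ^ 2) * Im z / norm (z - of_real x) ^ 2))" if z: "Im z > 0" for z
  proof -
    have nz: "z \<noteq> 0" using z by auto
    then have "Im (- 1 / (2 * z)) > 0" unfolding Im_invert using z by simp
    from C(3)[OF this]
    have "eta_h z \<le> C * exp (- (c * Im (- 1 / (2 * z)) / norm (- 1 / (2 * z) - of_real (- 1 / (2 * x))) ^ 2))"
      unfolding eta_h_invert[OF z] .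
    also have "- 1 / (2 * z) - of_real (- 1 / (2 * x)) = (z - of_real x) / (2 * z * of_real x)"
      using nz invert.hyps by (simp add: field_simps)
    also have "c * Im (- 1 / (2 * z)) / norm ((z - of_real x) / (2 * z * of_real x)) ^ 2 =
        c * (2 * x ^ 2) * Im z / norm (z - of_real x) ^ 2"
      unfolding Im_invert using nz invert.hyps
      by (simp add: norm_divide norm_mult power_divide power_mult_distrib)
    finally show ?thesis .
  qed
  moreover have "c * (2 * x ^ 2) > 0" using C invert.hyps by simp
  ultimately show ?case using C(1) by blast
qed

section \<open>The coefficients in mean square\<close>

lemma sum_cis_roots:
  fixes L :: nat and d :: int
  assumes "L > 0" "\<bar>d\<bar> < int L"
  shows "(\<Sum>j<L. cis (2 * pi * real_of_int d / real L) ^ j) = (if d = 0 then of_nat L else 0)"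
proof (cases "d = 0")
  case False
  define w where "w = cis (2 * pi * real_of_int d / real L)"
  have "w ^ L = cis (2 * pi * real_of_int d)" unfolding w_def Complex.DeMoivre using assms by (simp add: field_simps)
  also have "\<dots> = 1" by (simp add: cis_multiple_2pi)
  finally have wL: "w ^ L = 1" .
  have "w \<noteq> 1"
  proof
    assume "w = 1"
    then have "cos (2 * pi * real_of_int d / real L) = 1" unfolding w_def by (simp add: complex_eq_iff)
    then obtain k :: int where k: "2 * pi * real_of_int d / real L = of_int k * 2 * pi"
      by (auto simp: cos_one_2pi_int)
    then have "real_of_int d = real_of_int (k * int L)" using assms by (simp add: field_simps)
    then have d: "d = k * int L" by (simp only: of_int_eq_iff)
    then have "k \<noteq> 0" using False by auto
    then have "int L \<le> \<bar>d\<bar>" unfolding d abs_mult using assms by (simp add: mult_le_cancel_right1)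
    then show False using assms by simp
  qed
  then show ?thesis using False geometric_sum[of w L] wL by (simp add: w_def)
qed simp

lemma discrete_parseval:
  fixes c :: "nat \<Rightarrow> complex"
  assumes L: "L > 0"
  shows "(\<Sum>j<L. norm (\<Sum>n<L. c n * cis (2 * pi * real j / real L) ^ n) ^ 2) = real L * (\<Sum>n<L. norm (c n) ^ 2)"
proof -
  let ?w = "\<lambda>j. cis (2 * pi * real j / real L)"
  have "complex_of_real (\<Sum>j<L. norm (\<Sum>n<L. c n * ?w j ^ n) ^ 2) =
    (\<Sum>j<L. (\<Sum>n<L. c n * ?w j ^ n) * cnj (\<Sum>m<L. c m * ?w j ^ m))"
    by (simp only: of_real_sum complex_norm_square)
  also have "\<dots> = (\<Sum>j<L. \<Sum>n<L. \<Sum>m<L. c n * cnj (c m) * cis (2 * pi * real_of_int (int n - int m) / real L) ^ j)"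
  proof (intro sum.cong refl)
    fix j
    have "?w j ^ n * cnj (?w j ^ m) = cis (2 * pi * real_of_int (int n - int m) / real L) ^ j" for n m
      unfolding Complex.DeMoivre cis_cnj cis_mult by (rule arg_cong[of _ _ cis]) (use L in \<open>simp add: field_simps\<close>)
    then show "(\<Sum>n<L. c n * ?w j ^ n) * cnj (\<Sum>m<L. c m * ?w j ^ m) =
      (\<Sum>n<L. \<Sum>m<L. c n * cnj (c m) * cis (2 * pi * real_of_int (int n - int m) / real L) ^ j)"
      unfolding cnj_sum sum_product complex_cnj_mult
      by (intro sum.cong refl) (metis (no_types, lifting) mult.assoc mult.left_commute)
  qed
  also have "\<dots> = (\<Sum>n<L. \<Sum>m<L. c n * cnj (c m) * (\<Sum>j<L. cis (2 * pi * real_of_int (int n - int m) / real L) ^ j))"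
    unfolding sum_distrib_left by (subst sum.swap) (intro sum.cong refl sum.swap)
  also have "\<dots> = (\<Sum>n<L. \<Sum>m<L. if m = n then c n * cnj (c m) * of_nat L else 0)"
  proof (intro sum.cong refl)
    fix n m assume nm: "n \<in> {..<L}" "m \<in> {..<L}"
    have "(\<Sum>j<L. cis (2 * pi * real_of_int (int n - int m) / real L) ^ j) = (if int n - int m = 0 then of_nat L else 0)"
      by (rule sum_cis_roots) (use L nm in auto)
    then show "c n * cnj (c m) * (\<Sum>j<L. cis (2 * pi * real_of_int (int n - int m) / real L) ^ j) =
       (if m = n then c n * cnj (c m) * of_nat L else 0)"
      by (simp only:) auto
  qed
  also have "\<dots> = (\<Sum>n<L. c n * cnj (c n) * of_nat L)" by simp
  also have "\<dots> = complex_of_real (real L * (\<Sum>n<L. norm (c n) ^ 2))"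
    by (simp add: complex_norm_square[symmetric] sum_distrib_right sum_distrib_left mult.commute)
  finally show ?thesis by (simp only: of_real_eq_iff)
qed

text \<open>Parseval's identity by sampling at the L-th roots of unity. The truncated series there
  is at most M plus a tail that tends to 0 as L grows.\<close>

lemma parseval_le:
  fixes a :: "nat \<Rightarrow> complex"
  assumes r: "r \<ge> 0" and sm: "summable (\<lambda>n. norm (a n) * r ^ n)"
    and M: "\<And>q. norm q = r \<Longrightarrow> norm (\<Sum>n. a n * q ^ n) \<le> M"
  shows "(\<Sum>n<N. norm (a n) ^ 2 * r ^ (2 * n)) \<le> M ^ 2"
proof -
  define e where "e = (\<lambda>L. \<Sum>n. norm (a (n + L)) * r ^ (n + L))"
  have e0: "e \<longlonglongrightarrow> 0"
    unfolding e_def using suminf_exist_split2[OF sm] by simp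
  have le: "(\<Sum>n<N. norm (a n) ^ 2 * r ^ (2 * n)) \<le> (M + e L) ^ 2" if L: "L \<ge> N" "L > 0" for L
  proof -
    have "(\<Sum>n<N. norm (a n) ^ 2 * r ^ (2 * n)) \<le> (\<Sum>n<L. norm (a n) ^ 2 * r ^ (2 * n))"
      using L r by (intro sum_mono2) auto
    also have "\<dots> = (\<Sum>n<L. norm (a n * of_real r ^ n) ^ 2)"
      using r by (simp add: norm_mult norm_power power_mult_distrib power_mult mult.commute[of 2])
    also have "real L * \<dots> = (\<Sum>j<L. norm (\<Sum>n<L. a n * of_real r ^ n * cis (2 * pi * real j / real L) ^ n) ^ 2)"
      by (rule discrete_parseval[OF L(2), symmetric])
    also have "\<dots> \<le> (\<Sum>j<L. (M + e L) ^ 2)"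
    proof (intro sum_mono power_mono)
      fix j
      define q where "q = of_real r * cis (2 * pi * real j / real L)"
      have nq: "norm q = r" using r by (simp add: q_def norm_mult)
      have s: "summable (\<lambda>n. norm (a n * q ^ n))" using sm by (simp add: norm_mult norm_power nq)
      from suminf_split_initial_segment[OF summable_norm_cancel[OF this], of L]
      have "(\<Sum>n. a n * q ^ n) = (\<Sum>n. a (n + L) * q ^ (n + L)) + (\<Sum>n<L. a n * q ^ n)" .
      then have "norm (\<Sum>n<L. a n * q ^ n) \<le> norm (\<Sum>n. a n * q ^ n) + norm (\<Sum>n. a (n + L) * q ^ (n + L))"
        by (metis add_diff_cancel_left' norm_triangle_ineq4)
      also have "norm (\<Sum>n. a (n + L) * q ^ (n + L)) \<le> (\<Sum>n. norm (a (n + L) * q ^ (n + L)))"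
        using s by (intro summable_norm) (rule summable_ignore_initial_segment)
      also have "\<dots> = e L" unfolding e_def by (simp add: norm_mult norm_power nq)
      also have "norm (\<Sum>n. a n * q ^ n) \<le> M" by (rule M[OF nq])
      finally show "norm (\<Sum>n<L. a n * of_real r ^ n * cis (2 * pi * real j / real L) ^ n) \<le> M + e L"
        by (simp add: q_def power_mult_distrib mult.assoc)
    qed auto
    also have "\<dots> = real L * (M + e L) ^ 2" by simp
    finally show ?thesis using L by simp
  qed
  have "(\<lambda>L. (M + e L) ^ 2) \<longlonglongrightarrow> (M + 0) ^ 2" by (intro tendsto_intros e0)
  then show ?thesis
    using le by (intro LIMSEQ_le_const[of _ "M ^ 2"]) (auto intro!: exI[of _ "Suc N"])
qed

text \<open>Hecke's argument in mean square: at height 1/N the form is at most K N^4, while r^(2 n)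
  \<ge> exp(-4 pi) for n \<le> N.\<close>

lemma eta_coeff_square_sum:
  "\<exists>A>0. \<forall>N>0. (\<Sum>n\<le>N. real_of_int (eta_coeff n) ^ 2) \<le> A * real N ^ 8"
proof -
  obtain K where K: "K > 0" "\<And>z. Im z > 0 \<Longrightarrow> eta_h z \<le> K" using eta_h_bounded by blast
  have "(\<Sum>n\<le>N. real_of_int (eta_coeff n) ^ 2) \<le> (K ^ 2 * exp (4 * pi)) * real N ^ 8" if N: "N > 0" for N
  proof -
    define y where "y = 1 / real N"
    define r where "r = exp (- 2 * pi * y)"
    have y: "y > 0" using N by (simp add: y_def)
    have r: "0 < r" "r < 1" using y by (auto simp: r_def)
    have "(\<Sum>n<Suc N. norm (complex_of_int (eta_coeff n)) ^ 2 * r ^ (2 * n)) \<le> (K / y ^ 4) ^ 2"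
    proof (rule parseval_le)
      show "summable (\<lambda>n. norm (complex_of_int (eta_coeff n)) * r ^ n)"
        using eta_coeff_summable[of r] r by simp
      fix q :: complex assume q: "norm q = r"
      then have q0: "q \<noteq> 0" using r by auto
      \<comment> \<open>A logarithm of q, so that the circle of radius r becomes the height
        y.\<close>
      define z where "z = Ln q / (2 * of_real pi * \<i>)"
      have qz: "exp (2 * of_real pi * \<i> * z) = q" using q0 by (simp add: z_def)
      then have "exp (- 2 * pi * Im z) = exp (- 2 * pi * y)"
        using norm_exp_2pi[of z] q by (simp add: r_def)
      then have "Im z = y" by simp
      then have "norm (eta_fun z) \<le> K / y ^ 4"
        using K(2)[of z] y by (simp add: eta_h_def field_simps)
      moreover have "(\<Sum>n. of_int (eta_coeff n) * q ^ n) = eta_fun z"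
        using eta_q_sums[of q] q r unfolding eta_fun_def qz by (simp add: sums_iff)
      ultimately show "norm (\<Sum>n. of_int (eta_coeff n) * q ^ n) \<le> K / y ^ 4" by simp
    qed (use r in auto)
    then have 1: "(\<Sum>n\<le>N. real_of_int (eta_coeff n) ^ 2 * r ^ (2 * n)) \<le> (K / y ^ 4) ^ 2"
      unfolding lessThan_Suc_atMost by simp
    have "exp (- 4 * pi) * (\<Sum>n\<le>N. real_of_int (eta_coeff n) ^ 2) \<le> (\<Sum>n\<le>N. real_of_int (eta_coeff n) ^ 2 * r ^ (2 * n))"
      unfolding sum_distrib_left
    proof (intro sum_mono)
      fix n assume "n \<in> {..N}"
      then have "r ^ (2 * N) \<le> r ^ (2 * n)" using r by (intro power_decreasing) auto
      moreover have "r ^ (2 * N) = exp (- 4 * pi)"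
        unfolding r_def exp_of_nat_mult[symmetric] using N by (simp add: y_def field_simps)
      ultimately show "exp (- 4 * pi) * real_of_int (eta_coeff n) ^ 2 \<le> real_of_int (eta_coeff n) ^ 2 * r ^ (2 * n)"
        using mult_left_mono[of "exp (- 4 * pi)" "r ^ (2 * n)" "real_of_int (eta_coeff n) ^ 2"]
        by (simp add: mult.commute)
    qed
    also note 1
    also have "(K / y ^ 4) ^ 2 = K ^ 2 * real N ^ 8"
      using N by (simp add: y_def power_divide power_mult_distrib)
    finally have f: "exp (4 * pi) * (exp (- 4 * pi) * (\<Sum>n\<le>N. real_of_int (eta_coeff n) ^ 2)) \<le> exp (4 * pi) * (K ^ 2 * real N ^ 8)"
      by (intro mult_left_mono) auto
    have e: "exp (4 * pi) * (exp (- 4 * pi) * x) = x" for x :: real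
      by (simp add: mult.assoc[symmetric] flip: exp_add)
    show ?thesis using f unfolding e by (simp only: mult_ac)
  qed
  then show ?thesis using K by (intro exI[of _ "K ^ 2 * exp (4 * pi)"]) auto
qed

section \<open>Periods\<close>

text \<open>One estimate decays like exp(-c/y), the other like exp(-y); their geometric mean decays
  at both ends. Passing from \<open>eta_h\<close> to f brings in y^(-4), paid for with half of the
  exponent.\<close>

lemma eta_fun_line_bound:
  assumes "x \<in> \<rat>"
  shows "\<exists>B>0. \<exists>k>0. \<forall>y>0. norm (eta_fun (of_real x + \<i> * of_real y)) \<le> B * exp (- (k * (y + 1 / y)))"
proof -
  obtain C c where C: "C > 0" "c > 0" "\<And>z. Im z > 0 \<Longrightarrow> eta_h z \<le> C * exp (- (c * Im z / norm (z - of_real x) ^ 2))"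
    using eta_h_decay_cusp[OF assms] by blast
  obtain C' where C': "C' > 0" "\<And>z. Im z > 0 \<Longrightarrow> eta_h z \<le> C' * exp (- Im z)"
    using eta_h_decay_infinity by blast
  define S where "S = sqrt (C * C')"
  \<comment> \<open>The factor 1/2 comes from the square root in the geometric mean.\<close>
  define k where "k = min c 1 / 2"
  have S: "S > 0" "S ^ 2 = C * C'" using C C' by (auto simp: S_def)
  have k: "k > 0" "2 * k \<le> c" "2 * k \<le> 1" using C by (auto simp: k_def)
  have "norm (eta_fun (of_real x + \<i> * of_real y)) \<le> (S * (24 * (2 / k) ^ 4)) * exp (- (k / 2 * (y + 1 / y)))"
    if y: "y > 0" for y
  proof -
    define z where "z = of_real x + \<i> * complex_of_real y"
    have z: "Im z = y" "norm (z - of_real x) = y" using y by (auto simp: z_def norm_mult)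
    have 1: "eta_h z \<le> C * exp (- (c / y))"
      using C(3)[of z] z y by (simp add: power2_eq_square)
    have 2: "eta_h z \<le> C' * exp (- y)" using C'(2)[of z] z y by simp
    have h0: "eta_h z \<ge> 0" by (simp add: eta_h_def)
    have "eta_h z ^ 2 \<le> (C * exp (- (c / y))) * (C' * exp (- y))"
      unfolding power2_eq_square using 1 2 h0 C C' by (intro mult_mono) auto
    also have "\<dots> = S ^ 2 * exp (- (c / y + y))"
      unfolding S by (simp add: exp_add exp_minus exp_diff field_simps)
    also have "\<dots> \<le> S ^ 2 * exp (- (2 * k * (y + 1 / y)))"
    proof -
      have "2 * k * (1 / y) \<le> c * (1 / y)" "2 * k * y \<le> 1 * y"
        using k y by (intro mult_right_mono; simp)+
      then have "2 * k * (y + 1 / y) \<le> c / y + y" by (simp add: algebra_simps)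
      then show ?thesis by (intro mult_left_mono zero_le_power2) simp
    qed
    also have "\<dots> = (S * exp (- (k * (y + 1 / y)))) ^ 2"
      unfolding power_mult_distrib exp_of_nat_mult[of 2, symmetric, simplified] by (simp add: algebra_simps flip: exp_double)
    finally have h: "eta_h z \<le> S * exp (- (k * (y + 1 / y)))"
      by (rule power2_le_imp_le) (use S in auto)
    have "(k / 2 / y) ^ 4 \<le> 24 * exp (k / 2 / y)"
      using pow_le_exp[of "k / 2 / y" 4] k y by (simp add: fact_numeral)
    then have "(2 / k) ^ 4 * (k / 2 / y) ^ 4 \<le> (2 / k) ^ 4 * (24 * exp (k / 2 / y))"
      using k by (intro mult_left_mono) auto
    also have "(2 / k) ^ 4 * (k / 2 / y) ^ 4 = 1 / y ^ 4"
      using k by (simp add: power_divide)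
    finally have y4: "1 / y ^ 4 \<le> 24 * (2 / k) ^ 4 * exp (k / 2 / y)" by (simp add: mult_ac)
    have "norm (eta_fun z) = eta_h z * (1 / y ^ 4)" using y z by (simp add: eta_h_def)
    also have "\<dots> \<le> (S * exp (- (k * (y + 1 / y)))) * (24 * (2 / k) ^ 4 * exp (k / 2 / y))"
      using h y4 S h0 y by (intro mult_mono) auto
    also have "\<dots> = (S * (24 * (2 / k) ^ 4)) * exp (- (k * (y + 1 / y)) + k / 2 / y)"
      by (simp only: exp_add mult_ac)
    also have "- (k * (y + 1 / y)) + k / 2 / y \<le> - (k / 2 * (y + 1 / y))"
      using k y by (simp add: field_simps)
    then have "(S * (24 * (2 / k) ^ 4)) * exp (- (k * (y + 1 / y)) + k / 2 / y) \<le>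
      (S * (24 * (2 / k) ^ 4)) * exp (- (k / 2 * (y + 1 / y)))"
      using S k by (intro mult_left_mono) auto
    finally show ?thesis by (simp add: z_def)
  qed
  moreover have "S * (24 * (2 / k) ^ 4) > 0" "k / 2 > 0" using S k by auto
  ultimately show ?thesis by blast
qed

text \<open>Absorbs powers of y of either sign at both ends, uniformly in the exponent, which the
  holomorphy of the Mellin transform needs.\<close>

lemma powr_le_exp_sym:
  fixes A k :: real
  assumes "k > 0"
  shows "\<exists>M>0. \<forall>a. \<bar>a\<bar> \<le> A \<longrightarrow> (\<forall>y>0. y powr a \<le> M * exp (k * (y + 1 / y)))"
proof -
  define n where "n = nat \<lceil>A\<rceil>"
  have "y powr a \<le> fact n / k ^ n * exp (k * (y + 1 / y))" if a: "\<bar>a\<bar> \<le> A" and y: "y > 0" for a y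
  proof -
    let ?t = "y + 1 / y"
    have t: "?t \<ge> 1" "?t \<ge> y" "?t \<ge> 1 / y"
    proof -
      show "?t \<ge> y" "?t \<ge> 1 / y" using y by auto
      show "?t \<ge> 1"
      proof (cases "y \<ge> 1")
        case False
        then have "1 / y \<ge> 1" using y by simp
        then show ?thesis using y by linarith
      next
        case True
        moreover have "1 / y \<ge> 0" using y by simp
        ultimately show ?thesis by linarith
      qed
    qed
    have "y powr a \<le> ?t powr \<bar>a\<bar>"
    proof (cases "y \<ge> 1")
      case True
      then have "y powr a \<le> y powr \<bar>a\<bar>" by (intro powr_mono) auto
      also have "\<dots> \<le> ?t powr \<bar>a\<bar>" using t y by (intro powr_mono2) auto
      finally show ?thesis .
    next
      case False
      then have y1: "1 / y \<ge> 1" using y by simp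
      have "y powr a = (1 / y) powr (- a)" using y by (simp add: powr_minus powr_divide)
      also have "\<dots> \<le> (1 / y) powr \<bar>a\<bar>" using y1 by (intro powr_mono) auto
      also have "\<dots> \<le> ?t powr \<bar>a\<bar>" using t y1 by (intro powr_mono2) auto
      finally show ?thesis .
    qed
    also have "\<dots> \<le> ?t powr real n" using t a unfolding n_def by (intro powr_mono) linarith+
    also have "\<dots> = ?t ^ n" using t by (simp add: powr_realpow)
    also have "\<dots> = (k * ?t) ^ n / k ^ n" using assms by (simp add: power_mult_distrib)
    also have "\<dots> \<le> fact n * exp (k * ?t) / k ^ n"
      using assms t by (intro divide_right_mono pow_le_exp) auto
    finally show ?thesis by simp
  qed
  moreover have "fact n / k ^ n > 0" using assms by simp
  ultimately show ?thesis by blast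
qed

section \<open>Integrals along vertical lines\<close>

lemma absolutely_integrable_exp_decay:
  fixes g :: "real \<Rightarrow> complex"
  assumes "continuous_on {0<..} g" "k > 0" "\<And>y. y > 0 \<Longrightarrow> norm (g y) \<le> M * exp (- (k * y))"
  shows "g absolutely_integrable_on {0<..}"
proof (rule measurable_bounded_by_integrable_imp_absolutely_integrable)
  show "g \<in> borel_measurable (lebesgue_on {0<..})"
    using assms(1) by (rule continuous_imp_measurable_on_sets_lebesgue) simp
  have "(\<lambda>y. M * exp (- k * y)) integrable_on {0..}"
    using integrable_cmul[OF integrable_on_exp_minus_to_infinity[OF assms(2)], of M 0] by simp
  then show "(\<lambda>y. M * exp (- k * y)) integrable_on {0<..}"
    by (rule integrable_spike_set) (rule negligible_subset[of "{0}"]; force)+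
qed (use assms in auto)

lemma integral_truncation:
  fixes g :: "real \<Rightarrow> complex"
  assumes g: "g absolutely_integrable_on {0<..}"
    and a: "\<And>n. a n > 0" "a \<longlonglongrightarrow> 0" and b: "filterlim b at_top sequentially"
  shows "(\<lambda>n. integral {a n..b n} g) \<longlonglongrightarrow> integral {0<..} g"
proof -
  define f where "f = (\<lambda>n x. if x \<in> {a n..b n} then g x else 0)"
  have int: "g integrable_on {0<..}" "(\<lambda>x. norm (g x)) integrable_on {0<..}"
    using g by (auto simp: absolutely_integrable_on_def)
  have sub: "{a n..b n} \<subseteq> {0<..}" for n using a(1)[of n] by auto
  have "(\<lambda>n. integral {0<..} (f n)) \<longlonglongrightarrow> integral {0<..} g"
  proof (rule dominated_convergence)
    show "f n integrable_on {0<..}" for n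
      unfolding f_def integrable_restrict_Int using integrable_on_subinterval[OF int(1) sub[of n]]
      by (simp add: Int_absorb2 sub)
    show "norm (f n x) \<le> norm (g x)" for n x by (simp add: f_def)
    fix x :: real assume x: "x \<in> {0<..}"
    have "eventually (\<lambda>n. a n < x) sequentially" using order_tendstoD(2)[OF a(2)] x by simp
    moreover have "eventually (\<lambda>n. b n \<ge> x) sequentially" using b by (simp add: filterlim_at_top)
    ultimately have "eventually (\<lambda>n. f n x = g x) sequentially"
      by eventually_elim (simp add: f_def)
    then show "(\<lambda>n. f n x) \<longlonglongrightarrow> g x" by (rule tendsto_eventually)
  qed (rule int)
  moreover have "integral {0<..} (f n) = integral {a n..b n} g" for n
    unfolding f_def integral_restrict_Int by (simp add: Int_absorb2 sub)
  ultimately show ?thesis by simp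
qed

definition qform :: "real \<Rightarrow> real \<Rightarrow> real \<Rightarrow> complex \<Rightarrow> complex" where
  "qform a b c z = of_real a * z ^ 2 + of_real b * z + of_real c"

text \<open>The factor \<open>\<i>\<close> is dz/dy, so this is the contour integral from x to
  \<infinity>.\<close>

definition period :: "real \<Rightarrow> real \<Rightarrow> real \<Rightarrow> real \<Rightarrow> complex" where
  "period x a b c = integral {0<..}
     (\<lambda>y. \<i> * (eta_fun (of_real x + \<i> * of_real y) * qform a b c (of_real x + \<i> * of_real y) ^ 3))"

lemma qform_bound: "norm (qform a b c z) \<le> (\<bar>a\<bar> + \<bar>b\<bar> + \<bar>c\<bar>) * (1 + norm z) ^ 2"
proof -
  have "norm (qform a b c z) \<le> \<bar>a\<bar> * norm z ^ 2 + \<bar>b\<bar> * norm z + \<bar>c\<bar>"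
    unfolding qform_def by (rule order_trans[OF norm_triangle_ineq] add_mono | simp add: norm_mult norm_power)+
  also have "\<dots> \<le> \<bar>a\<bar> * (1 + norm z) ^ 2 + \<bar>b\<bar> * (1 + norm z) ^ 2 + \<bar>c\<bar> * (1 + norm z) ^ 2"
  proof (intro add_mono mult_left_mono)
    show "norm z ^ 2 \<le> (1 + norm z) ^ 2" by (intro power_mono) auto
    show "norm z \<le> (1 + norm z) ^ 2" by (simp add: power2_eq_square algebra_simps)
    have "1 \<le> (1 + norm z) ^ 2" by (intro one_le_power) auto
    then show "\<bar>c\<bar> \<le> \<bar>c\<bar> * (1 + norm z) ^ 2" by (simp add: mult_le_cancel_left1)
  qed auto
  finally show ?thesis by (simp add: algebra_simps)
qed

lemma continuous_on_eta_line:
  "continuous_on {0<..} (\<lambda>y. eta_fun (of_real x + \<i> * of_real y))"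
  by (rule continuous_on_compose2[OF holomorphic_on_imp_continuous_on[OF holomorphic_eta_fun]])
     (auto intro!: continuous_intros)

lemma period_integrable:
  assumes "x \<in> \<rat>"
  shows "(\<lambda>y. \<i> * (eta_fun (of_real x + \<i> * of_real y) * qform a b c (of_real x + \<i> * of_real y) ^ 3))
     absolutely_integrable_on {0<..}"
proof -
  obtain B k where B: "B > 0" "k > 0"
    "\<And>y. y > 0 \<Longrightarrow> norm (eta_fun (of_real x + \<i> * of_real y)) \<le> B * exp (- (k * (y + 1 / y)))"
    using eta_fun_line_bound[OF assms] by blast
  define m where "m = \<bar>a\<bar> + \<bar>b\<bar> + \<bar>c\<bar>"
  define h where "h = k / 2"
  have h: "h > 0" using B by (simp add: h_def)
  define M where "M = B * m ^ 3 * (fact 6 * exp (h * (1 + \<bar>x\<bar>)) / h ^ 6)"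
  show ?thesis
  proof (rule absolutely_integrable_exp_decay[OF _ h, of _ M])
    show "continuous_on {0<..} (\<lambda>y. \<i> * (eta_fun (of_real x + \<i> * of_real y) * qform a b c (of_real x + \<i> * of_real y) ^ 3))"
      unfolding qform_def by (intro continuous_intros continuous_on_eta_line)
    fix y :: real assume y: "y > 0"
    let ?z = "of_real x + \<i> * complex_of_real y"
    have "norm ?z \<le> \<bar>x\<bar> + y" by (rule order_trans[OF norm_triangle_ineq]) (use y in \<open>simp add: norm_mult\<close>)
    then have "(1 + norm ?z) ^ 2 \<le> (1 + \<bar>x\<bar> + y) ^ 2" by (intro power_mono) auto
    then have "m * (1 + norm ?z) ^ 2 \<le> m * (1 + \<bar>x\<bar> + y) ^ 2" by (intro mult_left_mono) (auto simp: m_def)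
    with qform_bound[of a b c ?z] have "norm (qform a b c ?z) \<le> m * (1 + \<bar>x\<bar> + y) ^ 2" by (simp add: m_def)
    then have "norm (qform a b c ?z) ^ 3 \<le> (m * (1 + \<bar>x\<bar> + y) ^ 2) ^ 3" by (intro power_mono) auto
    also have "\<dots> = m ^ 3 * (1 + \<bar>x\<bar> + y) ^ 6" by (simp add: power_mult_distrib flip: power_mult)
    also have "(1 + \<bar>x\<bar> + y) ^ 6 = (h * (1 + \<bar>x\<bar> + y)) ^ 6 / h ^ 6" using h by (simp add: power_mult_distrib)
    also have "m ^ 3 * \<dots> \<le> m ^ 3 * (fact 6 * exp (h * (1 + \<bar>x\<bar> + y)) / h ^ 6)"
      using h y by (intro mult_left_mono divide_right_mono pow_le_exp) (auto simp: m_def)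
    finally have q: "norm (qform a b c ?z) ^ 3 \<le> m ^ 3 * (fact 6 * exp (h * (1 + \<bar>x\<bar> + y)) / h ^ 6)" .
    have e: "norm (eta_fun ?z) \<le> B * exp (- (k * y))"
    proof -
      have "k * y \<le> k * (y + 1 / y)" using B y by (intro mult_left_mono) auto
      then have "B * exp (- (k * (y + 1 / y))) \<le> B * exp (- (k * y))" using B by (intro mult_left_mono) auto
      then show ?thesis using B(3)[OF y] by linarith
    qed
    have "norm (\<i> * (eta_fun ?z * qform a b c ?z ^ 3)) = norm (eta_fun ?z) * norm (qform a b c ?z) ^ 3"
      by (simp add: norm_mult norm_power)
    also have "\<dots> \<le> (B * exp (- (k * y))) * (m ^ 3 * (fact 6 * exp (h * (1 + \<bar>x\<bar> + y)) / h ^ 6))"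
      using e q B by (intro mult_mono) auto
    also have "\<dots> = M * (exp (- (k * y)) * exp (h * y))"
      unfolding M_def by (simp add: distrib_left exp_add)
    also have "exp (- (k * y)) * exp (h * y) = exp (- (h * y))"
      unfolding exp_add[symmetric] h_def by (simp add: field_simps)
    finally show "norm (\<i> * (eta_fun ?z * qform a b c ?z ^ 3)) \<le> M * exp (- (h * y))" .
  qed
qed

lemma period_shift: "period (x + 1) a b c = period x a (2 * a + b) (a + b + c)"
proof -
  have "eta_fun (of_real (x + 1) + \<i> * of_real y) = eta_fun (of_real x + \<i> * of_real y)" for y
    using eta_fun_plus_1[of "of_real x + \<i> * of_real y"] by (simp add: algebra_simps)
  moreover have "qform a b c (of_real (x + 1) + \<i> * of_real y) =
      qform a (2 * a + b) (a + b + c) (of_real x + \<i> * of_real y)" for y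
    by (simp add: qform_def power2_eq_square algebra_simps)
  ultimately show ?thesis by (simp add: period_def)
qed

lemma eta_fun_mirror:
  assumes "Im z > 0" shows "eta_fun (- cnj z) = cnj (eta_fun z)"
proof -
  have "exp (2 * of_real pi * \<i> * (- cnj z)) = cnj (exp (2 * of_real pi * \<i> * z))"
    by (simp add: exp_cnj)
  moreover have "eta_q (cnj q) = cnj (eta_q q)" if "norm q < 1" for q
  proof -
    have "(\<lambda>n. cnj (of_int (eta_coeff n) * q ^ n)) sums cnj (eta_q q)"
      using eta_q_sums[OF that] by (simp only: sums_cnj)
    then have "(\<lambda>n. of_int (eta_coeff n) * cnj q ^ n) sums cnj (eta_q q)" by simp
    moreover have "(\<lambda>n. of_int (eta_coeff n) * cnj q ^ n) sums eta_q (cnj q)"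
      using that by (intro eta_q_sums) simp
    ultimately show ?thesis using sums_unique2 by blast
  qed
  ultimately show ?thesis
    unfolding eta_fun_def using norm_exp_2pi_less[OF assms] by simp
qed

text \<open>The Fourier coefficients of f are real, and the minus sign stems from the factor
  \<open>\<i>\<close>. Hence the imaginary part obeys the reflection axiom without a sign.\<close>

lemma period_mirror: "period (- x) a b c = - cnj (period x a (- b) c)"
proof -
  have "\<i> * (eta_fun (of_real (- x) + \<i> * of_real y) * qform a b c (of_real (- x) + \<i> * of_real y) ^ 3) =
     - cnj (\<i> * (eta_fun (of_real x + \<i> * of_real y) * qform a (- b) c (of_real x + \<i> * of_real y) ^ 3))"
    if "y > 0" for y
  proof -
    have z: "of_real (- x) + \<i> * of_real y = - cnj (of_real x + \<i> * complex_of_real y)" by simp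
    have "eta_fun (of_real (- x) + \<i> * of_real y) = cnj (eta_fun (of_real x + \<i> * of_real y))"
      unfolding z by (rule eta_fun_mirror) (use that in simp)
    moreover have "qform a b c (of_real (- x) + \<i> * of_real y) = cnj (qform a (- b) c (of_real x + \<i> * of_real y))"
    proof -
      have "qform a b c (- cnj w) = cnj (qform a (- b) c w)" for w by (simp add: qform_def)
      then show ?thesis unfolding z .
    qed
    ultimately show ?thesis by simp
  qed
  then have "period (- x) a b c = integral {0<..}
     (\<lambda>y. - cnj (\<i> * (eta_fun (of_real x + \<i> * of_real y) * qform a (- b) c (of_real x + \<i> * of_real y) ^ 3)))"
    unfolding period_def by (intro integral_cong) auto
  also have "\<dots> = - cnj (period x a (- b) c)"
    unfolding period_def by (simp only: integral_neg integral_cnj)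
  finally show ?thesis .
qed

lemma period_uminus: "period x (- a) (- b) (- c) = - period x a b c"
proof -
  have "qform (- a) (- b) (- c) z = - qform a b c z" for z by (simp add: qform_def)
  then have "period x (- a) (- b) (- c) = integral {0<..}
     (\<lambda>y. - (\<i> * (eta_fun (of_real x + \<i> * of_real y) * qform a b c (of_real x + \<i> * of_real y) ^ 3)))"
    unfolding period_def by (intro integral_cong) simp
  also have "\<dots> = - period x a b c" unfolding period_def by (rule integral_neg)
  finally show ?thesis .
qed

section \<open>Changing the path of integration by means of a primitive\<close>

lemma eta_qform_primitive:
  "\<exists>F. \<forall>z. Im z > 0 \<longrightarrow> (F has_field_derivative (eta_fun z * qform a b c z ^ 3)) (at z)"
proof -
  have "(\<lambda>z. eta_fun z * qform a b c z ^ 3) holomorphic_on {z. Im z > 0}"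
    unfolding qform_def by (intro holomorphic_intros holomorphic_eta_fun)
  from holomorphic_convex_primitive'[OF convex_halfspace_Im_gt open_halfspace_Im_gt this]
  obtain F where F: "\<And>z. z \<in> {z. Im z > 0} \<Longrightarrow> (F has_field_derivative (eta_fun z * qform a b c z ^ 3)) (at z within {z. Im z > 0})"
    by blast
  have "(F has_field_derivative (eta_fun z * qform a b c z ^ 3)) (at z)" if "Im z > 0" for z
  proof -
    have "at z within {z. Im z > 0} = at z"
      by (rule at_within_open[OF _ open_halfspace_Im_gt]) (use that in simp)
    then show ?thesis using F[of z] that by (simp only: mem_Collect_eq)
  qed
  then show ?thesis by blast
qed

text \<open>The sequences are arbitrary because the inverted paths approach their ends at a speed of
  their own.\<close>

lemma period_primitive:
  assumes F: "\<And>z. Im z > 0 \<Longrightarrow> (F has_field_derivative (eta_fun z * qform a b c z ^ 3)) (at z)"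
    and x: "x \<in> \<rat>" and s: "\<And>n. s n > 0" "s \<longlonglongrightarrow> 0" and t: "filterlim t at_top sequentially"
  shows "(\<lambda>n. F (of_real x + \<i> * of_real (t n)) - F (of_real x + \<i> * of_real (s n))) \<longlonglongrightarrow> period x a b c"
proof -
  let ?g = "\<lambda>y. \<i> * (eta_fun (of_real x + \<i> * of_real y) * qform a b c (of_real x + \<i> * of_real y) ^ 3)"
  have "(\<lambda>n. integral {s n..t n} ?g) \<longlonglongrightarrow> period x a b c"
    unfolding period_def by (rule integral_truncation[OF period_integrable[OF x] s t])
  moreover have "\<forall>\<^sub>F n in sequentially. integral {s n..t n} ?g =
     F (of_real x + \<i> * of_real (t n)) - F (of_real x + \<i> * of_real (s n))"
  proof -
    have "\<forall>\<^sub>F n in sequentially. s n < 1" using order_tendstoD(2)[OF s(2)] by simp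
    moreover have "\<forall>\<^sub>F n in sequentially. t n \<ge> 1" using t by (simp add: filterlim_at_top)
    ultimately show ?thesis
    proof eventually_elim
      case (elim n)
      have "(?g has_integral (F (of_real x + \<i> * of_real (t n)) - F (of_real x + \<i> * of_real (s n)))) {s n..t n}"
      proof (rule fundamental_theorem_of_calculus)
        show "s n \<le> t n" using elim by simp
        fix y assume "y \<in> {s n..t n}"
        then have "y > 0" using s(1)[of n] by simp
        then have "(F has_field_derivative (eta_fun (of_real x + \<i> * of_real y) * qform a b c (of_real x + \<i> * of_real y) ^ 3))
           (at (of_real x + \<i> * of_real y))" by (intro F) simp
        moreover have "((\<lambda>y. of_real x + \<i> * complex_of_real y) has_vector_derivative \<i>) (at y within {s n..t n})"
          by (rule derivative_eq_intros refl has_vector_derivative_of_real | simp)+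
        ultimately have "((F \<circ> (\<lambda>y. of_real x + \<i> * complex_of_real y)) has_vector_derivative
            \<i> * (eta_fun (of_real x + \<i> * of_real y) * qform a b c (of_real x + \<i> * of_real y) ^ 3)) (at y within {s n..t n})"
          by (intro field_vector_diff_chain_within) (auto intro: has_field_derivative_at_within)
        then show "((\<lambda>y. F (of_real x + \<i> * of_real y)) has_vector_derivative ?g y) (at y within {s n..t n})"
          by (simp add: o_def)
      qed
      then show ?case by (rule integral_unique)
    qed
  qed
  ultimately show ?thesis by (rule Lim_transform_eventually)
qed

lemma primitive_segment_bound:
  assumes F: "\<And>z. Im z > 0 \<Longrightarrow> (F has_field_derivative f z) (at z)"
    and w: "Im w > 0" "Im z = Im w"
    and B: "\<And>v. Im v = Im w \<Longrightarrow> \<bar>Re v - Re w\<bar> \<le> \<bar>Re z - Re w\<bar> \<Longrightarrow> norm (f v) \<le> B"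
  shows "norm (F z - F w) \<le> B * \<bar>Re z - Re w\<bar>"
proof -
  have seg: "Im v = Im w \<and> \<bar>Re v - Re w\<bar> \<le> \<bar>Re z - Re w\<bar>" if "v \<in> closed_segment w z" for v
  proof -
    obtain u where u: "0 \<le> u" "u \<le> 1" "v = (1 - u) *\<^sub>R w + u *\<^sub>R z"
      using \<open>v \<in> closed_segment w z\<close> by (auto simp: closed_segment_def)
    have "Re v - Re w = u * (Re z - Re w)" unfolding u(3) by (simp add: algebra_simps)
    then have "\<bar>Re v - Re w\<bar> = u * \<bar>Re z - Re w\<bar>" using u by (simp add: abs_mult)
    also have "\<dots> \<le> 1 * \<bar>Re z - Re w\<bar>" using u by (intro mult_right_mono) auto
    finally have "\<bar>Re v - Re w\<bar> \<le> \<bar>Re z - Re w\<bar>" by simp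
    moreover have "Im v = Im w" unfolding u(3) using w by (simp add: algebra_simps)
    ultimately show ?thesis by blast
  qed
  have "norm (F z - F w) \<le> B * norm (z - w)"
  proof (rule field_differentiable_bound)
    show "convex (closed_segment w z)" by (rule convex_closed_segment)
    fix v assume "v \<in> closed_segment w z"
    from seg[OF this] show "(F has_field_derivative f v) (at v within closed_segment w z)" "norm (f v) \<le> B"
      using F[of v] B[of v] w by (auto intro: has_field_derivative_at_within)
  qed auto
  also have "norm (z - w) = \<bar>Re z - Re w\<bar>" using w by (simp add: cmod_def)
  finally show ?thesis .
qed

lemma eta_qform_bound:
  "norm (eta_fun v * qform a b c v ^ 3) \<le> norm (eta_fun v) * ((\<bar>a\<bar> + \<bar>b\<bar> + \<bar>c\<bar>) * (1 + norm v) ^ 2) ^ 3"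
  unfolding norm_mult norm_power by (intro mult_left_mono power_mono qform_bound) auto

text \<open>Inside the cone |z - x|^2 \<le> 2 y^2 for y = Im z, so the cusp estimate exp(-k/(2 y))
  outweighs y^(-4) and f stays bounded; the horizontal segment to the line over x has length at most
  y.\<close>

lemma primitive_cone_limit:
  assumes F: "\<And>z. Im z > 0 \<Longrightarrow> (F has_field_derivative (eta_fun z * qform a b c z ^ 3)) (at z)"
    and x: "x \<in> \<rat>"
    and z: "\<forall>\<^sub>F n in sequentially. Im (z n) > 0 \<and> \<bar>Re (z n) - x\<bar> \<le> Im (z n)" "(\<lambda>n. Im (z n)) \<longlonglongrightarrow> 0"
  shows "(\<lambda>n. F (z n) - F (of_real x + \<i> * of_real (Im (z n)))) \<longlonglongrightarrow> 0"
proof -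
  obtain C k where C: "C > 0" "k > 0" "\<And>z. Im z > 0 \<Longrightarrow> eta_h z \<le> C * exp (- (k * Im z / norm (z - of_real x) ^ 2))"
    using eta_h_decay_cusp[OF x] by blast
  define D where "D = C * (24 * (2 / k) ^ 4)"
  have eta: "norm (eta_fun v) \<le> D" if v: "Im v > 0" "\<bar>Re v - x\<bar> \<le> Im v" for v
  proof -
    define y where "y = Im v"
    have y: "y > 0" using v by (simp add: y_def)
    have "norm (v - of_real x) ^ 2 = \<bar>Re v - x\<bar> ^ 2 + y ^ 2" by (simp add: cmod_power2 y_def)
    also have "\<bar>Re v - x\<bar> ^ 2 \<le> y ^ 2" using v unfolding y_def by (intro power_mono) auto
    finally have n: "norm (v - of_real x) ^ 2 \<le> 2 * y ^ 2" by simp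
    have "v \<noteq> of_real x" using y by (auto simp: y_def)
    then have pos: "norm (v - of_real x) ^ 2 > 0" by simp
    have "k / 2 / y = k * y / (2 * y ^ 2)" using y by (simp add: power2_eq_square)
    also have "\<dots> \<le> k * y / norm (v - of_real x) ^ 2"
      using n pos C y by (intro divide_left_mono) auto
    finally have "exp (- (k * y / norm (v - of_real x) ^ 2)) \<le> exp (- (k / 2 / y))" by simp
    then have "C * exp (- (k * y / norm (v - of_real x) ^ 2)) \<le> C * exp (- (k / 2 / y))"
      using C by (intro mult_left_mono) auto
    then have h: "eta_h v \<le> C * exp (- (k / 2 / y))" using C(3)[OF v(1)] by (simp add: y_def)
    have "(k / 2 / y) ^ 4 \<le> 24 * exp (k / 2 / y)"
      using pow_le_exp[of "k / 2 / y" 4] C y by (simp add: fact_numeral)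
    then have "(2 / k) ^ 4 * (k / 2 / y) ^ 4 \<le> (2 / k) ^ 4 * (24 * exp (k / 2 / y))"
      using C by (intro mult_left_mono) auto
    also have "(2 / k) ^ 4 * (k / 2 / y) ^ 4 = 1 / y ^ 4" using C by (simp add: power_divide)
    finally have y4: "1 / y ^ 4 \<le> 24 * (2 / k) ^ 4 * exp (k / 2 / y)" by (simp add: mult_ac)
    have "norm (eta_fun v) = eta_h v * (1 / y ^ 4)" using y by (simp add: eta_h_def y_def)
    also have "\<dots> \<le> (C * exp (- (k / 2 / y))) * (24 * (2 / k) ^ 4 * exp (k / 2 / y))"
      using h y4 C y by (intro mult_mono) (auto simp: eta_h_def)
    also have "\<dots> = D * (exp (- (k / 2 / y)) * exp (k / 2 / y))" by (simp add: D_def mult_ac)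
    also have "\<dots> = D" by (simp flip: exp_add)
    finally show ?thesis .
  qed
  have D: "D > 0" using C by (simp add: D_def)
  define m where "m = \<bar>a\<bar> + \<bar>b\<bar> + \<bar>c\<bar>"
  define B where "B = D * (m * (3 + \<bar>x\<bar>) ^ 2) ^ 3"
  have "\<forall>\<^sub>F n in sequentially. Im (z n) < 1" using order_tendstoD(2)[OF z(2)] by simp
  with z(1) have "\<forall>\<^sub>F n in sequentially. norm (F (z n) - F (of_real x + \<i> * of_real (Im (z n)))) \<le> B * Im (z n)"
  proof eventually_elim
    case (elim n)
    let ?w = "of_real x + \<i> * complex_of_real (Im (z n))"
    have "norm (F (z n) - F ?w) \<le> B * \<bar>Re (z n) - Re ?w\<bar>"
    proof (rule primitive_segment_bound[OF F])
      fix v assume v: "Im v = Im ?w" "\<bar>Re v - Re ?w\<bar> \<le> \<bar>Re (z n) - Re ?w\<bar>"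
      then have v': "Im v > 0" "Im v < 1" "\<bar>Re v - x\<bar> \<le> Im v" using elim by auto
      have "norm v \<le> \<bar>Re v\<bar> + \<bar>Im v\<bar>" by (rule cmod_le)
      also have "\<dots> \<le> 2 + \<bar>x\<bar>" using v' by linarith
      finally have "1 + norm v \<le> 3 + \<bar>x\<bar>" by simp
      then have "(m * (1 + norm v) ^ 2) ^ 3 \<le> (m * (3 + \<bar>x\<bar>) ^ 2) ^ 3"
        by (intro power_mono mult_left_mono) (auto simp: m_def)
      then have "norm (eta_fun v) * (m * (1 + norm v) ^ 2) ^ 3 \<le> B"
        unfolding B_def using eta[OF v'(1,3)] D by (intro mult_mono) (auto simp: m_def)
      then show "norm (eta_fun v * qform a b c v ^ 3) \<le> B"
        using eta_qform_bound[of v a b c] unfolding m_def by linarith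
    qed (use elim in auto)
    also have "\<dots> \<le> B * Im (z n)"
      using elim D by (intro mult_left_mono) (auto simp: B_def m_def)
    finally show ?case .
  qed
  moreover have "(\<lambda>n. B * Im (z n)) \<longlonglongrightarrow> 0" by (intro tendsto_mult_right_zero z)
  ultimately show ?thesis by (rule Lim_null_comparison)
qed

lemma primitive_infinity_limit:
  assumes F: "\<And>z. Im z > 0 \<Longrightarrow> (F has_field_derivative (eta_fun z * qform a b c z ^ 3)) (at z)"
  shows "(\<lambda>n. F (of_real x + \<i> * of_real (real n)) - F (of_real 0 + \<i> * of_real (real n))) \<longlonglongrightarrow> 0"
proof -
  obtain C where C: "C > 0" "\<And>z. Im z > 0 \<Longrightarrow> eta_h z \<le> C * exp (- Im z)"
    using eta_h_decay_infinity by blast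
  define m where "m = \<bar>a\<bar> + \<bar>b\<bar> + \<bar>c\<bar>"
  define r where "r = 1 + \<bar>x\<bar>"
  define B where "B = (\<lambda>n. C * exp (- real n) * (m * (r + real n) ^ 2) ^ 3 * \<bar>x\<bar>)"
  have "\<forall>\<^sub>F n in sequentially. norm (F (of_real x + \<i> * of_real (real n)) - F (of_real 0 + \<i> * of_real (real n))) \<le> B n"
    using eventually_ge_at_top[of 1]
  proof eventually_elim
    case (elim n)
    let ?z = "of_real x + \<i> * complex_of_real (real n)" and ?w = "of_real 0 + \<i> * complex_of_real (real n)"
    have "norm (F ?z - F ?w) \<le> (C * exp (- real n) * (m * (r + real n) ^ 2) ^ 3) * \<bar>Re ?z - Re ?w\<bar>"
    proof (rule primitive_segment_bound[OF F])
      fix v assume v: "Im v = Im ?w" "\<bar>Re v - Re ?w\<bar> \<le> \<bar>Re ?z - Re ?w\<bar>"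
      then have v': "Im v = real n" "\<bar>Re v\<bar> \<le> \<bar>x\<bar>" "Im v > 0" using elim by auto
      have "norm (eta_fun v) \<le> C * exp (- real n)"
      proof -
        have "norm (eta_fun v) \<le> Im v ^ 4 * norm (eta_fun v)"
          using elim v' by (simp add: mult_le_cancel_right1 one_le_power)
        also have "\<dots> \<le> C * exp (- Im v)" using C(2)[OF v'(3)] by (simp add: eta_h_def)
        finally show ?thesis using v' by simp
      qed
      moreover have "(m * (1 + norm v) ^ 2) ^ 3 \<le> (m * (r + real n) ^ 2) ^ 3"
        using cmod_le[of v] v' by (intro power_mono mult_left_mono) (auto simp: m_def r_def)
      ultimately have "norm (eta_fun v) * (m * (1 + norm v) ^ 2) ^ 3 \<le> C * exp (- real n) * (m * (r + real n) ^ 2) ^ 3"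
        using C(1) by (intro mult_mono) (auto simp: m_def)
      then show "norm (eta_fun v * qform a b c v ^ 3) \<le> C * exp (- real n) * (m * (r + real n) ^ 2) ^ 3"
        using eta_qform_bound[of v a b c] unfolding m_def by linarith
    qed (use elim in auto)
    then show ?case by (simp add: B_def)
  qed
  moreover have "B \<longlonglongrightarrow> 0"
  proof -
    have "(\<lambda>n. exp (- real n) * (r + real n) ^ 6) \<longlonglongrightarrow> 0" by real_asymp
    then have "(\<lambda>n. (C * m ^ 3 * \<bar>x\<bar>) * (exp (- real n) * (r + real n) ^ 6)) \<longlonglongrightarrow> (C * m ^ 3 * \<bar>x\<bar>) * 0"
      by (intro tendsto_intros)
    moreover have "B = (\<lambda>n. (C * m ^ 3 * \<bar>x\<bar>) * (exp (- real n) * (r + real n) ^ 6))"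
      by (rule ext) (simp add: B_def power_mult_distrib flip: power_mult)
    ultimately show ?thesis by simp
  qed
  ultimately show ?thesis by (rule Lim_null_comparison)
qed

lemma qform_invert:
  assumes "z \<noteq> 0"
  shows "2 * z ^ 2 * qform a b c (- 1 / (2 * z)) = qform (2 * c) (- b) (a / 2) z"
  using assms by (simp add: qform_def field_simps power2_eq_square)

text \<open>The weights fit: 16 z^8 times the derivative 1/(2 z^2) is (2 z^2)^3, just what the cube
  of the transformed form absorbs.\<close>

lemma primitive_invert:
  assumes F: "\<And>z. Im z > 0 \<Longrightarrow> (F has_field_derivative (eta_fun z * qform a b c z ^ 3)) (at z)"
    and z: "Im z > 0"
  shows "((\<lambda>z. F (- 1 / (2 * z))) has_field_derivative (eta_fun z * qform (2 * c) (- b) (a / 2) z ^ 3)) (at z)"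
proof -
  have nz: "z \<noteq> 0" using z by auto
  then have "Im (- 1 / (2 * z)) > 0" unfolding Im_invert using z by simp
  from F[OF this] have "(F has_field_derivative (16 * z ^ 8 * eta_fun z * qform a b c (- 1 / (2 * z)) ^ 3)) (at (- 1 / (2 * z)))"
    unfolding eta_fun_invert[OF z] .
  moreover have "((\<lambda>z. - 1 / (2 * z)) has_field_derivative (1 / (2 * z ^ 2))) (at z)"
    using nz by (auto intro!: derivative_eq_intros simp: field_simps power2_eq_square)
  ultimately have "((\<lambda>z. F (- 1 / (2 * z))) has_field_derivative
      (16 * z ^ 8 * eta_fun z * qform a b c (- 1 / (2 * z)) ^ 3) * (1 / (2 * z ^ 2))) (at z)"
    by (rule DERIV_chain2)
  moreover have "(16 * z ^ 8 * eta_fun z * qform a b c (- 1 / (2 * z)) ^ 3) * (1 / (2 * z ^ 2)) =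
     eta_fun z * (2 * z ^ 2 * qform a b c (- 1 / (2 * z))) ^ 3"
    using nz by (simp add: power_mult_distrib field_simps eval_nat_numeral)
  ultimately show ?thesis unfolding qform_invert[OF nz] by simp
qed

text \<open>The inversion reverses the imaginary axis.\<close>

lemma period_0_invert: "period 0 (2 * c) (- b) (a / 2) = - period 0 a b c"
proof -
  obtain F where F: "\<And>z. Im z > 0 \<Longrightarrow> (F has_field_derivative (eta_fun z * qform a b c z ^ 3)) (at z)"
    using eta_qform_primitive[of a b c] by blast
  have e: "- 1 / (2 * (of_real 0 + \<i> * complex_of_real y)) = of_real 0 + \<i> * of_real (1 / (2 * y))" for y
    by (cases "y = 0") (simp_all add: field_simps)
  have t0: "(\<lambda>n. 1 / (2 * (real n + 1))) \<longlonglongrightarrow> 0" "(\<lambda>n. 1 / (real n + 1)) \<longlonglongrightarrow> 0" by real_asymp+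
  have ti: "filterlim (\<lambda>n. real n + 1) at_top sequentially" "filterlim (\<lambda>n. (real n + 1) / 2) at_top sequentially"
    by real_asymp+
  have 1: "(\<lambda>n. F (of_real 0 + \<i> * of_real (1 / (2 * (real n + 1)))) - F (of_real 0 + \<i> * of_real ((real n + 1) / 2)))
     \<longlonglongrightarrow> period 0 (2 * c) (- b) (a / 2)"
    using period_primitive[OF primitive_invert[OF F], of 0 "\<lambda>n. 1 / (real n + 1)" "\<lambda>n. real n + 1"] t0 ti
    unfolding e by simp
  have 2: "(\<lambda>n. F (of_real 0 + \<i> * of_real ((real n + 1) / 2)) - F (of_real 0 + \<i> * of_real (1 / (2 * (real n + 1)))))
     \<longlonglongrightarrow> period 0 a b c"
    using period_primitive[OF F, of 0 "\<lambda>n. 1 / (2 * (real n + 1))" "\<lambda>n. (real n + 1) / 2"] t0 ti by simp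
  from tendsto_minus[OF 2] 1 show ?thesis by (simp add: LIMSEQ_unique)
qed

lemma Re_invert: "Re (- 1 / (2 * z)) = - Re z / (2 * norm z ^ 2)"
  by (subst complex_div_cnj) (simp add: norm_mult power_mult_distrib)

text \<open>The inversion takes the line over w = -1/(2 x) to an arc from x to 0. Its ends u and v
  enter these cusps inside cones, so \<open>primitive_cone_limit\<close> replaces them by points of
  the lines over x and over 0; those lines are joined at \<infinity>.\<close>

lemma period_invert:
  assumes x: "x \<in> \<rat>" "x \<noteq> 0"
  shows "period x a b c = period 0 a b c + period (- 1 / (2 * x)) (2 * c) (- b) (a / 2)"
proof -
  obtain F where F: "\<And>z. Im z > 0 \<Longrightarrow> (F has_field_derivative (eta_fun z * qform a b c z ^ 3)) (at z)"
    using eta_qform_primitive[of a b c] by blast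
  define w where "w = - 1 / (2 * x)"
  have w: "w \<in> \<rat>" "w \<noteq> 0" "x = - 1 / (2 * w)" using x by (auto simp: w_def)
  define u v where "u = (\<lambda>n::nat. - 1 / (2 * (of_real w + \<i> * complex_of_real (1 / (real n + 1)))))"
    and "v = (\<lambda>n::nat. - 1 / (2 * (of_real w + \<i> * complex_of_real (real n + 1))))"
  have uv: "Re (- 1 / (2 * (of_real w + \<i> * complex_of_real y))) = - w / (2 * (w ^ 2 + y ^ 2))"
    "Im (- 1 / (2 * (of_real w + \<i> * complex_of_real y))) = y / (2 * (w ^ 2 + y ^ 2))" for y
  proof -
    have "norm (of_real w + \<i> * complex_of_real y) ^ 2 = w ^ 2 + y ^ 2" by (simp add: cmod_power2)
    then show "Re (- 1 / (2 * (of_real w + \<i> * complex_of_real y))) = - w / (2 * (w ^ 2 + y ^ 2))"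
      "Im (- 1 / (2 * (of_real w + \<i> * complex_of_real y))) = y / (2 * (w ^ 2 + y ^ 2))"
      using Im_invert[of "of_real w + \<i> * complex_of_real y"] Re_invert[of "of_real w + \<i> * complex_of_real y"]
      by simp_all
  qed
  have pos: "w ^ 2 + y ^ 2 > 0" for y using w by (simp add: add_pos_nonneg)
  have t0: "(\<lambda>n. 1 / (real n + 1)) \<longlonglongrightarrow> 0" by real_asymp
  have ti: "filterlim (\<lambda>n. real n + 1) at_top sequentially" "filterlim (\<lambda>n. real n) at_top sequentially" by real_asymp+
  have G: "(\<lambda>n. F (v n) - F (u n)) \<longlonglongrightarrow> period w (2 * c) (- b) (a / 2)"
    using period_primitive[OF primitive_invert[OF F] w(1), of "\<lambda>n. 1 / (real n + 1)" "\<lambda>n. real n + 1"] t0 ti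
    unfolding u_def v_def by simp
  have ulim: "(\<lambda>n. Im (u n)) \<longlonglongrightarrow> 0"
  proof -
    have "(\<lambda>n. (1 / (real n + 1)) / (2 * (w ^ 2 + (1 / (real n + 1)) ^ 2))) \<longlonglongrightarrow> 0 / (2 * (w ^ 2 + 0 ^ 2))"
      by (intro tendsto_intros t0) (use w in auto)
    then show ?thesis unfolding u_def uv by simp
  qed
  have vlim: "(\<lambda>n. Im (v n)) \<longlonglongrightarrow> 0"
  proof (rule tendsto_sandwich[OF always_eventually always_eventually tendsto_const t0]; intro allI)
    fix n
    have "(real n + 1) / (2 * (w ^ 2 + (real n + 1) ^ 2)) \<le> (real n + 1) / ((real n + 1) ^ 2)"
      using pos[of "real n + 1"] by (intro divide_left_mono) (auto simp: add_increasing)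
    then show "Im (v n) \<le> 1 / (real n + 1)" unfolding v_def uv by (simp add: power2_eq_square)
    show "0 \<le> Im (v n)" unfolding v_def uv using pos[of "real n + 1"] by simp
  qed
  have ucone: "\<forall>\<^sub>F n in sequentially. Im (u n) > 0 \<and> \<bar>Re (u n) - x\<bar> \<le> Im (u n)"
  proof -
    have "\<forall>\<^sub>F n in sequentially. 1 / (real n + 1) < \<bar>w\<bar>"
      using order_tendstoD(2)[OF t0, of "\<bar>w\<bar>"] w by simp
    then show ?thesis
    proof eventually_elim
      case (elim n)
      define y where "y = 1 / (real n + 1)"
      have y: "y > 0" "y < \<bar>w\<bar>" using elim by (auto simp: y_def)
      have "- w / (2 * (w ^ 2 + y ^ 2)) - - 1 / (2 * w) = (y / w) * (y / (2 * (w ^ 2 + y ^ 2)))"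
        using w pos[of y] by (simp add: field_simps power2_eq_square)
      then have "\<bar>- w / (2 * (w ^ 2 + y ^ 2)) - - 1 / (2 * w)\<bar> = (y / \<bar>w\<bar>) * (y / (2 * (w ^ 2 + y ^ 2)))"
        using y pos[of y] by (simp add: abs_mult)
      also have "\<dots> \<le> 1 * (y / (2 * (w ^ 2 + y ^ 2)))"
        using y pos[of y] by (intro mult_right_mono) auto
      finally show ?case unfolding u_def uv w(3) y_def[symmetric] using y pos[of y] by simp
    qed
  qed
  have vcone: "\<forall>\<^sub>F n in sequentially. Im (v n) > 0 \<and> \<bar>Re (v n) - 0\<bar> \<le> Im (v n)"
  proof -
    have "\<forall>\<^sub>F n in sequentially. real n + 1 \<ge> \<bar>w\<bar>" using ti(1) by (simp add: filterlim_at_top)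
    then show ?thesis
    proof eventually_elim
      case (elim n)
      show ?case unfolding v_def uv using elim pos[of "real n + 1"]
        by (simp add: divide_right_mono)
    qed
  qed
  note lu = primitive_cone_limit[OF F x(1) ucone ulim]
  have lv: "(\<lambda>n. F (v n) - F (of_real 0 + \<i> * of_real (Im (v n)))) \<longlonglongrightarrow> 0"
    by (rule primitive_cone_limit[OF F Rats_0 vcone vlim])
  have upos: "Im (u n) > 0" "Im (v n) > 0" for n
    unfolding u_def v_def uv using pos[of "1 / (real n + 1)"] pos[of "real n + 1"] by simp_all
  have px: "(\<lambda>n. F (of_real x + \<i> * of_real (real n)) - F (of_real x + \<i> * of_real (Im (u n)))) \<longlonglongrightarrow> period x a b c"
    by (rule period_primitive[OF F x(1) upos(1) ulim ti(2)])
  have p0: "(\<lambda>n. F (of_real 0 + \<i> * of_real (real n)) - F (of_real 0 + \<i> * of_real (Im (v n)))) \<longlonglongrightarrow> period 0 a b c"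
    by (rule period_primitive[OF F Rats_0 upos(2) vlim ti(2)])
  have inf: "(\<lambda>n. F (of_real x + \<i> * of_real (real n)) - F (of_real 0 + \<i> * of_real (real n))) \<longlonglongrightarrow> 0"
    by (rule primitive_infinity_limit[OF F])
  \<comment> \<open>Signs chosen so that everything except F(v n) - F(u n) cancels.\<close>
  have "(\<lambda>n. (F (of_real x + \<i> * of_real (real n)) - F (of_real x + \<i> * of_real (Im (u n))))
      - (F (of_real 0 + \<i> * of_real (real n)) - F (of_real 0 + \<i> * of_real (Im (v n))))
      - (F (of_real x + \<i> * of_real (real n)) - F (of_real 0 + \<i> * of_real (real n)))
      + (F (v n) - F (of_real 0 + \<i> * of_real (Im (v n))))
      - (F (u n) - F (of_real x + \<i> * of_real (Im (u n))))) \<longlonglongrightarrow> period x a b c - period 0 a b c - 0 + 0 - 0"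
    by (intro tendsto_intros px p0 inf lu lv)
  then have "(\<lambda>n. F (v n) - F (u n)) \<longlonglongrightarrow> period x a b c - period 0 a b c"
    by (simp add: algebra_simps)
  from LIMSEQ_unique[OF this G] show ?thesis by (simp add: w_def algebra_simps)
qed

section \<open>Moments of the form on the imaginary axis\<close>

definition axis_moment :: "nat \<Rightarrow> real" where
  "axis_moment n = integral {0<..} (\<lambda>y. Re (eta_fun (\<i> * of_real y)) * y ^ n)"

lemma axis_moment_integrable: "(\<lambda>y. Re (eta_fun (\<i> * of_real y)) * y ^ n) integrable_on {0<..}"
proof -
  obtain B k where B: "B > 0" "k > 0"
    "\<And>y. y > 0 \<Longrightarrow> norm (eta_fun (of_real 0 + \<i> * of_real y)) \<le> B * exp (- (k * (y + 1 / y)))"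
    using eta_fun_line_bound[OF Rats_0] by blast
  define h where "h = k / 2"
  have h: "h > 0" using B by (simp add: h_def)
  have "(\<lambda>y. eta_fun (of_real 0 + \<i> * of_real y) * of_real y ^ n) absolutely_integrable_on {0<..}"
  proof (rule absolutely_integrable_exp_decay[OF _ h])
    show "continuous_on {0<..} (\<lambda>y. eta_fun (of_real 0 + \<i> * of_real y) * of_real y ^ n)"
      by (intro continuous_intros continuous_on_eta_line)
    fix y :: real assume y: "y > 0"
    have "k * y \<le> k * (y + 1 / y)" using B y by (intro mult_left_mono) auto
    then have "B * exp (- (k * (y + 1 / y))) \<le> B * exp (- (k * y))" using B by (intro mult_left_mono) auto
    then have e: "norm (eta_fun (of_real 0 + \<i> * of_real y)) \<le> B * exp (- (k * y))" using B(3)[OF y] by linarith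
    have "y ^ n = (h * y) ^ n / h ^ n" using h by (simp add: power_mult_distrib)
    also have "\<dots> \<le> fact n * exp (h * y) / h ^ n"
      using h y by (intro divide_right_mono pow_le_exp) auto
    finally have "norm (eta_fun (of_real 0 + \<i> * of_real y)) * y ^ n \<le> (B * exp (- (k * y))) * (fact n * exp (h * y) / h ^ n)"
      using e y B by (intro mult_mono) auto
    also have "\<dots> = (B * fact n / h ^ n) * (exp (- (k * y)) * exp (h * y))" by simp
    also have "exp (- (k * y)) * exp (h * y) = exp (- (h * y))"
      unfolding exp_add[symmetric] h_def by (simp add: field_simps)
    finally show "norm (eta_fun (of_real 0 + \<i> * of_real y) * of_real y ^ n) \<le> (B * fact n / h ^ n) * exp (- (h * y))"
      using y by (simp add: norm_mult norm_power)
  qed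
  then have "(\<lambda>y. eta_fun (\<i> * of_real y) * of_real y ^ n) integrable_on {0<..}"
    by (simp add: absolutely_integrable_on_def)
  from integrable_linear[OF this bounded_linear_Re] show ?thesis
    by (simp add: o_def flip: of_real_power)
qed

text \<open>On the axis f is real and the form is (c - a y^2) + i b y; the real part of its cube
  contains even powers of y only.\<close>

lemma Im_period_0:
  "Im (period 0 a b c) = c ^ 3 * axis_moment 0 - (3 * a * c ^ 2 + 3 * b ^ 2 * c) * axis_moment 2
     + (3 * a ^ 2 * c + 3 * a * b ^ 2) * axis_moment 4 - a ^ 3 * axis_moment 6"
proof -
  let ?f = "\<lambda>y. Re (eta_fun (\<i> * complex_of_real y))"
  have int: "(\<lambda>y. \<i> * (eta_fun (of_real 0 + \<i> * of_real y) * qform a b c (of_real 0 + \<i> * of_real y) ^ 3)) integrable_on {0<..}"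
    using period_integrable[OF Rats_0, of a b c] by (simp add: absolutely_integrable_on_def)
  have "Im (period 0 a b c) = integral {0<..}
     (\<lambda>y. Im (\<i> * (eta_fun (of_real 0 + \<i> * of_real y) * qform a b c (of_real 0 + \<i> * of_real y) ^ 3)))"
    unfolding period_def using integral_linear[OF int bounded_linear_Im] by (simp only: o_def)
  also have "\<dots> = integral {0<..} (\<lambda>y. c ^ 3 * (?f y * y ^ 0) - (3 * a * c ^ 2 + 3 * b ^ 2 * c) * (?f y * y ^ 2)
     + (3 * a ^ 2 * c + 3 * a * b ^ 2) * (?f y * y ^ 4) - a ^ 3 * (?f y * y ^ 6))"
  proof (rule integral_cong)
    fix y :: real assume "y \<in> {0<..}"
    then have "Im (eta_fun (\<i> * of_real y)) = 0" using eta_fun_axis_pos by simp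
    then have f: "eta_fun (\<i> * of_real y) = of_real (?f y)" by (simp add: complex_eq_iff)
    have q: "qform a b c (of_real 0 + \<i> * of_real y) = Complex (c - a * y ^ 2) (b * y)"
      by (simp add: qform_def complex_eq_iff power2_eq_square)
    have r: "Re (Complex u v ^ 3) = u ^ 3 - 3 * u * v ^ 2" for u v
      by (simp add: power3_eq_cube power2_eq_square algebra_simps)
    have "Im (\<i> * (eta_fun (of_real 0 + \<i> * of_real y) * qform a b c (of_real 0 + \<i> * of_real y) ^ 3)) =
       ?f y * Re (Complex (c - a * y ^ 2) (b * y) ^ 3)"
      unfolding q by (simp only: of_real_0 add_0) (subst f, simp)
    also have "\<dots> = c ^ 3 * (?f y * y ^ 0) - (3 * a * c ^ 2 + 3 * b ^ 2 * c) * (?f y * y ^ 2)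
     + (3 * a ^ 2 * c + 3 * a * b ^ 2) * (?f y * y ^ 4) - a ^ 3 * (?f y * y ^ 6)"
      unfolding r by (simp add: eval_nat_numeral algebra_simps)
    finally show "Im (\<i> * (eta_fun (of_real 0 + \<i> * of_real y) * qform a b c (of_real 0 + \<i> * of_real y) ^ 3)) =
      c ^ 3 * (?f y * y ^ 0) - (3 * a * c ^ 2 + 3 * b ^ 2 * c) * (?f y * y ^ 2)
     + (3 * a ^ 2 * c + 3 * a * b ^ 2) * (?f y * y ^ 4) - a ^ 3 * (?f y * y ^ 6)" .
  qed
  also have "\<dots> = c ^ 3 * axis_moment 0 - (3 * a * c ^ 2 + 3 * b ^ 2 * c) * axis_moment 2
     + (3 * a ^ 2 * c + 3 * a * b ^ 2) * axis_moment 4 - a ^ 3 * axis_moment 6"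
  proof -
    have s: "((\<lambda>y. d * (?f y * y ^ n)) has_integral (d * axis_moment n)) {0<..}" for d n
      unfolding axis_moment_def
      by (intro has_integral_mult_right integrable_integral axis_moment_integrable)
    show ?thesis
      by (rule integral_unique, intro has_integral_add has_integral_diff s)
  qed
  finally show ?thesis .
qed

text \<open>Two cases of \<open>period_0_invert\<close>, for the constant form 1 and for z +
  1.\<close>

lemma axis_moment_relations: "axis_moment 6 = axis_moment 0 / 8" "axis_moment 4 = axis_moment 2 / 2"
proof -
  have 1: "Im (period 0 2 0 0) = - Im (period 0 0 0 1)"
    using period_0_invert[of 1 0 0] by simp
  have 2: "Im (period 0 2 (- 1) 0) = - Im (period 0 0 1 1)"
    using period_0_invert[of 1 1 0] by simp
  show "axis_moment 6 = axis_moment 0 / 8" "axis_moment 4 = axis_moment 2 / 2"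
    using 1 2 unfolding Im_period_0 by simp_all
qed

lemma axis_moment_2_pos: "axis_moment 2 > 0"
proof -
  let ?g = "\<lambda>y. Re (eta_fun (\<i> * of_real y)) * y ^ 2"
  have pos: "?g y > 0" if "y > 0" for y using eta_fun_axis_pos[OF that] that by simp
  have "continuous_on {1..2} (\<lambda>y. eta_fun (of_real 0 + \<i> * of_real y))"
    by (rule continuous_on_subset[OF continuous_on_eta_line]) auto
  then have cont: "continuous_on {1..2} ?g" by (intro continuous_intros) simp
  obtain y0 where y0: "y0 \<in> {1..2}" "\<And>y. y \<in> {1..2} \<Longrightarrow> ?g y0 \<le> ?g y"
    using continuous_attains_inf[OF compact_Icc _ cont] by auto
  have int: "?g integrable_on {0<..}" by (rule axis_moment_integrable)
  have int2: "?g integrable_on {1..2}" by (rule integrable_on_subinterval[OF int]) auto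
  have "0 < ?g y0" using pos[of y0] y0 by simp
  also have "?g y0 = integral {1..2} (\<lambda>y::real. ?g y0)" by simp
  also have "\<dots> \<le> integral {1..2} ?g"
    using y0 int2 by (intro integral_le) auto
  also have "\<dots> \<le> integral {0<..} ?g"
    by (intro integral_subset_le int int2) (use pos in \<open>auto intro: less_imp_le\<close>)
  finally show ?thesis by (simp add: axis_moment_def)
qed

context odd_residue_character
begin

text \<open>The second moment carries a minus sign because (i y)^2 = -y^2.\<close>

lemma period_cocycle_Im_period:
  "period_cocycle p chi (\<lambda>x a b c. Im (period x a b c)) (axis_moment 0) (- axis_moment 2)"
proof unfold_locales
  fix x a b c :: real
  show "Im (period (x + 1) a b c) = Im (period x a (2 * a + b) (a + b + c))" by (simp only: period_shift)
  show "Im (period (- x) a b c) = Im (period x a (- b) c)" by (simp add: period_mirror)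
  show "Im (period x (- a) (- b) (- c)) = - Im (period x a b c)" by (simp add: period_uminus)
  show "Im (period 0 a b c) = axis_moment 0 * (c ^ 3 - (a / 2) ^ 3) + 3 * - axis_moment 2 * (c - a / 2) * (a * c + b ^ 2)"
    unfolding Im_period_0 axis_moment_relations by (simp add: field_simps eval_nat_numeral)
  show "Im (period x a b c) = Im (period 0 a b c) + Im (period (- 1 / (2 * x)) (2 * c) (- b) (a / 2))"
    if "x \<in> \<rat>" "x \<noteq> 0" using period_invert[OF that, of a b c] by simp
qed

end

section \<open>The twisted L-function\<close>

text \<open>Dyadic blocks: by the mean square bound, block K contributes at most a constant times
  2^(-\<delta> K).\<close>

lemma eta_coeff_square_summable:
  assumes "\<delta> > 0"
  shows "summable (\<lambda>n. real_of_int (eta_coeff n) ^ 2 * real n powr (- (8 + \<delta>)))"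
proof -
  obtain A where A: "A > 0" "\<And>N. N > 0 \<Longrightarrow> (\<Sum>n\<le>N. real_of_int (eta_coeff n) ^ 2) \<le> A * real N ^ 8"
    using eta_coeff_square_sum by blast
  define f where "f = (\<lambda>n. real_of_int (eta_coeff n) ^ 2 * real n powr (- (8 + \<delta>)))"
  define r where "r = 2 powr (- \<delta>)"
  have r: "0 < r" "r < 1" using assms by (auto simp: r_def powr_less_one)
  have f0: "f n \<ge> 0" for n by (simp add: f_def)
  have block: "sum f {2 ^ K..<2 ^ Suc K} \<le> A * 2 ^ 8 * r ^ K" for K
  proof -
    have "sum f {2 ^ K..<2 ^ Suc K} \<le> (\<Sum>n\<in>{2 ^ K..<2 ^ Suc K}. real_of_int (eta_coeff n) ^ 2 * (2 ^ K) powr (- (8 + \<delta>)))"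
      unfolding f_def
    proof (intro sum_mono mult_left_mono)
      fix n :: nat assume "n \<in> {2 ^ K..<2 ^ Suc K}"
      then have "real (2 ^ K) \<le> real n" by (simp only: of_nat_le_iff atLeastLessThan_iff)
      then show "real n powr (- (8 + \<delta>)) \<le> (2 ^ K) powr (- (8 + \<delta>))"
        using assms by (intro powr_mono2') auto
    qed auto
    also have "\<dots> = (\<Sum>n\<in>{2 ^ K..<2 ^ Suc K}. real_of_int (eta_coeff n) ^ 2) * (2 ^ K) powr (- (8 + \<delta>))"
      by (simp only: sum_distrib_right)
    also have "\<dots> \<le> (\<Sum>n\<le>2 ^ Suc K. real_of_int (eta_coeff n) ^ 2) * (2 ^ K) powr (- (8 + \<delta>))"
      by (intro mult_right_mono sum_mono2) auto
    also have "\<dots> \<le> (A * real (2 ^ Suc K) ^ 8) * (2 ^ K) powr (- (8 + \<delta>))"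
      by (intro mult_right_mono A(2)) auto
    also have "\<dots> = A * 2 ^ 8 * ((2 ^ K) ^ 8 * (2 ^ K) powr (- (8 + \<delta>)))"
      by (simp add: power_mult_distrib)
    also have "(2 ^ K) ^ 8 * (2 ^ K) powr (- (8 + \<delta>)) = (2 ^ K :: real) powr (- \<delta>)"
    proof -
      have "t ^ 8 * t powr (- (8 + \<delta>)) = t powr (- \<delta>)" if "t > 0" for t :: real
      proof -
        have "t ^ 8 = t powr 8" using that by simp
        then have "t ^ 8 * t powr (- (8 + \<delta>)) = t powr (8 + - (8 + \<delta>))" by (simp only: powr_add)
        then show ?thesis by simp
      qed
      then show ?thesis by simp
    qed
    also have "(2 ^ K :: real) powr (- \<delta>) = r ^ K"
      unfolding r_def by (induction K) (simp_all only: power_0 power_Suc powr_one_eq_one powr_mult)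
    finally show ?thesis .
  qed
  have part: "sum f {..<2 ^ K} \<le> A * 2 ^ 8 * (\<Sum>k<K. r ^ k)" for K
  proof (induction K)
    case 0
    \<comment> \<open>The only term is n = 0, where the power \<open>0 powr\<close> is 0 by
      convention.\<close>
    have "{..<2 ^ 0 :: nat} = {0}" by auto
    then show ?case by (simp add: f_def)
  next
    case (Suc K)
    have "{..<2 ^ Suc K} = {..<2 ^ K} \<union> {2 ^ K..<2 ^ Suc K :: nat}"
      by (rule ivl_disj_un_one(2)[symmetric]) simp
    moreover have "sum f ({..<2 ^ K} \<union> {2 ^ K..<2 ^ Suc K}) = sum f {..<2 ^ K} + sum f {2 ^ K..<2 ^ Suc K}"
      by (rule sum.union_disjoint) auto
    ultimately have "sum f {..<2 ^ Suc K} = sum f {..<2 ^ K} + sum f {2 ^ K..<2 ^ Suc K}" by (simp only:)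
    also have "\<dots> \<le> A * 2 ^ 8 * (\<Sum>k<K. r ^ k) + A * 2 ^ 8 * r ^ K" by (intro add_mono Suc block)
    finally show ?case by (simp add: distrib_left)
  qed
  have geo: "(\<Sum>k<K. r ^ k) \<le> 1 / (1 - r)" for K
    using r sum_le_suminf[of "\<lambda>k. r ^ k" "{..<K}"] by (simp add: summable_geometric suminf_geometric)
  have "summable f"
  proof (rule summableI_nonneg_bounded[OF f0])
    fix n
    have "n < 2 ^ n" by (rule less_exp)
    then have "sum f {..<n} \<le> sum f {..<2 ^ n}" using f0 by (intro sum_mono2) auto
    also have "\<dots> \<le> A * 2 ^ 8 * (\<Sum>k<n. r ^ k)" by (rule part)
    also have "\<dots> \<le> A * 2 ^ 8 * (1 / (1 - r))" using A geo by (intro mult_left_mono) auto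
    finally show "sum f {..<n} \<le> A * 2 ^ 8 * (1 / (1 - r))" .
  qed
  then show ?thesis by (simp add: f_def)
qed

text \<open>Follows from x y \<le> x^2 + y^2 with \<sigma> = (8 + \<delta>)/2 + (1 + \<delta>)/2.
  The abscissa 9/2 is Re s = 1 after the shift by 7/2.\<close>

lemma eta_coeff_dirichlet_summable:
  assumes "\<sigma> > 9 / 2"
  shows "summable (\<lambda>n. \<bar>real_of_int (eta_coeff n)\<bar> * real n powr (- \<sigma>))"
proof (rule summable_comparison_test')
  define \<delta> where "\<delta> = \<sigma> - 9 / 2"
  have d: "\<delta> > 0" using assms by (simp add: \<delta>_def)
  show "summable (\<lambda>n. real_of_int (eta_coeff n) ^ 2 * real n powr (- (8 + (\<sigma> - 9 / 2))) + real n powr (- (1 + (\<sigma> - 9 / 2))))"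
    using assms by (intro summable_add eta_coeff_square_summable) (auto simp: summable_real_powr_iff)
  fix n :: nat assume "n \<ge> 0"
  define X Y where "X = \<bar>real_of_int (eta_coeff n)\<bar> * real n powr (- (8 + \<delta>) / 2)" and "Y = real n powr (- (1 + \<delta>) / 2)"
  have "2 * (X * Y) \<le> X ^ 2 + Y ^ 2" using sum_squares_bound[of X Y] by simp
  moreover have "0 \<le> X * Y" by (simp add: X_def Y_def)
  ultimately have "X * Y \<le> X ^ 2 + Y ^ 2" by linarith
  moreover have "X * Y = \<bar>real_of_int (eta_coeff n)\<bar> * real n powr (- \<sigma>)"
  proof -
    have "- (8 + \<delta>) / 2 + - (1 + \<delta>) / 2 = - \<sigma>" unfolding \<delta>_def by argo
    then have "real n powr (- (8 + \<delta>) / 2) * real n powr (- (1 + \<delta>) / 2) = real n powr (- \<sigma>)"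
      by (simp only: powr_add[symmetric])
    then show ?thesis unfolding X_def Y_def by (simp only: mult.assoc)
  qed
  moreover have p2: "(real n powr t) ^ 2 = real n powr (2 * t)" for t
    unfolding power2_eq_square powr_add[symmetric] by simp
  have "X ^ 2 = real_of_int (eta_coeff n) ^ 2 * real n powr (- (8 + (\<sigma> - 9 / 2)))"
  proof -
    have "2 * (- (8 + \<delta>) / 2) = - (8 + (\<sigma> - 9 / 2))" unfolding \<delta>_def by argo
    then show ?thesis unfolding X_def power_mult_distrib p2 by (simp only: power2_abs)
  qed
  moreover have "Y ^ 2 = real n powr (- (1 + (\<sigma> - 9 / 2)))"
  proof -
    have "2 * (- (1 + \<delta>) / 2) = - (1 + (\<sigma> - 9 / 2))" unfolding \<delta>_def by argo
    then show ?thesis unfolding Y_def p2 by (simp only:)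
  qed
  ultimately show "norm (\<bar>real_of_int (eta_coeff n)\<bar> * real n powr (- \<sigma>)) \<le>
    real_of_int (eta_coeff n) ^ 2 * real n powr (- (8 + (\<sigma> - 9 / 2))) + real n powr (- (1 + (\<sigma> - 9 / 2)))"
    by simp
qed

text \<open>Taken against dy rather than dy/y, so the classical argument is s + 1.\<close>

definition mellin :: "(real \<Rightarrow> complex) \<Rightarrow> complex \<Rightarrow> complex" where
  "mellin h s = integral {0<..} (\<lambda>y. h y * exp (s * of_real (ln y)))"

lemma mellin_kernel_bound:
  fixes h :: "real \<Rightarrow> complex"
  assumes h: "\<And>y. y > 0 \<Longrightarrow> norm (h y) \<le> B * exp (- (k * (y + 1 / y)))" and B: "B > 0" and k: "k > 0"
  shows "\<exists>M>0. \<forall>s. \<bar>Re s\<bar> \<le> A \<longrightarrow> (\<forall>y>0. norm (h y * exp (s * of_real (ln y))) \<le> M * exp (- (k / 2 * y)))"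
proof -
  have "k / 2 > 0" using k by simp
  from powr_le_exp_sym[OF this, of A]
  obtain M where M: "M > 0" "\<And>a y. \<bar>a\<bar> \<le> A \<Longrightarrow> y > 0 \<Longrightarrow> y powr a \<le> M * exp (k / 2 * (y + 1 / y))"
    by blast
  have "norm (h y * exp (s * of_real (ln y))) \<le> B * M * exp (- (k / 2 * y))" if s: "\<bar>Re s\<bar> \<le> A" and y: "y > 0" for s y
  proof -
    have "norm (exp (s * of_real (ln y))) = y powr Re s" using y by (simp add: powr_def mult.commute)
    also have "\<dots> \<le> M * exp (k / 2 * (y + 1 / y))" by (rule M(2)[OF s y])
    finally have "norm (h y * exp (s * of_real (ln y))) \<le> (B * exp (- (k * (y + 1 / y)))) * (M * exp (k / 2 * (y + 1 / y)))"
      unfolding norm_mult using h[OF y] B M by (intro mult_mono) auto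
    also have "\<dots> = B * M * (exp (- (k * (y + 1 / y))) * exp (k / 2 * (y + 1 / y)))" by simp
    also have "exp (- (k * (y + 1 / y))) * exp (k / 2 * (y + 1 / y)) = exp (- (k / 2 * (y + 1 / y)))"
    proof -
      have "- (k * t) + k / 2 * t = - (k / 2 * t)" for t by simp
      then show ?thesis unfolding exp_add[symmetric] by (simp only:)
    qed
    also have "\<dots> \<le> exp (- (k / 2 * y))"
    proof -
      have "k / 2 * y \<le> k / 2 * (y + 1 / y)" using k y by (intro mult_left_mono) auto
      then show ?thesis by simp
    qed
    finally show ?thesis using B M by (simp add: mult_left_mono)
  qed
  moreover have "B * M > 0" using B M by simp
  ultimately show ?thesis by blast
qed

lemma has_integral_norm_bound:
  fixes f :: "real \<Rightarrow> complex"
  assumes "(f has_integral I) S" "(g has_integral J) S" "\<And>y. y \<in> S \<Longrightarrow> norm (f y) \<le> g y"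
  shows "norm I \<le> J"
  using Henstock_Kurzweil_Integration.integral_norm_bound_integral[of f S g] assms
  by (auto simp: has_integral_iff)

lemma mellin_integrable:
  fixes h :: "real \<Rightarrow> complex"
  assumes "continuous_on {0<..} h" "\<And>y. y > 0 \<Longrightarrow> norm (h y) \<le> B * exp (- (k * (y + 1 / y)))" "B > 0" "k > 0"
  shows "(\<lambda>y. h y * exp (s * of_real (ln y))) absolutely_integrable_on {0<..}"
proof -
  obtain M where M: "\<And>y. y > 0 \<Longrightarrow> norm (h y * exp (s * of_real (ln y))) \<le> M * exp (- (k / 2 * y))"
    using mellin_kernel_bound[OF assms(2-4), of "\<bar>Re s\<bar>"] by auto
  show ?thesis
    by (rule absolutely_integrable_exp_decay[where k = "k / 2" and M = M])
       (use assms M in \<open>auto intro!: continuous_intros\<close>)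
qed

text \<open>Integrals over compact intervals are entire in s, and the kernel bound, uniform on
  vertical strips, makes them converge locally uniformly.\<close>

lemma mellin_entire:
  fixes h :: "real \<Rightarrow> complex"
  assumes cont: "continuous_on {0<..} h" and h: "\<And>y. y > 0 \<Longrightarrow> norm (h y) \<le> B * exp (- (k * (y + 1 / y)))"
    and B: "B > 0" and k: "k > 0"
  shows "mellin h holomorphic_on UNIV"
proof -
  define a b where "a = (\<lambda>n::nat. 1 / (real n + 1))" and "b = (\<lambda>n::nat. real n + 1)"
  have a: "a n > 0" "a \<longlonglongrightarrow> 0" for n unfolding a_def by (auto, real_asymp)
  have b: "filterlim b at_top sequentially" unfolding b_def by real_asymp
  have ab: "{a n..b n} \<subseteq> {0<..}" for n using a(1)[of n] by auto
  define F where "F = (\<lambda>s y. h y * exp (s * of_real (ln y)))"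
  define M where "M = (\<lambda>n s. integral {a n..b n} (F s))"
  show ?thesis
  proof (rule holomorphic_uniform_sequence)
    fix n
    have ch: "continuous_on {a n..b n} h" by (rule continuous_on_subset[OF cont ab])
    have "(\<lambda>s. integral (cbox (a n) (b n)) (F s)) holomorphic_on UNIV"
    proof (rule leibniz_rule_holomorphic)
      show "((\<lambda>s. F s y) has_field_derivative (h y * (exp (s * of_real (ln y)) * of_real (ln y)))) (at s within UNIV)" for s y
        unfolding F_def by (auto intro!: derivative_eq_intros)
      show "F s integrable_on cbox (a n) (b n)" for s
        unfolding F_def cbox_interval
        by (intro integrable_continuous_interval continuous_intros ch) (use ab[of n] in force)
      have "continuous_on (UNIV \<times> cbox (a n) (b n)) (\<lambda>x :: complex \<times> real. h (snd x))"
        by (rule continuous_on_compose2[OF ch]) (auto intro!: continuous_intros)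
      then show "continuous_on (UNIV \<times> cbox (a n) (b n)) (\<lambda>(s, y). h y * (exp (s * of_real (ln y)) * of_real (ln y)))"
        unfolding case_prod_unfold
        by (intro continuous_intros) (use ab[of n] in force)+
    qed auto
    then show "M n holomorphic_on UNIV" by (simp add: M_def)
  next
    fix x :: complex
    obtain C where C: "C > 0" "\<And>s y. \<bar>Re s\<bar> \<le> \<bar>Re x\<bar> + 1 \<Longrightarrow> y > 0 \<Longrightarrow> norm (F s y) \<le> C * exp (- (k / 2 * y))"
      unfolding F_def using mellin_kernel_bound[OF h B k, of "\<bar>Re x\<bar> + 1"] by blast
    define g where "g = (\<lambda>y. C * exp (- (k / 2 * y)))"
    have gc: "(\<lambda>y. complex_of_real (g y)) absolutely_integrable_on {0<..}"
      by (rule absolutely_integrable_exp_decay[where k = "k / 2" and M = C])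
         (use k C in \<open>auto simp: g_def norm_mult intro!: continuous_intros\<close>)
    then have "(\<lambda>y. complex_of_real (g y)) integrable_on {0<..}" by (simp add: absolutely_integrable_on_def)
    from integrable_linear[OF this bounded_linear_Re] have gi: "g integrable_on {0<..}" by (simp add: o_def)
    have gi': "g integrable_on {a n..b n}" for n by (rule integrable_on_subinterval[OF gi ab])
    define e where "e = (\<lambda>n. integral {0<..} g - integral {a n..b n} g)"
    have "e \<longlonglongrightarrow> 0"
    proof -
      have "(\<lambda>n. integral {a n..b n} (\<lambda>y. complex_of_real (g y))) \<longlonglongrightarrow> integral {0<..} (\<lambda>y. complex_of_real (g y))"
        by (rule integral_truncation[OF gc a b])
      then have "(\<lambda>n. complex_of_real (integral {a n..b n} g)) \<longlonglongrightarrow> complex_of_real (integral {0<..} g)"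
        using integral_linear[OF gi' bounded_linear_of_real[where 'a = complex]]
          integral_linear[OF gi bounded_linear_of_real[where 'a = complex]]
        by (simp add: o_def)
      then have "(\<lambda>n. integral {a n..b n} g) \<longlonglongrightarrow> integral {0<..} g" by (simp only: tendsto_of_real_iff)
      from tendsto_diff[OF tendsto_const this, of "integral {0<..} g"] show ?thesis unfolding e_def by simp
    qed
    have bound: "norm (mellin h s - M n s) \<le> e n" if s: "s \<in> cball x 1" for s n
    proof -
      have "\<bar>Re s - Re x\<bar> \<le> norm (s - x)" by (metis abs_Re_le_cmod minus_complex.sel(1))
      also have "\<dots> \<le> 1" using s by (simp add: dist_norm norm_minus_commute)
      finally have re: "\<bar>Re s\<bar> \<le> \<bar>Re x\<bar> + 1" by linarith
      have Fi: "F s integrable_on {0<..}"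
        using mellin_integrable[OF cont h B k, of s] by (simp add: F_def absolutely_integrable_on_def)
      have Fi': "F s integrable_on {a n..b n}" by (rule integrable_on_subinterval[OF Fi ab])
      have r: "((\<lambda>y. if y \<in> {a n..b n} then f y else 0) has_integral integral {a n..b n} f) {0<..}"
        if "f integrable_on {a n..b n}" for f :: "real \<Rightarrow> 'c :: euclidean_space"
        by (subst has_integral_restrict[OF ab]) (rule integrable_integral[OF that])
      have "((\<lambda>y. F s y - (if y \<in> {a n..b n} then F s y else 0)) has_integral (integral {0<..} (F s) - integral {a n..b n} (F s))) {0<..}"
        by (intro has_integral_diff r Fi' integrable_integral Fi)
      moreover have "((\<lambda>y. g y - (if y \<in> {a n..b n} then g y else 0)) has_integral (integral {0<..} g - integral {a n..b n} g)) {0<..}"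
        by (intro has_integral_diff r gi' integrable_integral gi)
      ultimately have "norm (integral {0<..} (F s) - integral {a n..b n} (F s)) \<le> integral {0<..} g - integral {a n..b n} g"
        by (rule has_integral_norm_bound) (use C(1) C(2)[OF re] in \<open>simp add: g_def\<close>)
      then show ?thesis by (simp add: mellin_def F_def M_def e_def)
    qed
    have "uniform_limit (cball x 1) M (mellin h) sequentially"
      unfolding uniform_limit_iff
    proof (intro allI impI)
      fix \<epsilon> :: real assume "\<epsilon> > 0"
      then have "\<forall>\<^sub>F n in sequentially. e n < \<epsilon>" using order_tendstoD(2)[OF \<open>e \<longlonglongrightarrow> 0\<close>] by blast
      then show "\<forall>\<^sub>F n in sequentially. \<forall>s\<in>cball x 1. dist (M n s) (mellin h s) < \<epsilon>"
      proof eventually_elim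
        case (elim n)
        show ?case
        proof
          fix s assume "s \<in> cball x 1"
          from bound[OF this, of n] elim show "dist (M n s) (mellin h s) < \<epsilon>"
            by (simp add: dist_norm norm_minus_commute)
        qed
      qed
    qed
    then show "\<exists>d>0. cball x d \<subseteq> UNIV \<and> uniform_limit (cball x d) M (mellin h) sequentially"
      by (intro exI[of _ 1]) auto
  qed simp
qed

text \<open>The substitution y -> c y in the Gamma integral, carried out for the Lebesgue
  integral.\<close>

lemma gamma_integral_scaled:
  assumes z: "Re z > 0" and c: "c > 0"
  shows "(\<lambda>y. exp (- of_real (c * y)) * exp ((z - 1) * of_real (ln y))) absolutely_integrable_on {0<..}"
    and "integral {0<..} (\<lambda>y. exp (- of_real (c * y)) * exp ((z - 1) * of_real (ln y))) =
           Gamma z * exp (- z * of_real (ln c))"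
proof -
  define G where "G = (\<lambda>c y. exp (- complex_of_real (c * y)) * exp ((z - 1) * of_real (ln y)))"
  have G_eq: "G c y = complex_of_real y powr (z - 1) / of_real (exp (c * y))" if "y > 0" for c y
    using that by (simp add: G_def powr_def exp_minus field_simps Ln_of_real exp_of_real[symmetric] of_real_mult del: exp_of_real)
  have int: "G c absolutely_integrable_on {0<..}" if "c > 0" for c
    using absolutely_integrable_Gamma_integral[OF z that]
    by (rule set_integrable_cong[THEN iffD1, rotated -1]) (auto simp: G_eq)
  show "(\<lambda>y. exp (- of_real (c * y)) * exp ((z - 1) * of_real (ln y))) absolutely_integrable_on {0<..}"
    using int[OF c] by (simp add: G_def)
  have G1: "integral {0<..} (G 1) = Gamma z"
  proof -
    have "((\<lambda>t. of_real t powr (z - 1) / of_real (exp t)) has_integral Gamma z) {0<..}"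
      by (rule Gamma_integral_complex'[OF z])
    then have "(G 1 has_integral Gamma z) {0<..}"
      by (rule has_integral_cong[THEN iffD1, rotated]) (simp add: G_eq)
    then show ?thesis by (rule integral_unique)
  qed
  have L: "integral {0<..} (G c) = (\<integral>x. indicator {0<..} x *\<^sub>R G c x \<partial>lborel)" if "c > 0" for c
  proof -
    have "integral {0<..} (G c) = (LINT x:{0<..}|lebesgue. G c x)"
      using set_lebesgue_integral_eq_integral(2)[OF int[OF that]] by simp
    also have "\<dots> = (\<integral>x. indicator {0<..} x *\<^sub>R G c x \<partial>lborel)"
      unfolding set_lebesgue_integral_def
      by (rule integral_completion)
         (auto intro!: borel_measurable_continuous_on_indicator continuous_intros simp: G_def)
    finally show ?thesis .
  qed
  have "integral {0<..} (G 1) = \<bar>c\<bar> *\<^sub>R (\<integral>x. indicator {0<..} (0 + c * x) *\<^sub>R G 1 (0 + c * x) \<partial>lborel)"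
    unfolding L[OF zero_less_one] by (rule lborel_integral_real_affine) (use c in simp)
  also have "(\<lambda>x. indicator {0<..} (0 + c * x) *\<^sub>R G 1 (0 + c * x)) =
     (\<lambda>x. exp ((z - 1) * of_real (ln c)) * (indicator {0<..} x *\<^sub>R G c x))"
  proof
    fix x
    show "indicator {0<..} (0 + c * x) *\<^sub>R G 1 (0 + c * x) = exp ((z - 1) * of_real (ln c)) * (indicator {0<..} x *\<^sub>R G c x)"
    proof (cases "x > 0")
      case True
      then have "exp ((z - 1) * of_real (ln (c * x))) = exp ((z - 1) * of_real (ln c)) * exp ((z - 1) * of_real (ln x))"
        using c by (simp add: ln_mult distrib_left exp_add)
      then show ?thesis using True c by (simp add: G_def)
    next
      case False
      then show ?thesis using c by (simp add: zero_less_mult_iff indicator_def)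
    qed
  qed
  also have "(\<integral>x. exp ((z - 1) * of_real (ln c)) * (indicator {0<..} x *\<^sub>R G c x) \<partial>lborel) =
      exp ((z - 1) * of_real (ln c)) * integral {0<..} (G c)"
    unfolding L[OF c] by (rule integral_mult_right_zero)
  finally have "Gamma z = of_real c * (exp ((z - 1) * of_real (ln c)) * integral {0<..} (G c))"
    unfolding G1 using c by (simp add: scaleR_conv_of_real)
  also have "of_real c * (exp ((z - 1) * of_real (ln c)) * integral {0<..} (G c)) = exp (z * of_real (ln c)) * integral {0<..} (G c)"
  proof -
    have "of_real c = exp (complex_of_real (ln c))" using c by (simp add: exp_of_real)
    then have "of_real c * exp ((z - 1) * of_real (ln c)) = exp (z * of_real (ln c))"
      by (simp only: exp_add[symmetric]) (simp add: algebra_simps)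
    then show ?thesis by (simp add: mult.assoc[symmetric])
  qed
  finally have "Gamma z = exp (z * of_real (ln c)) * integral {0<..} (G c)" .
  then have "Gamma z * exp (- z * of_real (ln c)) = integral {0<..} (G c) * (exp (z * of_real (ln c)) * exp (- z * of_real (ln c)))"
    by (simp add: mult_ac)
  also have "exp (z * of_real (ln c)) * exp (- z * of_real (ln c)) = 1" by (simp flip: exp_add)
  finally show "integral {0<..} (\<lambda>y. exp (- of_real (c * y)) * exp ((z - 1) * of_real (ln y))) =
           Gamma z * exp (- z * of_real (ln c))"
    by (simp add: G_def)
qed

text \<open>Termwise integration is allowed since the norms of the terms integrate to Gamma
  integrals at Re z, that is, to a constant times the absolute Dirichlet series.\<close>

lemma dirichlet_mellin:
  fixes a :: "nat \<Rightarrow> complex"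
  assumes z: "Re z > 0"
    and h: "\<And>y. y > 0 \<Longrightarrow> (\<lambda>n. a n * exp (- of_real (2 * pi * real n * y))) sums h y"
    and abs: "\<And>y. y > 0 \<Longrightarrow> summable (\<lambda>n. norm (a n) * exp (- (2 * pi * real n * y)))"
    and int: "(\<lambda>y. h y * exp ((z - 1) * of_real (ln y))) absolutely_integrable_on {0<..}"
    and a0: "a 0 = 0" and dir: "summable (\<lambda>n. norm (a n) * real n powr (- Re z))"
  shows "(\<lambda>n. a n * (Gamma z * exp (- z * of_real (ln (2 * pi * real n))))) sums mellin h (z - 1)"
proof -
  define F where "F = (\<lambda>w n y. exp (- complex_of_real (2 * pi * real n * y)) * exp ((w - 1) * of_real (ln y)))"
  define f where "f = (\<lambda>n y. indicat_real {0<..} y *\<^sub>R (a n * F z n y))"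
  have c: "2 * pi * real n > 0" if "n \<noteq> 0" for n using that by simp
  have G: "F w n absolutely_integrable_on {0<..}"
    "integral {0<..} (F w n) = Gamma w * exp (- w * of_real (ln (2 * pi * real n)))"
    if "n \<noteq> 0" "Re w > 0" for n w
    using gamma_integral_scaled[OF that(2) c[OF that(1)]] by (simp_all only: F_def)
  have aG: "(\<lambda>y. a n * F z n y) absolutely_integrable_on {0<..}" for n
    by (cases "n = 0") (auto simp: a0 intro!: set_integrable_mult_right G z)
  have integral_f: "integral\<^sup>L lebesgue (f n) = a n * (Gamma z * exp (- z * of_real (ln (2 * pi * real n))))" for n
  proof (cases "n = 0")
    case False
    have "integral\<^sup>L lebesgue (f n) = integral {0<..} (\<lambda>y. a n * F z n y)"
      using set_lebesgue_integral_eq_integral(2)[OF aG, of n] unfolding f_def set_lebesgue_integral_def .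
    then show ?thesis using G(2)[OF False z] by simp
  qed (simp add: f_def a0)
  define s where "s = complex_of_real (Re z)"
  have s: "Re s > 0" using z by (simp add: s_def)
  have norm_F: "complex_of_real (norm (F z n y)) = F s n y" for n y
  proof -
    have "F s n y = complex_of_real (exp (- (2 * pi * real n * y)) * exp ((Re z - 1) * ln y))"
      by (simp add: F_def s_def exp_of_real[symmetric] del: exp_of_real)
    moreover have "norm (F z n y) = exp (- (2 * pi * real n * y)) * exp ((Re z - 1) * ln y)"
      by (simp add: F_def norm_mult)
    ultimately show ?thesis by simp
  qed
  have norm_term: "(\<integral>y. norm (f n y) \<partial>lebesgue) =
      norm (a n) * real n powr (- Re z) * (Re (Gamma s) * (2 * pi) powr (- Re z))" for n
  proof (cases "n = 0")
    case False
    have "complex_of_real (\<integral>y. norm (f n y) \<partial>lebesgue) = (\<integral>y. complex_of_real (norm (f n y)) \<partial>lebesgue)"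
      by (rule integral_complex_of_real[symmetric])
    also have "\<dots> = (LINT y:{0<..}|lebesgue. of_real (norm (a n)) * F s n y)"
      unfolding set_lebesgue_integral_def norm_F[symmetric]
      by (rule Bochner_Integration.integral_cong) (auto simp: f_def norm_mult indicator_def)
    also have "\<dots> = integral {0<..} (\<lambda>y. of_real (norm (a n)) * F s n y)"
      by (rule set_lebesgue_integral_eq_integral(2)) (intro set_integrable_mult_right G False s)
    also have "\<dots> = of_real (norm (a n)) * (Gamma s * exp (- s * of_real (ln (2 * pi * real n))))"
      using G(2)[OF False s] by simp
    also have "exp (- s * of_real (ln (2 * pi * real n))) = complex_of_real (exp (- Re z * ln (2 * pi * real n)))"
      by (simp add: s_def exp_of_real[symmetric] del: exp_of_real)
    also have "exp (- Re z * ln (2 * pi * real n)) = (2 * pi) powr (- Re z) * real n powr (- Re z)"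
    proof -
      have "exp (- Re z * ln (2 * pi * real n)) = (2 * pi * real n) powr (- Re z)"
        using False by (simp add: powr_def)
      then show ?thesis by (simp add: powr_mult)
    qed
    finally have "Re (complex_of_real (\<integral>y. norm (f n y) \<partial>lebesgue)) =
      Re (of_real (norm (a n)) * (Gamma s * complex_of_real ((2 * pi) powr (- Re z) * real n powr (- Re z))))"
      by (rule arg_cong)
    then show ?thesis by (simp add: mult_ac)
  qed (simp add: f_def a0)
  have "(\<lambda>n. integral\<^sup>L lebesgue (f n)) sums (\<integral>y. (\<Sum>n. f n y) \<partial>lebesgue)"
  proof (rule sums_integral)
    show "integrable lebesgue (f n)" for n
      using aG[of n] by (simp add: f_def set_integrable_def)
    have "summable (\<lambda>n. norm (f n y))" for y
    proof (cases "y > 0")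
      case True
      have "norm (f n y) = norm (a n) * exp (- (2 * pi * real n * y)) * norm (exp ((z - 1) * of_real (ln y)))" for n
        using True by (simp add: f_def F_def norm_mult)
      then show ?thesis using summable_mult2[OF abs[OF True]] by (simp only:)
    qed (simp add: f_def)
    then show "AE y in lebesgue. summable (\<lambda>n. norm (f n y))" by simp
    show "summable (\<lambda>n. \<integral>y. norm (f n y) \<partial>lebesgue)"
      unfolding norm_term by (intro summable_mult2 dir)
  qed
  also have "(\<integral>y. (\<Sum>n. f n y) \<partial>lebesgue) = (LINT y:{0<..}|lebesgue. h y * exp ((z - 1) * of_real (ln y)))"
    unfolding set_lebesgue_integral_def
  proof (rule Bochner_Integration.integral_cong[OF refl])
    fix y
    show "(\<Sum>n. f n y) = indicat_real {0<..} y *\<^sub>R (h y * exp ((z - 1) * of_real (ln y)))"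
    proof (cases "y > 0")
      case True
      have "(\<lambda>n. f n y) = (\<lambda>n. a n * exp (- of_real (2 * pi * real n * y)) * exp ((z - 1) * of_real (ln y)))"
        using True by (simp add: f_def F_def mult.assoc fun_eq_iff)
      then show ?thesis using sums_mult2[OF h[OF True]] True by (simp add: sums_iff)
    qed (simp add: f_def)
  qed
  also have "\<dots> = mellin h (z - 1)"
    unfolding mellin_def by (rule set_lebesgue_integral_eq_integral(2)[OF int])
  finally show ?thesis unfolding integral_f .
qed

lemma eta_fun_line_sum_bound:
  fixes c :: "'a \<Rightarrow> complex"
  assumes "finite A" "\<And>u. u \<in> A \<Longrightarrow> x u \<in> \<rat>"
  shows "\<exists>B>0. \<exists>k>0. \<forall>y>0. norm (\<Sum>u\<in>A. c u * eta_fun (of_real (x u) + \<i> * of_real y)) \<le> B * exp (- (k * (y + 1 / y)))"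
  using assms
proof (induction A rule: finite_induct)
  case empty
  show ?case by (auto intro!: exI[of _ "1 :: real"])
next
  case (insert u A)
  then obtain B1 k1 where 1: "B1 > 0" "k1 > 0" "\<And>y. y > 0 \<Longrightarrow>
    norm (\<Sum>u\<in>A. c u * eta_fun (of_real (x u) + \<i> * of_real y)) \<le> B1 * exp (- (k1 * (y + 1 / y)))" by auto
  obtain B2 k2 where 2: "B2 > 0" "k2 > 0" "\<And>y. y > 0 \<Longrightarrow>
    norm (eta_fun (of_real (x u) + \<i> * of_real y)) \<le> B2 * exp (- (k2 * (y + 1 / y)))"
    using eta_fun_line_bound[of "x u"] insert.prems by auto
  define k where "k = min k1 k2"
  have mono: "exp (- (k' * (y + 1 / y))) \<le> exp (- (k * (y + 1 / y)))" if "k \<le> k'" "y > 0" for k' y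
    using that by (auto intro!: mult_right_mono)
  have "norm (\<Sum>u\<in>insert u A. c u * eta_fun (of_real (x u) + \<i> * of_real y)) \<le> (norm (c u) * B2 + B1) * exp (- (k * (y + 1 / y)))"
    if y: "y > 0" for y
  proof -
    have "norm (\<Sum>u\<in>insert u A. c u * eta_fun (of_real (x u) + \<i> * of_real y)) \<le>
      norm (c u * eta_fun (of_real (x u) + \<i> * of_real y)) + norm (\<Sum>u\<in>A. c u * eta_fun (of_real (x u) + \<i> * of_real y))"
      unfolding sum.insert[OF insert.hyps] by (rule norm_triangle_ineq)
    also have "\<dots> \<le> norm (c u) * (B2 * exp (- (k2 * (y + 1 / y)))) + B1 * exp (- (k1 * (y + 1 / y)))"
      unfolding norm_mult using 1 2 y by (intro add_mono mult_left_mono) auto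
    also have "\<dots> \<le> norm (c u) * (B2 * exp (- (k * (y + 1 / y)))) + B1 * exp (- (k * (y + 1 / y)))"
      using 1 2 y by (intro add_mono mult_left_mono mono) (auto simp: k_def)
    finally show ?thesis by (simp add: distrib_right mult.assoc)
  qed
  moreover have "norm (c u) * B2 + B1 > 0" using 1 2 by (simp add: add_nonneg_pos)
  moreover have "k > 0" using 1 2 by (simp add: k_def)
  ultimately show ?case by blast
qed

section \<open>Gauss sums, the twisted form and its Mellin transform\<close>

context odd_residue_character
begin

definition gauss_sum :: complex where
  "gauss_sum = (\<Sum>u\<in>{1..p - 1}. of_int (chi u) * exp (2 * of_real pi * \<i> * (of_int u / of_int p)))"

lemma chi_0: "p dvd n \<Longrightarrow> chi n = 0"
  using chi_cong[of n 0] chi_uminus[of 0] by (simp add: cong_0_iff)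

lemma norm_chi_le: "\<bar>chi n\<bar> \<le> 1"
proof (cases "p dvd n")
  case False
  then have "(chi n) ^ 2 \<le> 1" using chi_sq by (simp add: power2_eq_square)
  then show ?thesis by (simp only: abs_square_le_1)
qed (simp add: chi_0)

lemma sum_chi: "(\<Sum>u\<in>{1..p - 1}. chi u) = 0"
proof -
  have "(\<Sum>u\<in>{1..p - 1}. chi u) = (\<Sum>u\<in>{1..p - 1}. chi (p - u))"
    by (rule sum.reindex_bij_witness[of _ "\<lambda>u. p - u" "\<lambda>u. p - u"]) auto
  also have "\<dots> = (\<Sum>u\<in>{1..p - 1}. - chi u)"
    by (intro sum.cong refl) (use chi_cong chi_uminus in \<open>simp add: cong_iff_dvd_diff flip: chi_uminus\<close>)
  finally show ?thesis by (simp add: sum_negf)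
qed

lemma exp_residue_cong:
  assumes "[k = l] (mod p)"
  shows "exp (2 * of_real pi * \<i> * (of_int k / of_int p)) = exp (2 * of_real pi * \<i> * (of_int l / of_int p))"
proof -
  from assms obtain m where m: "k = l + p * m" by (metis cong_iff_lin cong_sym)
  have "of_int p \<noteq> (0 :: complex)" using p_ge_3 by simp
  then have "2 * of_real pi * \<i> * (of_int k / of_int p) = 2 * of_real pi * \<i> * (of_int l / of_int p) + (of_int (2 * m) * pi) * \<i>"
    by (simp add: m field_simps)
  then show ?thesis unfolding exp_eq by blast
qed

text \<open>If p does not divide n, multiplication by n permutes the residues. If it does, both
  sides vanish, the left one because the values of chi sum to 0; so all coefficients of the twist
  are covered.\<close>

lemma gauss_sum_twist:
  "(\<Sum>u\<in>{1..p - 1}. of_int (chi u) * exp (2 * of_real pi * \<i> * (of_int (n * u) / of_int p))) = of_int (chi n) * gauss_sum"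
proof (cases "p dvd n")
  case True
  have "exp (2 * of_real pi * \<i> * (of_int (n * u) / of_int p)) = 1" for u
    using exp_residue_cong[of "n * u" 0] True by (simp add: cong_0_iff)
  then have "(\<Sum>u\<in>{1..p - 1}. of_int (chi u) * exp (2 * of_real pi * \<i> * (of_int (n * u) / of_int p))) =
    of_int (\<Sum>u\<in>{1..p - 1}. chi u)" by simp
  then show ?thesis using True by (simp only: sum_chi chi_0 of_int_0 mult_zero_left)
next
  case False
  define r where "r = (\<lambda>u. (n * u) mod p)"
  have "coprime n p" using prime_imp_coprime[OF prime_p False] by (simp add: coprime_commute)
  have inj: "inj_on r {1..p - 1}"
  proof
    fix u v assume uv: "u \<in> {1..p - 1}" "v \<in> {1..p - 1}" "r u = r v"
    then have "[n * u = n * v] (mod p)" by (simp add: r_def cong_def)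
    then have "[u = v] (mod p)" using \<open>coprime n p\<close> by (simp add: cong_mult_lcancel)
    then show "u = v" using uv by (simp add: cong_def)
  qed
  have sub: "r ` {1..p - 1} \<subseteq> {1..p - 1}"
  proof
    fix v assume "v \<in> r ` {1..p - 1}"
    then obtain u where "u \<in> {1..p - 1}" "v = r u" by blast
    then have u: "0 < u" "u < p" "v = (n * u) mod p" by (auto simp: r_def)
    have "\<not> p dvd n * u" using False not_dvd_small[OF u(1,2)] prime_p by (simp add: prime_dvd_mult_iff)
    then have "v \<noteq> 0" using u(3) by (auto simp: dvd_eq_mod_eq_0)
    moreover have "0 \<le> v" "v < p" using u p_ge_3 by auto
    ultimately show "v \<in> {1..p - 1}" by simp
  qed
  have bij: "bij_betw r {1..p - 1} {1..p - 1}"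
    unfolding bij_betw_def using inj endo_inj_surj[OF _ sub inj] by simp
  have rc: "[n * u = r u] (mod p)" for u by (simp add: r_def cong_def)
  have "chi u = chi n * chi (r u)" for u
  proof -
    have "chi (r u) = chi n * chi u" using chi_cong[OF rc[of u]] chi_mult by simp
    then show ?thesis using chi_sq[OF False] by (simp add: mult.assoc[symmetric])
  qed
  then have "(\<Sum>u\<in>{1..p - 1}. of_int (chi u) * exp (2 * of_real pi * \<i> * (of_int (n * u) / of_int p))) =
    (\<Sum>u\<in>{1..p - 1}. of_int (chi n) * (of_int (chi (r u)) * exp (2 * of_real pi * \<i> * (of_int (r u) / of_int p))))"
    by (intro sum.cong refl) (metis exp_residue_cong[OF rc] of_int_mult mult.assoc)
  also have "\<dots> = of_int (chi n) * (\<Sum>u\<in>{1..p - 1}. of_int (chi (r u)) * exp (2 * of_real pi * \<i> * (of_int (r u) / of_int p)))"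
    by (simp only: sum_distrib_left)
  also have "(\<Sum>u\<in>{1..p - 1}. of_int (chi (r u)) * exp (2 * of_real pi * \<i> * (of_int (r u) / of_int p))) = gauss_sum"
    unfolding gauss_sum_def by (rule sum.reindex_bij_betw[OF bij])
  finally show ?thesis .
qed

definition twist_fun :: "real \<Rightarrow> complex" where
  "twist_fun y = (\<Sum>u\<in>{1..p - 1}. of_int (chi u) * eta_fun (of_real (real_of_int u / real_of_int p) + \<i> * of_real y))"

lemma continuous_on_twist_fun: "continuous_on {0<..} twist_fun"
  unfolding twist_fun_def by (intro continuous_intros continuous_on_eta_line)

lemma twist_fun_bound: "\<exists>B>0. \<exists>k>0. \<forall>y>0. norm (twist_fun y) \<le> B * exp (- (k * (y + 1 / y)))"
  unfolding twist_fun_def by (rule eta_fun_line_sum_bound) auto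

lemma twist_fun_sums:
  assumes y: "y > 0"
  shows "(\<lambda>n. of_int (eta_coeff n * chi n) * gauss_sum * exp (- of_real (2 * pi * real n * y))) sums twist_fun y"
proof -
  let ?z = "\<lambda>u. of_real (real_of_int u / real_of_int p) + \<i> * of_real y"
  have e: "exp (2 * of_real pi * \<i> * of_nat n * ?z u) =
    exp (2 * of_real pi * \<i> * (of_int (int n * u) / of_int p)) * exp (- of_real (2 * pi * real n * y))" for n u
  proof -
    have "2 * of_real pi * \<i> * of_nat n * ?z u =
      2 * of_real pi * \<i> * (of_int (int n * u) / of_int p) + - of_real (2 * pi * real n * y)"
      by (simp add: distrib_left) (simp add: mult.assoc[symmetric])
    then show ?thesis by (simp only: exp_add)
  qed
  have "(\<lambda>n. \<Sum>u\<in>{1..p - 1}. of_int (chi u) * (of_int (eta_coeff n) * exp (2 * of_real pi * \<i> * of_nat n * ?z u))) sums twist_fun y"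
    unfolding twist_fun_def by (intro sums_sum sums_mult eta_fun_sums) (use y in simp)
  also have "(\<lambda>n. \<Sum>u\<in>{1..p - 1}. of_int (chi u) * (of_int (eta_coeff n) * exp (2 * of_real pi * \<i> * of_nat n * ?z u))) =
    (\<lambda>n. of_int (eta_coeff n) * exp (- of_real (2 * pi * real n * y)) *
       (\<Sum>u\<in>{1..p - 1}. of_int (chi u) * exp (2 * of_real pi * \<i> * (of_int (int n * u) / of_int p))))"
    unfolding e by (simp only: sum_distrib_left mult_ac)
  finally show ?thesis unfolding gauss_sum_twist by (simp add: mult_ac)
qed

text \<open>On the line over u/p the form p z - u is i p y, and i (i p y)^3 = p^3 y^3.\<close>

lemma period_eq_moment:
  assumes "x = real_of_int u / real_of_int p"
  shows "period x 0 p (- real_of_int u) = of_int p ^ 3 * integral {0<..} (\<lambda>y. eta_fun (of_real x + \<i> * of_real y) * of_real y ^ 3)"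
    and "(\<lambda>y. eta_fun (of_real x + \<i> * of_real y) * of_real y ^ 3) integrable_on {0<..}"
proof -
  have p: "of_int p \<noteq> (0 :: complex)" using p_ge_3 by simp
  have q: "\<i> * (eta_fun (of_real x + \<i> * of_real y) * qform 0 p (- real_of_int u) (of_real x + \<i> * of_real y) ^ 3) =
    of_int p ^ 3 * (eta_fun (of_real x + \<i> * of_real y) * of_real y ^ 3)" for y
  proof -
    have "qform 0 p (- real_of_int u) (of_real x + \<i> * of_real y) = \<i> * (of_int p * of_real y)"
      using p by (simp add: qform_def assms distrib_left mult.left_commute)
    moreover have "\<i> * (f * (\<i> * (P * Y)) ^ 3) = P ^ 3 * (f * Y ^ 3)" for f P Y :: complex
    proof -
      have "(\<i> * (P * Y)) ^ 3 = - \<i> * (P ^ 3 * Y ^ 3)"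
        unfolding power_mult_distrib by (simp add: power3_eq_cube)
      then show ?thesis by (simp add: mult.left_commute[of f])
    qed
    ultimately show ?thesis by (simp only:)
  qed
  show "period x 0 p (- real_of_int u) = of_int p ^ 3 * integral {0<..} (\<lambda>y. eta_fun (of_real x + \<i> * of_real y) * of_real y ^ 3)"
    unfolding period_def q by (rule integral_mult_right)
  have "x \<in> \<rat>" using assms by simp
  then have "(\<lambda>y. of_int p ^ 3 * (eta_fun (of_real x + \<i> * of_real y) * of_real y ^ 3)) integrable_on {0<..}"
    using period_integrable[of x 0 p "- real_of_int u"] unfolding q absolutely_integrable_on_def by blast
  from integrable_on_mult_right[OF this, of "1 / of_int p ^ 3"] p
  show "(\<lambda>y. eta_fun (of_real x + \<i> * of_real y) * of_real y ^ 3) integrable_on {0<..}" by simp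
qed

text \<open>This is \<open>period_sum\<close>; its minus sign disappears because s2 is minus the
  second moment.\<close>

lemma mellin_twist_fun_3:
  "of_int p ^ 3 * Im (mellin twist_fun 3) = 120 * axis_moment 2 * central_sum"
proof -
  interpret period_cocycle p chi "\<lambda>x a b c. Im (period x a b c)" "axis_moment 0" "- axis_moment 2"
    by (rule period_cocycle_Im_period)
  let ?m = "\<lambda>u::int. integral {0<..} (\<lambda>y. eta_fun (of_real (real_of_int u / real_of_int p) + \<i> * of_real y) * of_real y ^ 3)"
  have "mellin twist_fun 3 = integral {0<..} (\<lambda>y. \<Sum>u\<in>{1..p - 1}.
      of_int (chi u) * (eta_fun (of_real (real_of_int u / real_of_int p) + \<i> * of_real y) * of_real y ^ 3))"
    unfolding mellin_def
  proof (rule integral_cong)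
    fix y :: real assume "y \<in> {0<..}"
    then have y: "y > 0" by simp
    have "exp (3 * complex_of_real (ln y)) = of_real (exp (ln y)) ^ 3"
      by (simp add: exp_of_nat_mult[of 3, simplified] exp_of_real del: exp_ln)
    then have "exp (3 * complex_of_real (ln y)) = of_real y ^ 3" using y by simp
    then show "twist_fun y * exp (3 * complex_of_real (ln y)) = (\<Sum>u\<in>{1..p - 1}.
      of_int (chi u) * (eta_fun (of_real (real_of_int u / real_of_int p) + \<i> * of_real y) * of_real y ^ 3))"
      by (simp only: twist_fun_def sum_distrib_right mult.assoc)
  qed
  also have "\<dots> = (\<Sum>u\<in>{1..p - 1}. of_int (chi u) * ?m u)"
  proof -
    have "(\<lambda>y. of_int (chi u) * (eta_fun (of_real (real_of_int u / real_of_int p) + \<i> * of_real y) * of_real y ^ 3))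
        integrable_on {0<..}" for u
      by (intro integrable_on_mult_right period_eq_moment(2)[OF refl])
    from integral_sum[OF finite_atLeastAtMost_int this] show ?thesis by (simp only: integral_mult_right)
  qed
  finally have m: "mellin twist_fun 3 = (\<Sum>u\<in>{1..p - 1}. of_int (chi u) * ?m u)" .
  have Im_of_int: "Im (of_int c * w) = of_int c * Im w" for c w by simp
  have "Im (period (real_of_int u / real_of_int p) 0 p (- real_of_int u)) = of_int p ^ 3 * Im (?m u)" for u
  proof -
    have "Im (of_int p ^ 3 * w) = of_int p ^ 3 * Im w" for w
      using Im_of_int[of "p ^ 3" w] by (simp only: of_int_power)
    then show ?thesis by (simp only: period_eq_moment(1)[OF refl])
  qed
  then have "(\<Sum>u\<in>{1..p - 1}. chi u * (of_int p ^ 3 * Im (?m u))) = 120 * axis_moment 2 * central_sum"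
    using period_sum by simp
  then show ?thesis
    unfolding m Im_sum Im_of_int by (simp add: sum_distrib_left mult_ac)
qed

text \<open>The Mellin formula solved for L. Multiplying by the entire \<open>rGamma\<close> instead
  of dividing by Gamma keeps the result entire. At s = 1/2 the transform is taken at 3 and the Gamma
  factor at 4.\<close>

definition twisted_L :: "complex \<Rightarrow> complex" where
  "twisted_L s = mellin twist_fun (s + 5 / 2) * exp ((s + 7 / 2) * of_real (ln (2 * pi))) * rGamma (s + 7 / 2) / gauss_sum"

lemma twisted_L_entire: "twisted_L holomorphic_on UNIV"
proof -
  obtain B k where "B > 0" "k > 0" "\<And>y. y > 0 \<Longrightarrow> norm (twist_fun y) \<le> B * exp (- (k * (y + 1 / y)))"
    using twist_fun_bound by blast
  then have "mellin twist_fun holomorphic_on UNIV" by (intro mellin_entire continuous_on_twist_fun)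
  then have "(mellin twist_fun \<circ> (\<lambda>s. s + 5 / 2)) holomorphic_on UNIV"
    by (intro holomorphic_on_compose_gen[of _ _ _ UNIV] holomorphic_intros) auto
  then show ?thesis
    unfolding twisted_L_def divide_inverse[of _ gauss_sum] by (intro holomorphic_intros) (auto simp: o_def)
qed

context
  assumes QR: "QuadRes p (- 2)"
begin

lemma mellin_twist_fun_3_nonzero: "mellin twist_fun 3 \<noteq> 0"
proof
  assume "mellin twist_fun 3 = 0"
  then have "central_sum = 0" using mellin_twist_fun_3 axis_moment_2_pos by simp
  then show False using central_sum_odd[OF QR] by simp
qed

text \<open>A vanishing Gauss sum would annihilate the twisted form, hence its Mellin transform,
  which is nonzero at 3.\<close>

lemma gauss_sum_nonzero: "gauss_sum \<noteq> 0"
proof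
  assume "gauss_sum = 0"
  then have 0: "twist_fun y = 0" if "y > 0" for y
    using twist_fun_sums[OF that] by (simp add: sums_iff)
  have "mellin twist_fun 3 = integral {0<..} (\<lambda>y :: real. 0)"
    unfolding mellin_def by (intro integral_cong) (use 0 in simp)
  then show False using mellin_twist_fun_3_nonzero by simp
qed

lemma twisted_L_central_nonzero: "twisted_L (1 / 2) \<noteq> 0"
proof -
  have "rGamma (4 :: complex) \<noteq> 0" by (simp add: rGamma_eq_zero_iff nonpos_Ints_def)
  then show ?thesis
    using mellin_twist_fun_3_nonzero gauss_sum_nonzero by (simp add: twisted_L_def)
qed

text \<open>This is \<open>dirichlet_mellin\<close> at z = s + 7/2, with the Gamma factor, the
  powers of 2 pi and the Gauss sum removed.\<close>

lemma twisted_L_sums: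
  assumes s: "Re s > 1"
  shows "(\<lambda>n. of_int (eta_coeff n * chi n) / of_nat n powr (s + 7 / 2)) sums twisted_L s"
proof -
  define z where "z = s + 7 / 2"
  have z: "Re z > 9 / 2" using s by (simp add: z_def)
  define a where "a = (\<lambda>n::nat. of_int (eta_coeff n * chi n) * gauss_sum)"
  have a: "norm (a n) \<le> norm gauss_sum * \<bar>real_of_int (eta_coeff n)\<bar>" for n
  proof -
    have "\<bar>real_of_int (chi n)\<bar> \<le> 1" using norm_chi_le[of n] by linarith
    then have "\<bar>real_of_int (eta_coeff n)\<bar> * \<bar>real_of_int (chi n)\<bar> \<le> \<bar>real_of_int (eta_coeff n)\<bar>"
      by (simp add: mult_left_le)
    then have "(\<bar>real_of_int (eta_coeff n)\<bar> * \<bar>real_of_int (chi n)\<bar>) * norm gauss_sum \<le> \<bar>real_of_int (eta_coeff n)\<bar> * norm gauss_sum"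
      by (rule mult_right_mono) simp
    then show ?thesis by (simp add: a_def norm_mult mult_ac)
  qed
  have comp: "summable (\<lambda>n. norm (a n) * t n)"
    if "summable (\<lambda>n. \<bar>real_of_int (eta_coeff n)\<bar> * t n)" "\<And>n. t n \<ge> 0" for t
  proof (rule summable_comparison_test')
    show "summable (\<lambda>n. norm gauss_sum * (\<bar>real_of_int (eta_coeff n)\<bar> * t n))" by (intro summable_mult that)
    show "norm (norm (a n) * t n) \<le> norm gauss_sum * (\<bar>real_of_int (eta_coeff n)\<bar> * t n)" for n
      using mult_right_mono[OF a that(2), of n] that(2)[of n] by (simp add: mult.assoc abs_mult)
  qed
  obtain B k where Bk: "B > 0" "k > 0" "\<And>y. y > 0 \<Longrightarrow> norm (twist_fun y) \<le> B * exp (- (k * (y + 1 / y)))"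
    using twist_fun_bound by blast
  have "(\<lambda>n. a n * (Gamma z * exp (- z * of_real (ln (2 * pi * real n))))) sums mellin twist_fun (z - 1)"
  proof (rule dirichlet_mellin)
    show "(\<lambda>n. a n * exp (- of_real (2 * pi * real n * y))) sums twist_fun y" if "y > 0" for y
      unfolding a_def by (rule twist_fun_sums[OF that])
    show "summable (\<lambda>n. norm (a n) * exp (- (2 * pi * real n * y)))" if "y > 0" for y
    proof (rule comp)
      have "exp (- (2 * pi * real n * y)) = exp (- (2 * pi * y)) ^ n" for n
        by (simp add: exp_of_nat_mult[symmetric] mult_ac)
      then show "summable (\<lambda>n. \<bar>real_of_int (eta_coeff n)\<bar> * exp (- (2 * pi * real n * y)))"
        using eta_coeff_summable[of "exp (- (2 * pi * y))"] that by simp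
    qed simp
    show "summable (\<lambda>n. norm (a n) * real n powr (- Re z))"
      by (intro comp eta_coeff_dirichlet_summable z) simp
    show "(\<lambda>y. twist_fun y * exp ((z - 1) * of_real (ln y))) absolutely_integrable_on {0<..}"
      by (rule mellin_integrable[OF continuous_on_twist_fun Bk(3,1,2)])
    show "a 0 = 0" by (simp add: a_def chi_0)
  qed (use z in simp)
  from sums_mult2[OF this, of "exp (z * of_real (ln (2 * pi))) * rGamma z / gauss_sum"]
  have "(\<lambda>n. a n * (Gamma z * exp (- z * of_real (ln (2 * pi * real n)))) * (exp (z * of_real (ln (2 * pi))) * rGamma z / gauss_sum))
    sums (mellin twist_fun (z - 1) * (exp (z * of_real (ln (2 * pi))) * rGamma z / gauss_sum))" .
  also have "mellin twist_fun (z - 1) * (exp (z * of_real (ln (2 * pi))) * rGamma z / gauss_sum) = twisted_L s"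
    by (simp add: twisted_L_def z_def add.commute algebra_simps)
  also have "(\<lambda>n. a n * (Gamma z * exp (- z * of_real (ln (2 * pi * real n)))) * (exp (z * of_real (ln (2 * pi))) * rGamma z / gauss_sum)) =
    (\<lambda>n. of_int (eta_coeff n * chi n) / of_nat n powr (s + 7 / 2))"
  proof
    fix n :: nat
    show "a n * (Gamma z * exp (- z * of_real (ln (2 * pi * real n)))) * (exp (z * of_real (ln (2 * pi))) * rGamma z / gauss_sum) =
      of_int (eta_coeff n * chi n) / of_nat n powr (s + 7 / 2)"
    \<comment> \<open>At n = 0 both sides are 0, because chi vanishes there.\<close>
    proof (cases "n = 0")
      case False
      have "z \<notin> \<int>\<^sub>\<le>\<^sub>0" using z by (auto elim!: nonpos_Ints_cases)
      then have G: "Gamma z * rGamma z = 1" by (simp add: Gamma_def rGamma_eq_zero_iff)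
      have "ln (2 * pi * real n) = ln (2 * pi) + ln (real n)" using False by (intro ln_mult_pos) auto
      then have "- z * of_real (ln (2 * pi * real n)) + z * of_real (ln (2 * pi)) = - (z * of_real (ln (real n)))"
        by (simp add: algebra_simps)
      then have "exp (- z * of_real (ln (2 * pi * real n))) * exp (z * of_real (ln (2 * pi))) = exp (- (z * of_real (ln (real n))))"
        by (simp only: exp_add[symmetric])
      also have "\<dots> = 1 / of_nat n powr z"
        using False by (simp add: powr_def exp_minus Ln_of_nat field_simps)
      finally have e: "exp (- z * of_real (ln (2 * pi * real n))) * exp (z * of_real (ln (2 * pi))) = 1 / of_nat n powr z" .
      have "a n * (Gamma z * exp (- z * of_real (ln (2 * pi * real n)))) * (exp (z * of_real (ln (2 * pi))) * rGamma z / gauss_sum) =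
        a n / gauss_sum * (Gamma z * rGamma z) * (exp (- z * of_real (ln (2 * pi * real n))) * exp (z * of_real (ln (2 * pi))))"
        by (simp add: mult_ac)
      then show ?thesis unfolding G e using gauss_sum_nonzero by (simp add: a_def z_def)
    qed (simp add: a_def chi_0)
  qed
  finally show ?thesis .
qed

end

end

theorem theorem5p2:
  fixes \<Delta> :: int
  assumes "prime (- \<Delta>)"
    and "\<Delta> mod 8 = 5"
    and "embeds_in_D \<Delta>"
  shows "\<exists>L. is_twisted_L \<Delta> L \<and> L (1 / 2) \<noteq> 0"
proof -
  define p where "p = nat (- \<Delta>)"
  have D: "\<Delta> = - int p" using prime_gt_0_int[OF assms(1)] by (simp add: p_def)
  have p: "prime p" "p mod 8 = 3" using assms(1,2) unfolding D by (simp, presburger)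
  interpret odd_residue_character "int p" "\<lambda>n. Legendre n p" by (rule odd_residue_character_Legendre[OF p])
  note QR = QuadRes_minus_2[OF p]
  have "twisted_coeff \<Delta> n = of_int (eta_coeff n * Legendre n p)" for n
    by (simp add: twisted_coeff_def D kronecker_eq_Legendre[OF p])
  then have "is_twisted_L \<Delta> twisted_L"
    unfolding is_twisted_L_def using twisted_L_entire twisted_L_sums[OF QR] by simp
  then show ?thesis using twisted_L_central_nonzero[OF QR] by blast
qed

end
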